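(* Let $\mathcal{Q}$ be a Dynkin quiver, $M$ a finite dimensional representation of $\mathcal{Q}$, ${\bf e}$ a dimension vector for $\mathcal{Q}$, and $[N]\in{\rm gsub}_{\bf e}(M)$ a generic subrepresentation type. For every point $(U\subset M)$ in ${\rm Gr}_{\bf e}(M)$, there is an isomorphism $$\pi_{[N]}^{-1}(U\subset M)\simeq{\rm Gr}_{{\bf dim}\,\widehat{N}-{\bf dim}\,\widehat{U}}(\widehat{M}/\widehat{U}).$$
   Context: $k$ is an algebraically closed field, $\mathcal{Q}$ a Dynkin quiver (an orientation of a simply laced Dynkin diagram) with vertex set $\mathcal{Q}_0$, $\bmod\,k\mathcal{Q}$ the category of finite dimensional representations of $\mathcal{Q}$, $P_i$ the indecomposable projective with simple top $S_i$. $\mathcal{H}_{\mathcal{Q}}$ is the category whose objects are injective maps $\iota:P\to Q$ (also written $P\subset Q$) between finite dimensional projective representations of $\mathcal{Q}$ having no nonzero direct summand of the form $0\to P$, with morphisms the commutative squares. Its indecomposables are $(P_i=P_i)$ for $i\in\mathcal{Q}_0$ and $(P_U\subset Q_U)$ for $U$ non-projective indecomposable with minimal projective resolution $0\to P_U\to Q_U\to U\to 0$. $\bmod\,\mathcal{H}_{\mathcal{Q}}^{\rm op}$ is the category of $k$-linear additive contravariant functors from $\mathcal{H}_{\mathcal{Q}}$ to finite dimensional vector spaces; it is equivalent to finite dimensional modules over $B_{\mathcal{Q}}={\rm End}(\bigoplus X)^{\rm op}$ ($X$ over representatives of indecomposables of $\mathcal{H}_{\mathcal{Q}}$), i.e.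 to representations, with relations, of the quiver $\widehat{\mathcal{Q}}$ of $B_{\mathcal{Q}}$, whose vertices are $[i]$, $i\in\mathcal{Q}_0$, and $[U]$, $U$ non-projective indecomposable. The dimension vector ${\bf dim}\,F$ of $F$ is $({\bf dim}\,F)_{[U]}=\dim F(P_U\subset Q_U)$, $({\bf dim}\,F)_{[i]}=\dim F(P_i=P_i)$. For $M\in\bmod\,k\mathcal{Q}$, $\widehat{M}(P\subset Q)={\rm Im}({\rm Hom}(Q,M)\to{\rm Hom}(P,M))$; the functor $M\mapsto\widehat M$ preserves injective maps, so $U\subset M$ gives $\widehat{U}\subset\widehat{M}$. Restriction along $P\mapsto(P=P)$ defines ${\rm res}:\bmod\,\mathcal{H}_{\mathcal{Q}}^{\rm op}\to\bmod({\rm proj}\,k\mathcal{Q})^{\rm op}\simeq\bmod\,k\mathcal{Q}$, and ${\rm res}\,\widehat{M}\simeq M$. Quiver Grassmannians ${\rm Gr}_{\bf e}(M)$ (resp. ${\rm Gr}_{\bf f}(F)$ for $F\in\bmod\,\mathcal{H}_{\mathcal{Q}}^{\rm op}$) are the projective varieties of subrepresentations of $M$ (resp. subobjects of $F$) of the given dimension vector, with reduced structure. $\mathcal{S}_{[N]}\subset{\rm Gr}_{\bf e}(M)$ is the (locally closed, irreducible) set of subrepresentations isomorphic to $N$; $[N]$ is a generic subrepresentation type of $M$ of dimension vector ${\bf e}$ if $\mathcal{S}_{[N]}$ is (nonempty and) open, and ${\rm gsub}_{\bf e}(M)$ is the set of these. The map $\pi_{[N]}:{\rm Gr}_{{\bf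 dim}\,\widehat{N}}(\widehat{M})\to{\rm Gr}_{\bf e}(M)$ is $(F\subset\widehat{M})\mapsto({\rm res}\,F\subset M)$. *)

theory Defs
  imports "HOL-Algebra.AbelCoset" "Graph_Theory.Arc_Walk" "Jordan_Normal_Form.VS_Connect"
begin

section \<open>Dynkin quivers\<close>

text \<open>Quivers are digraphs in the sense of the Graph Theory library. The diagrams live on the vertex
  set \<open>{..<n}\<close>; an edge is a two-element set. In type \<open>D\<close> the extra vertex \<open>n - 1\<close> is attached next to
  the end of the chain \<open>0, \<dots>, n - 2\<close>, in type \<open>E\<close> to its third vertex.\<close>

definition dynkin_A :: "nat \<Rightarrow> nat set set" where
  "dynkin_A n = {{i, Suc i} | i. Suc i < n}"

definition dynkin_D :: "nat \<Rightarrow> nat set set" where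
  "dynkin_D n = insert {n - 3, n - 1} (dynkin_A (n - 1))"

definition dynkin_E :: "nat \<Rightarrow> nat set set" where
  "dynkin_E n = insert {2, n - 1} (dynkin_A (n - 1))"

definition simply_laced_dynkin :: "nat \<Rightarrow> nat set set \<Rightarrow> bool" where
  "simply_laced_dynkin n E \<longleftrightarrow>
     (1 \<le> n \<and> E = dynkin_A n) \<or> (4 \<le> n \<and> E = dynkin_D n) \<or> (n \<in> {6, 7, 8} \<and> E = dynkin_E n)"

definition dynkin_quiver :: "('q, 'e) pre_digraph \<Rightarrow> bool" where
  "dynkin_quiver Q \<longleftrightarrow> wf_digraph Q \<and>
     (\<exists>n E \<nu>. simply_laced_dynkin n E \<and> bij_betw \<nu> (verts Q) {..<n} \<and>
        bij_betw (\<lambda>a. {\<nu> (tail Q a), \<nu> (head Q a)}) (arcs Q) E)"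


section \<open>Finite dimensional representations\<close>

text \<open>A vector space over the field \<open>'k\<close> is a module record over \<open>class_ring\<close>.\<close>

record ('q, 'e, 'k, 'a) quiver_rep =
  rsp :: "'q \<Rightarrow> ('k, 'a) module"
  rmap :: "'e \<Rightarrow> 'a \<Rightarrow> 'a"

definition fd_space :: "('k::field, 'a) module \<Rightarrow> bool" where
  "fd_space V \<longleftrightarrow> vectorspace class_ring V \<and> vectorspace.fin_dim class_ring V"

abbreviation vdim :: "('k::field, 'a) module \<Rightarrow> nat" where
  "vdim V \<equiv> vectorspace.dim class_ring V"

definition subspaces :: "('k::field, 'a) module \<Rightarrow> 'a set set" where
  "subspaces V = {W. VectorSpace.subspace class_ring W V}"

definition fd_rep :: "('q, 'e) pre_digraph \<Rightarrow> ('q, 'e, 'k::field, 'a) quiver_rep \<Rightarrow> bool" where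
  "fd_rep Q V \<longleftrightarrow> (\<forall>i\<in>verts Q. fd_space (rsp V i)) \<and>
     (\<forall>a\<in>arcs Q. rmap V a \<in> module_hom class_ring (rsp V (tail Q a)) (rsp V (head Q a)))"

definition rep_hom :: "('q, 'e) pre_digraph \<Rightarrow> ('q, 'e, 'k::field, 'a) quiver_rep \<Rightarrow>
    ('q, 'e, 'k, 'b) quiver_rep \<Rightarrow> ('q \<Rightarrow> 'a \<Rightarrow> 'b) set" where
  "rep_hom Q V W = {f \<in> \<Pi>\<^sub>E i\<in>verts Q. carrier (rsp V i) \<rightarrow>\<^sub>E carrier (rsp W i).
     (\<forall>i\<in>verts Q. f i \<in> module_hom class_ring (rsp V i) (rsp W i)) \<and>
     (\<forall>a\<in>arcs Q. \<forall>x\<in>carrier (rsp V (tail Q a)).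
        f (head Q a) (rmap V a x) = rmap W a (f (tail Q a) x))}"

text \<open>The composite \<open>g \<circ> f\<close> of morphisms, where \<open>V\<close> is the domain of \<open>f\<close>.\<close>

definition rep_comp :: "('q, 'e) pre_digraph \<Rightarrow> ('q, 'e, 'k, 'a) quiver_rep \<Rightarrow>
    ('q \<Rightarrow> 'b \<Rightarrow> 'c) \<Rightarrow> ('q \<Rightarrow> 'a \<Rightarrow> 'b) \<Rightarrow> 'q \<Rightarrow> 'a \<Rightarrow> 'c" where
  "rep_comp Q V g f = (\<lambda>i\<in>verts Q. compose (carrier (rsp V i)) (g i) (f i))"

definition rep_id :: "('q, 'e) pre_digraph \<Rightarrow> ('q, 'e, 'k, 'a) quiver_rep \<Rightarrow> 'q \<Rightarrow> 'a \<Rightarrow> 'a" where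
  "rep_id Q V = (\<lambda>i\<in>verts Q. \<lambda>x\<in>carrier (rsp V i). x)"

definition hom_space :: "('q, 'e) pre_digraph \<Rightarrow> ('q, 'e, 'k::field, 'a) quiver_rep \<Rightarrow>
    ('q, 'e, 'k, 'b) quiver_rep \<Rightarrow> ('k, 'q \<Rightarrow> 'a \<Rightarrow> 'b) module" where
  "hom_space Q V W = \<lparr>carrier = rep_hom Q V W, mult = undefined, one = undefined,
     zero = (\<lambda>i\<in>verts Q. \<lambda>x\<in>carrier (rsp V i). \<zero>\<^bsub>rsp W i\<^esub>),
     add = (\<lambda>f g. \<lambda>i\<in>verts Q. \<lambda>x\<in>carrier (rsp V i). f i x \<oplus>\<^bsub>rsp W i\<^esub> g i x),
     smult = (\<lambda>c f. \<lambda>i\<in>verts Q. \<lambda>x\<in>carrier (rsp V i). c \<odot>\<^bsub>rsp W i\<^esub> f i x)\<rparr>"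

definition rep_iso :: "('q, 'e) pre_digraph \<Rightarrow> ('q, 'e, 'k::field, 'a) quiver_rep \<Rightarrow>
    ('q, 'e, 'k, 'b) quiver_rep \<Rightarrow> bool" where
  "rep_iso Q V W \<longleftrightarrow> (\<exists>f\<in>rep_hom Q V W.
     \<forall>i\<in>verts Q. bij_betw (f i) (carrier (rsp V i)) (carrier (rsp W i)))"

definition subreps :: "('q, 'e) pre_digraph \<Rightarrow> ('q, 'e, 'k::field, 'a) quiver_rep \<Rightarrow>
    ('q \<Rightarrow> 'a set) set" where
  "subreps Q V = {U \<in> \<Pi>\<^sub>E i\<in>verts Q. subspaces (rsp V i).
     \<forall>a\<in>arcs Q. rmap V a ` U (tail Q a) \<subseteq> U (head Q a)}"

definition sub_rep :: "('q, 'e, 'k, 'a) quiver_rep \<Rightarrow> ('q \<Rightarrow> 'a set) \<Rightarrow>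
    ('q, 'e, 'k, 'a) quiver_rep" where
  "sub_rep V U = V\<lparr>rsp := \<lambda>i. (rsp V i)\<lparr>carrier := U i\<rparr>\<rparr>"

definition zero_subrep :: "('q, 'e) pre_digraph \<Rightarrow> ('q, 'e, 'k, 'a) quiver_rep \<Rightarrow>
    'q \<Rightarrow> 'a set" where
  "zero_subrep Q V = (\<lambda>i\<in>verts Q. {\<zero>\<^bsub>rsp V i\<^esub>})"

definition whole_subrep :: "('q, 'e) pre_digraph \<Rightarrow> ('q, 'e, 'k, 'a) quiver_rep \<Rightarrow>
    'q \<Rightarrow> 'a set" where
  "whole_subrep Q V = (\<lambda>i\<in>verts Q. carrier (rsp V i))"

definition rep_decomp :: "('q, 'e) pre_digraph \<Rightarrow> ('q, 'e, 'k::field, 'a) quiver_rep \<Rightarrow>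
    ('q \<Rightarrow> 'a set) \<Rightarrow> ('q \<Rightarrow> 'a set) \<Rightarrow> bool" where
  "rep_decomp Q V U W \<longleftrightarrow> U \<in> subreps Q V \<and> W \<in> subreps Q V \<and>
     (\<forall>i\<in>verts Q. U i \<inter> W i = {\<zero>\<^bsub>rsp V i\<^esub>} \<and>
        (\<forall>x\<in>carrier (rsp V i). \<exists>u\<in>U i. \<exists>w\<in>W i. x = u \<oplus>\<^bsub>rsp V i\<^esub> w))"

definition indecomposable_rep :: "('q, 'e) pre_digraph \<Rightarrow> ('q, 'e, 'k::field, 'a) quiver_rep \<Rightarrow>
    bool" where
  "indecomposable_rep Q V \<longleftrightarrow> fd_rep Q V \<and> whole_subrep Q V \<noteq> zero_subrep Q V \<and>
     (\<forall>U W. rep_decomp Q V U W \<longrightarrow> U = zero_subrep Q V \<or> W = zero_subrep Q V)"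


section \<open>Projective representations\<close>

text \<open>The representations whose vectors are functions \<open>'e list \<times> nat \<Rightarrow> 'k\<close> contain a copy of
  every finite dimensional representation, and serve as an essentially full small model of the
  category of all of them; the paths \<open>'e list\<close> make room for the path algebra.\<close>

type_synonym ('e, 'k) vec_elem = "'e list \<times> nat \<Rightarrow> 'k"
type_synonym ('q, 'e, 'k) qrep = "('q, 'e, 'k, ('e, 'k) vec_elem) quiver_rep"

definition projective_rep :: "('q, 'e) pre_digraph \<Rightarrow> ('q, 'e, 'k::field) qrep \<Rightarrow> bool" where
  "projective_rep Q P \<longleftrightarrow> fd_rep Q P \<and>
     (\<forall>(A :: ('q, 'e, 'k) qrep) (B :: ('q, 'e, 'k) qrep). \<forall>g\<in>rep_hom Q A B. \<forall>h\<in>rep_hom Q P B.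
        fd_rep Q A \<and> fd_rep Q B \<and> (\<forall>i\<in>verts Q. g i ` carrier (rsp A i) = carrier (rsp B i)) \<longrightarrow>
        (\<exists>h'\<in>rep_hom Q P A. rep_comp Q P g h' = h))"

text \<open>\<open>P\<^sub>i\<close>: the space at \<open>j\<close> has the paths from \<open>i\<close> to \<open>j\<close> as a basis (a path \<open>p\<close> being the
  indicator function of \<open>(p, 0)\<close>), and an arrow acts by prolonging paths.\<close>

definition proj_rep :: "('q, 'e) pre_digraph \<Rightarrow> 'q \<Rightarrow> ('q, 'e, 'k::field) qrep" where
  "proj_rep Q i = \<lparr>
     rsp = (\<lambda>j. \<lparr>
       carrier = {f. finite {x. f x \<noteq> 0} \<and>
                     (\<forall>p n. f (p, n) \<noteq> 0 \<longrightarrow> n = 0 \<and> pre_digraph.awalk Q i p j)},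
       mult = undefined, one = undefined,
       zero = (\<lambda>_. 0), add = (\<lambda>f g x. f x + g x), smult = (\<lambda>c f x. c * f x)\<rparr>),
     rmap = (\<lambda>a f (p, n). if p \<noteq> [] \<and> last p = a then f (butlast p, n) else 0)\<rparr>"

definition trivial_path :: "('e, 'k::field) vec_elem" where
  "trivial_path = (\<lambda>x. if x = ([], 0) then 1 else 0)"


section \<open>The category of inclusions of projectives\<close>

record ('q, 'e, 'k) h_obj =
  hsub :: "('q, 'e, 'k) qrep"
  hamb :: "('q, 'e, 'k) qrep"
  hinc :: "'q \<Rightarrow> ('e, 'k) vec_elem \<Rightarrow> ('e, 'k) vec_elem"

text \<open>The last clause excludes direct summands \<open>0 \<rightarrow> R'\<close>: such a summand is given by a decomposition
  \<open>R \<oplus> R'\<close> of the ambient projective whose part \<open>R\<close> contains the image of the whole subobject.\<close>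

definition h_objs :: "('q, 'e) pre_digraph \<Rightarrow> ('q, 'e, 'k::field) h_obj set" where
  "h_objs Q = {X. projective_rep Q (hsub X) \<and> projective_rep Q (hamb X) \<and>
     hinc X \<in> rep_hom Q (hsub X) (hamb X) \<and>
     (\<forall>i\<in>verts Q. inj_on (hinc X i) (carrier (rsp (hsub X) i))) \<and>
     (\<forall>R R'. rep_decomp Q (hamb X) R R' \<and>
        (\<forall>i\<in>verts Q. hinc X i ` carrier (rsp (hsub X) i) \<subseteq> R i) \<longrightarrow>
        R' = zero_subrep Q (hamb X))}"

type_synonym ('q, 'e, 'k) h_mor =
  "('q \<Rightarrow> ('e, 'k) vec_elem \<Rightarrow> ('e, 'k) vec_elem) \<times> ('q \<Rightarrow> ('e, 'k) vec_elem \<Rightarrow> ('e, 'k) vec_elem)"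

definition h_hom :: "('q, 'e) pre_digraph \<Rightarrow> ('q, 'e, 'k::field) h_obj \<Rightarrow> ('q, 'e, 'k) h_obj \<Rightarrow>
    ('q, 'e, 'k) h_mor set" where
  "h_hom Q X Y = {(a, b). a \<in> rep_hom Q (hsub X) (hsub Y) \<and> b \<in> rep_hom Q (hamb X) (hamb Y) \<and>
     rep_comp Q (hsub X) b (hinc X) = rep_comp Q (hsub X) (hinc Y) a}"

definition proj_obj :: "('q, 'e) pre_digraph \<Rightarrow> 'q \<Rightarrow> ('q, 'e, 'k::field) h_obj" where
  "proj_obj Q i = \<lparr>hsub = proj_rep Q i, hamb = proj_rep Q i, hinc = rep_id Q (proj_rep Q i)\<rparr>"

text \<open>\<open>X = (P \<subset> Q)\<close> is a minimal projective resolution \<open>0 \<rightarrow> P \<rightarrow> Q \<rightarrow> U \<rightarrow> 0\<close>; minimality says that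
  \<open>Q \<rightarrow> U\<close> is a projective cover, i.e. no proper subrepresentation of \<open>Q\<close> maps onto \<open>U\<close>.\<close>

definition min_resolution :: "('q, 'e) pre_digraph \<Rightarrow> ('q, 'e, 'k::field) h_obj \<Rightarrow>
    ('q, 'e, 'k) qrep \<Rightarrow> bool" where
  "min_resolution Q X U \<longleftrightarrow> X \<in> h_objs Q \<and> (\<exists>p\<in>rep_hom Q (hamb X) U.
     (\<forall>i\<in>verts Q. p i ` carrier (rsp (hamb X) i) = carrier (rsp U i) \<and>
        {x \<in> carrier (rsp (hamb X) i). p i x = \<zero>\<^bsub>rsp U i\<^esub>} =
          hinc X i ` carrier (rsp (hsub X) i)) \<and>
     (\<forall>R\<in>subreps Q (hamb X). (\<forall>i\<in>verts Q. p i ` R i = carrier (rsp U i)) \<longrightarrow>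
        R = whole_subrep Q (hamb X)))"

text \<open>The vertices \<open>[i]\<close> and \<open>[U]\<close> of the quiver of \<open>B\<close>; \<open>[U]\<close> is the isomorphism class of \<open>U\<close>.
  Every \<open>U\<close> has a minimal projective resolution, so requiring one is no restriction.\<close>

datatype ('q, 'r) h_vertex = PVert 'q | IVert "'r set"

definition iso_class :: "('q, 'e) pre_digraph \<Rightarrow> ('q, 'e, 'k::field) qrep \<Rightarrow>
    ('q, 'e, 'k) qrep set" where
  "iso_class Q U = {V. fd_rep Q V \<and> rep_iso Q U V}"

definition h_vertices :: "('q, 'e) pre_digraph \<Rightarrow> ('q, ('q, 'e, 'k::field) qrep) h_vertex set" where
  "h_vertices Q = PVert ` verts Q \<union>
     {IVert (iso_class Q U) | U X. indecomposable_rep Q U \<and> \<not> projective_rep Q U \<and>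
        min_resolution Q X U}"

definition vertex_obj :: "('q, 'e) pre_digraph \<Rightarrow> ('q, ('q, 'e, 'k::field) qrep) h_vertex \<Rightarrow>
    ('q, 'e, 'k) h_obj" where
  "vertex_obj Q v = (case v of PVert i \<Rightarrow> proj_obj Q i
     | IVert C \<Rightarrow> (SOME X. \<exists>U\<in>C. min_resolution Q X U))"


section \<open>Contravariant functors to vector spaces\<close>

text \<open>\<open>fmap F X Y \<phi>\<close> is the map from \<open>F Y\<close> to \<open>F X\<close> induced by \<open>\<phi> : X \<rightarrow> Y\<close>.\<close>

record ('q, 'e, 'k, 'a) h_functor =
  fobj :: "('q, 'e, 'k) h_obj \<Rightarrow> ('k, 'a) module"
  fmap :: "('q, 'e, 'k) h_obj \<Rightarrow> ('q, 'e, 'k) h_obj \<Rightarrow> ('q, 'e, 'k) h_mor \<Rightarrow> 'a \<Rightarrow> 'a"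

definition hat_functor :: "('q, 'e) pre_digraph \<Rightarrow> ('q, 'e, 'k::field, 'm) quiver_rep \<Rightarrow>
    ('q, 'e, 'k, 'q \<Rightarrow> ('e, 'k) vec_elem \<Rightarrow> 'm) h_functor" where
  "hat_functor Q M = \<lparr>
     fobj = (\<lambda>X. (hom_space Q (hsub X) M)
       \<lparr>carrier := (\<lambda>h. rep_comp Q (hsub X) h (hinc X)) ` rep_hom Q (hamb X) M\<rparr>),
     fmap = (\<lambda>X Y \<phi> g. rep_comp Q (hsub X) g (fst \<phi>))\<rparr>"

definition subfunctors :: "('q, 'e) pre_digraph \<Rightarrow> ('q, 'e, 'k::field, 'a) h_functor \<Rightarrow>
    (('q, 'e, 'k) h_obj \<Rightarrow> 'a set) set" where
  "subfunctors Q F = {G \<in> \<Pi>\<^sub>E X\<in>h_objs Q. subspaces (fobj F X).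
     \<forall>X\<in>h_objs Q. \<forall>Y\<in>h_objs Q. \<forall>\<phi>\<in>h_hom Q X Y. fmap F X Y \<phi> ` G Y \<subseteq> G X}"

text \<open>For a subrepresentation \<open>U\<close> of \<open>M\<close>, a morphism into \<open>U\<close> is also a morphism into \<open>M\<close>, so
  \<open>hat U\<close> is a subfunctor of \<open>hat M\<close> without any identification.\<close>

definition hat_sub :: "('q, 'e) pre_digraph \<Rightarrow> ('q, 'e, 'k::field, 'm) quiver_rep \<Rightarrow>
    ('q \<Rightarrow> 'm set) \<Rightarrow> ('q, 'e, 'k) h_obj \<Rightarrow> ('q \<Rightarrow> ('e, 'k) vec_elem \<Rightarrow> 'm) set" where
  "hat_sub Q M U = (\<lambda>X\<in>h_objs Q. carrier (fobj (hat_functor Q (sub_rep M U)) X))"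

text \<open>Scalar multiplication of cosets is not elementwise, as \<open>0 \<odot> A\<close> has to be the coset \<open>W\<close>.\<close>

definition quot_space :: "('k::field, 'a) module \<Rightarrow> 'a set \<Rightarrow> ('k, 'a set) module" where
  "quot_space V W = \<lparr>carrier = a_rcosets\<^bsub>V\<^esub> W, mult = undefined, one = undefined,
     zero = W, add = set_add V, smult = (\<lambda>c A. \<Union>x\<in>A. W +>\<^bsub>V\<^esub> (c \<odot>\<^bsub>V\<^esub> x))\<rparr>"

definition quot_functor :: "('q, 'e, 'k::field, 'a) h_functor \<Rightarrow> (('q, 'e, 'k) h_obj \<Rightarrow> 'a set) \<Rightarrow>
    ('q, 'e, 'k, 'a set) h_functor" where
  "quot_functor F G = \<lparr>
     fobj = (\<lambda>X. quot_space (fobj F X) (G X)),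
     fmap = (\<lambda>X Y \<phi> A. \<Union>x\<in>A. G X +>\<^bsub>fobj F X\<^esub> fmap F X Y \<phi> x)\<rparr>"

text \<open>Integer valued, so that differences of dimension vectors are not truncated.\<close>

definition functor_dim :: "('q, 'e) pre_digraph \<Rightarrow> ('q, 'e, 'k::field, 'a) h_functor \<Rightarrow>
    ('q, ('q, 'e, 'k) qrep) h_vertex \<Rightarrow> int" where
  "functor_dim Q F v = int (vdim (fobj F (vertex_obj Q v)))"

text \<open>Restriction of a subfunctor \<open>G\<close> of \<open>hat M\<close> along \<open>P \<mapsto> (P = P)\<close>, as a subrepresentation of \<open>M\<close>:
  the representation attached to a functor on projectives has the space \<open>G (P\<^sub>i = P\<^sub>i) \<subseteq> Hom (P\<^sub>i, M)\<close>
  at \<open>i\<close>, and the isomorphism from the restriction of \<open>hat M\<close> to \<open>M\<close> evaluates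
  \<open>h : P\<^sub>i \<rightarrow> M\<close> at the trivial path.\<close>

definition res_sub :: "('q, 'e) pre_digraph \<Rightarrow>
    (('q, 'e, 'k::field) h_obj \<Rightarrow> ('q \<Rightarrow> ('e, 'k) vec_elem \<Rightarrow> 'm) set) \<Rightarrow> 'q \<Rightarrow> 'm set" where
  "res_sub Q G = (\<lambda>i\<in>verts Q. (\<lambda>h. h i trivial_path) ` G (proj_obj Q i))"


section \<open>Algebraic sets in products of projective spaces\<close>

text \<open>A point of a product, over \<open>i\<close>, of projective spaces with homogeneous coordinates indexed by
  \<open>'j\<close> is represented by the set of all its systems of multihomogeneous coordinates
  \<open>z :: 'i \<Rightarrow> 'j \<Rightarrow> 'k\<close>. As the field is infinite, polynomials can be identified with polynomial
  functions; \<open>multihomog d p\<close> says that \<open>p\<close> is one of multidegree \<open>d\<close>. Subsets of the product carry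
  the Zariski topology and the reduced structure.\<close>

type_synonym ('i, 'j, 'k) mpoint = "('i \<Rightarrow> 'j \<Rightarrow> 'k) set"

inductive multihomog :: "('i \<Rightarrow> nat) \<Rightarrow> (('i \<Rightarrow> 'j \<Rightarrow> 'k::field) \<Rightarrow> 'k) \<Rightarrow> bool" where
  const: "multihomog (\<lambda>_. 0) (\<lambda>_. c)"
| coord: "multihomog (\<lambda>l. if l = i then 1 else 0) (\<lambda>z. z i j)"
| add: "multihomog d p \<Longrightarrow> multihomog d q \<Longrightarrow> multihomog d (\<lambda>z. p z + q z)"
| mult: "multihomog d p \<Longrightarrow> multihomog d' q \<Longrightarrow> multihomog (\<lambda>i. d i + d' i) (\<lambda>z. p z * q z)"

definition zariski_open :: "('i, 'j, 'k::field) mpoint set \<Rightarrow> ('i, 'j, 'k) mpoint set \<Rightarrow> bool" where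
  "zariski_open X T \<longleftrightarrow> (\<exists>S. (\<forall>p\<in>S. \<exists>d. multihomog d p) \<and>
     T = {x \<in> X. \<exists>p\<in>S. \<exists>z\<in>x. p z \<noteq> 0})"

definition regular_on :: "('i, 'j, 'k::field) mpoint set \<Rightarrow> ('i, 'j, 'k) mpoint set \<Rightarrow>
    (('i, 'j, 'k) mpoint \<Rightarrow> 'k) \<Rightarrow> bool" where
  "regular_on X T f \<longleftrightarrow> (\<forall>x\<in>T. \<exists>T' d p q. zariski_open X T' \<and> x \<in> T' \<and> T' \<subseteq> T \<and>
     multihomog d p \<and> multihomog d q \<and> (\<forall>y\<in>T'. \<forall>z\<in>y. q z \<noteq> 0 \<and> f y = p z / q z))"

definition variety_morphism :: "('i, 'j, 'k::field) mpoint set \<Rightarrow> ('i', 'j', 'k) mpoint set \<Rightarrow>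
    (('i, 'j, 'k) mpoint \<Rightarrow> ('i', 'j', 'k) mpoint) \<Rightarrow> bool" where
  "variety_morphism X Y \<phi> \<longleftrightarrow> \<phi> \<in> X \<rightarrow> Y \<and>
     (\<forall>T. zariski_open Y T \<longrightarrow> zariski_open X {x \<in> X. \<phi> x \<in> T} \<and>
        (\<forall>f. regular_on Y T f \<longrightarrow> regular_on X {x \<in> X. \<phi> x \<in> T} (\<lambda>x. f (\<phi> x))))"

definition variety_iso :: "('i, 'j, 'k::field) mpoint set \<Rightarrow> ('i', 'j', 'k) mpoint set \<Rightarrow> bool" where
  "variety_iso X Y \<longleftrightarrow> (\<exists>\<phi> \<psi>. variety_morphism X Y \<phi> \<and> variety_morphism Y X \<psi> \<and>
     (\<forall>x\<in>X. \<psi> (\<phi> x) = x) \<and> (\<forall>y\<in>Y. \<phi> (\<psi> y) = y))"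


section \<open>Quiver Grassmannians\<close>

text \<open>Basis-free Pluecker coordinates of the subspace with ordered basis \<open>us\<close> of \<open>V\<close>: the coordinates
  are indexed by \<open>r\<close>-tuples of linear forms on \<open>V\<close>, where \<open>r = length us\<close>, and the coordinate at
  \<open>\<xi>\<^sub>1, \<dots>, \<xi>\<^sub>r\<close> is the value of \<open>\<xi>\<^sub>1 \<and> \<dots> \<and> \<xi>\<^sub>r\<close> at \<open>u\<^sub>1 \<and> \<dots> \<and> u\<^sub>r\<close>. All of them are
  linear combinations of those given by the elements of a basis of the dual of \<open>V\<close>, which are the
  usual maximal minors. Lists that are not \<open>r\<close>-tuples of linear forms get the coordinate \<open>0\<close>.\<close>

definition linear_form :: "('k::field, 'a) module \<Rightarrow> ('a \<Rightarrow> 'k) \<Rightarrow> bool" where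
  "linear_form V \<xi> \<longleftrightarrow>
     (\<forall>x\<in>carrier V. \<forall>y\<in>carrier V. \<xi> (x \<oplus>\<^bsub>V\<^esub> y) = \<xi> x + \<xi> y) \<and>
     (\<forall>c. \<forall>x\<in>carrier V. \<xi> (c \<odot>\<^bsub>V\<^esub> x) = c * \<xi> x)"

definition pluecker_coord :: "('k::field, 'a) module \<Rightarrow> 'a list \<Rightarrow> ('a \<Rightarrow> 'k) list \<Rightarrow> 'k" where
  "pluecker_coord V us \<xi>s =
     (if length \<xi>s = length us \<and> (\<forall>\<xi>\<in>set \<xi>s. linear_form V \<xi>)
      then det (mat (length us) (length us) (\<lambda>(s, t). (\<xi>s ! s) (us ! t))) else 0)"

text \<open>The point of a product, over \<open>I\<close>, of Grassmannians given by subspaces \<open>W i\<close> of \<open>V i\<close>.\<close>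

definition gr_point :: "'i set \<Rightarrow> ('i \<Rightarrow> ('k::field, 'a) module) \<Rightarrow> ('i \<Rightarrow> 'a set) \<Rightarrow>
    ('i, ('a \<Rightarrow> 'k) list, 'k) mpoint" where
  "gr_point I V W = {\<lambda>i \<xi>s. if i \<in> I then c i * pluecker_coord (V i) (us i) \<xi>s else 0 | c us.
     \<forall>i\<in>I. c i \<noteq> 0 \<and> distinct (us i) \<and>
       vectorspace.basis class_ring ((V i)\<lparr>carrier := W i\<rparr>) (set (us i))}"

definition rep_gr :: "('q, 'e) pre_digraph \<Rightarrow> ('q \<Rightarrow> nat) \<Rightarrow> ('q, 'e, 'k::field, 'm) quiver_rep \<Rightarrow>
    ('q \<Rightarrow> 'm set) set" where
  "rep_gr Q e M = {U \<in> subreps Q M. \<forall>i\<in>verts Q. vdim (rsp (sub_rep M U) i) = e i}"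

definition rep_gr_point :: "('q, 'e) pre_digraph \<Rightarrow> ('q, 'e, 'k::field, 'm) quiver_rep \<Rightarrow>
    ('q \<Rightarrow> 'm set) \<Rightarrow> ('q, ('m \<Rightarrow> 'k) list, 'k) mpoint" where
  "rep_gr_point Q M = gr_point (verts Q) (rsp M)"

definition functor_gr :: "('q, 'e) pre_digraph \<Rightarrow> (('q, ('q, 'e, 'k::field) qrep) h_vertex \<Rightarrow> int) \<Rightarrow>
    ('q, 'e, 'k, 'a) h_functor \<Rightarrow> (('q, 'e, 'k) h_obj \<Rightarrow> 'a set) set" where
  "functor_gr Q f F = {G \<in> subfunctors Q F. \<forall>v\<in>h_vertices Q.
     int (vdim ((fobj F (vertex_obj Q v))\<lparr>carrier := G (vertex_obj Q v)\<rparr>)) = f v}"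

definition functor_gr_point :: "('q, 'e) pre_digraph \<Rightarrow> ('q, 'e, 'k::field, 'a) h_functor \<Rightarrow>
    (('q, 'e, 'k) h_obj \<Rightarrow> 'a set) \<Rightarrow>
    (('q, ('q, 'e, 'k) qrep) h_vertex, ('a \<Rightarrow> 'k) list, 'k) mpoint" where
  "functor_gr_point Q F G =
     gr_point (h_vertices Q) (\<lambda>v. fobj F (vertex_obj Q v)) (\<lambda>v. G (vertex_obj Q v))"

text \<open>The subset of \<open>Gr\<^sub>e (M)\<close> of the subrepresentations isomorphic to \<open>N\<close>.\<close>

definition stratum :: "('q, 'e) pre_digraph \<Rightarrow> ('q \<Rightarrow> nat) \<Rightarrow> ('q, 'e, 'k::field, 'm) quiver_rep \<Rightarrow>
    ('q, 'e, 'k, 'n) quiver_rep \<Rightarrow> ('q \<Rightarrow> 'm set) set" where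
  "stratum Q e M N = {U \<in> rep_gr Q e M. rep_iso Q (sub_rep M U) N}"

text \<open>Isomorphism classes are given by their members: \<open>gsub Q e M\<close> contains the representations \<open>N\<close>
  for which \<open>[N]\<close> is a generic subrepresentation type.\<close>

definition gsub :: "('q, 'e) pre_digraph \<Rightarrow> ('q \<Rightarrow> nat) \<Rightarrow> ('q, 'e, 'k::field, 'm) quiver_rep \<Rightarrow>
    ('q, 'e, 'k, 'n) quiver_rep set" where
  "gsub Q e M = {N. fd_rep Q N \<and> stratum Q e M N \<noteq> {} \<and>
     zariski_open (rep_gr_point Q M ` rep_gr Q e M) (rep_gr_point Q M ` stratum Q e M N)}"

text \<open>The fibre over \<open>U\<close> of the map from the Grassmannian of \<open>hat M\<close> of dimension vector
  \<open>dim (hat N)\<close> to the Grassmannian of \<open>M\<close>.\<close>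

definition pi_fibre :: "('q, 'e) pre_digraph \<Rightarrow> ('q, 'e, 'k::field, 'm) quiver_rep \<Rightarrow>
    ('q, 'e, 'k, 'n) quiver_rep \<Rightarrow> ('q \<Rightarrow> 'm set) \<Rightarrow>
    (('q, 'e, 'k) h_obj \<Rightarrow> ('q \<Rightarrow> ('e, 'k) vec_elem \<Rightarrow> 'm) set) set" where
  "pi_fibre Q M N U =
     {G \<in> functor_gr Q (functor_dim Q (hat_functor Q N)) (hat_functor Q M). res_sub Q G = U}"

end

theory Submission
  imports Defs
begin

text \<open>Write \<open>hat M\<close> and \<open>hat U\<close> for the functors attached to \<open>M\<close> and \<open>U\<close>. A point of the fibre is a subfunctor
  \<open>G\<close> of \<open>hat M\<close> with \<open>res G = U\<close> and the dimension vector of \<open>hat N\<close>; the isomorphism sends \<open>G\<close> to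
  \<open>G / hat U\<close>. There are two things to see.

  The correspondence on points. Every subfunctor \<open>G\<close> with \<open>res G = U\<close> contains \<open>hat U\<close>
  (\<open>hat_sub_in_subfunctor\<close>). Indeed, an element of \<open>hat U (P \<subset> Q)\<close> is the restriction to \<open>P\<close> of a morphism
  \<open>h : Q \<rightarrow> U\<close>. As \<open>Q\<close> is projective, its identity is a sum of morphisms that factor through
  indecomposable projectives \<open>P\<^sub>i\<close> (\<open>projective_dual_basis\<close>), hence \<open>h\<close> is a sum of composites
  \<open>Q \<rightarrow> P\<^sub>i \<rightarrow> U\<close>. By \<open>res G = U\<close> and the Yoneda lemma each \<open>P\<^sub>i \<rightarrow> U\<close> lies in \<open>G (P\<^sub>i = P\<^sub>i)\<close>, and the
  functoriality of \<open>G\<close> along \<open>(P \<subset> Q) \<rightarrow> (P\<^sub>i = P\<^sub>i)\<close> puts the restriction of the composite to \<open>P\<close> into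
  \<open>G (P \<subset> Q)\<close>. Conversely, let \<open>H\<close> be a subfunctor of \<open>hat M / hat U\<close> whose dimension vector is that of
  \<open>hat N\<close> minus that of \<open>hat U\<close>. Both \<open>N\<close> and \<open>U\<close> have dimension vector \<open>e\<close>, and \<open>hat N (P\<^sub>i = P\<^sub>i)\<close> has
  the dimension of \<open>N\<close> at \<open>i\<close>, again by the Yoneda lemma (\<open>hat_dim_proj_obj\<close>). So \<open>H\<close> vanishes at
  \<open>(P\<^sub>i = P\<^sub>i)\<close>, and its inverse image in \<open>hat M\<close> restricts to \<open>U\<close> (\<open>res_lift_sub\<close>).

  The morphisms of varieties. Let \<open>W\<close> be a subspace of \<open>V\<close>, and let \<open>A\<close> run through subspaces of \<open>V\<close>
  that contain \<open>W\<close>. Then \<open>A \<mapsto> A / W\<close> and its inverse are given in Pluecker coordinates by linear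
  substitutions (\<open>grassmannian_quotient_iso\<close>). Let \<open>ws\<close> be a basis of \<open>W\<close> with dual forms \<open>\<omega>s\<close>, and
  extend it to a basis \<open>ws @ us\<close> of \<open>A\<close> such that \<open>\<omega>s\<close> vanish on \<open>us\<close>. A matrix of values of forms that
  vanish on \<open>W\<close>, together with \<open>\<omega>s\<close>, is block diagonal at \<open>ws @ us\<close>; hence the coordinates of \<open>A / W\<close>
  are among those of \<open>A\<close> (\<open>pluecker_quot\<close>). In the other direction the columns of \<open>ws\<close> do not depend on
  \<open>A\<close>, and the Laplace expansion along them expresses the coordinates of \<open>A\<close> as fixed linear
  combinations of those of \<open>A / W\<close> (\<open>pluecker_lift\<close>). Linear substitutions preserve multihomogeneous
  polynomials and therefore induce morphisms (\<open>variety_morphism_coord_subst\<close>). This is applied to all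
  vertices of the quiver of \<open>B\<close> at once.

  The shape of the quiver matters as follows: an orientation of a tree admits a height function that
  increases by one along each arrow (\<open>dynkin_height\<close>), so there are finitely many paths, and the
  representations \<open>P\<^sub>i\<close> are finite dimensional projectives.\<close>


section \<open>Dual bases\<close>

abbreviation is_subspace :: "'a set \<Rightarrow> ('k::field, 'a) module \<Rightarrow> bool" where
  "is_subspace \<equiv> VectorSpace.subspace class_ring"

locale kspace = vectorspace "class_ring :: 'k::field ring" V
  for V :: "('k::field, 'a) module" (structure)
begin

lemma vadd_comm: "x \<in> carrier V \<Longrightarrow> y \<in> carrier V \<Longrightarrow> x \<oplus> y = y \<oplus> x"
  by (rule a_comm)

lemma vadd_assoc:
  "x \<in> carrier V \<Longrightarrow> y \<in> carrier V \<Longrightarrow> z \<in> carrier V \<Longrightarrow> (x \<oplus> y) \<oplus> z = x \<oplus> (y \<oplus> z)"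
  by (rule a_assoc)

lemma vadd_zero: "x \<in> carrier V \<Longrightarrow> x \<oplus> \<zero> = x"
  by (rule r_zero)

lemma scale_closed [simp]: "x \<in> carrier V \<Longrightarrow> c \<odot> x \<in> carrier V"
  by (rule smult_closed) auto

lemma scale_add_left: "x \<in> carrier V \<Longrightarrow> (c + d) \<odot> x = c \<odot> x \<oplus> d \<odot> x"
  using smult_l_distr[of c d x] by simp

lemma scale_add_right: "x \<in> carrier V \<Longrightarrow> y \<in> carrier V \<Longrightarrow> c \<odot> (x \<oplus> y) = c \<odot> x \<oplus> c \<odot> y"
  using smult_r_distr[of c x y] by simp

lemma scale_scale: "x \<in> carrier V \<Longrightarrow> c \<odot> (d \<odot> x) = (c * d) \<odot> x"
  using smult_assoc1[of c d x] by simp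

lemma scale_one [simp]: "x \<in> carrier V \<Longrightarrow> 1 \<odot> x = x"
  using smult_one[of x] by simp

lemma scale_zero_left [simp]: "x \<in> carrier V \<Longrightarrow> 0 \<odot> x = \<zero>"
  using smult_l_null[of x] by simp

lemma scale_zero_right [simp]: "c \<odot> \<zero> = \<zero>"
  using smult_r_null[of c] by simp

lemma add_scale_neg [simp]: "x \<in> carrier V \<Longrightarrow> x \<oplus> (- 1) \<odot> x = \<zero>"
  using scale_add_left[of x 1 "- 1"] by simp

lemma subspace_iff: "is_subspace W V \<longleftrightarrow>
    W \<subseteq> carrier V \<and> \<zero> \<in> W \<and> (\<forall>x\<in>W. \<forall>y\<in>W. x \<oplus> y \<in> W) \<and> (\<forall>c. \<forall>x\<in>W. c \<odot> x \<in> W)"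
  using vectorspace_axioms module_axioms
  by (auto simp: VectorSpace.subspace_def submodule_def)

lemma eq_if_diff_zero:
  assumes "x \<in> carrier V" "y \<in> carrier V" "x \<oplus> (- 1) \<odot> y = \<zero>"
  shows "x = y"
proof -
  have "x = x \<oplus> ((- 1) \<odot> y \<oplus> y)"
    using assms(1,2) by (simp add: a_comm)
  also have "\<dots> = (x \<oplus> (- 1) \<odot> y) \<oplus> y" using assms(1,2) by (simp add: a_assoc)
  finally show ?thesis using assms by simp
qed

lemma linear_formD:
  assumes "linear_form V \<xi>"
  shows "x \<in> carrier V \<Longrightarrow> y \<in> carrier V \<Longrightarrow> \<xi> (x \<oplus> y) = \<xi> x + \<xi> y"
    and "x \<in> carrier V \<Longrightarrow> \<xi> (c \<odot> x) = c * \<xi> x"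
  using assms by (auto simp: linear_form_def)

definition comb :: "(nat \<Rightarrow> 'k) \<Rightarrow> 'a list \<Rightarrow> 'a" where
  "comb c us = (\<Oplus>i\<in>{..<length us}. c i \<odot> us ! i)"

lemma linear_form_zero: "linear_form V \<xi> \<Longrightarrow> \<xi> \<zero> = 0"
  unfolding linear_form_def by (metis mult_zero_left scale_zero_right zero_closed)

lemma linear_form_finsum:
  assumes "linear_form V \<xi>" "f \<in> A \<rightarrow> carrier V"
  shows "\<xi> (\<Oplus>i\<in>A. f i) = (\<Sum>i\<in>A. \<xi> (f i))"
  using assms(2)
proof (induction A rule: infinite_finite_induct)
  case (insert x A)
  then have "\<xi> (f x \<oplus> finsum V f A) = \<xi> (f x) + \<xi> (finsum V f A)"
    using assms(1) by (auto simp: linear_form_def)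
  with insert show ?case by (simp add: Pi_iff)
qed (use linear_form_zero[OF assms(1)] in auto)

lemma finsum_in_subspace:
  assumes "is_subspace W V" "f \<in> A \<rightarrow> W"
  shows "(\<Oplus>i\<in>A. f i) \<in> W"
  using assms(2)
proof (induction A rule: infinite_finite_induct)
  case (insert x A)
  have "W \<subseteq> carrier V" using assms(1) by (simp add: subspace_iff)
  then have "finsum V f (insert x A) = f x \<oplus> finsum V f A"
    using insert by (intro finsum_insert) (auto simp: Pi_iff)
  then show ?case using insert assms(1) by (auto simp: subspace_iff)
qed (use assms(1) in \<open>auto simp: subspace_iff\<close>)

lemma comb_in_subspace:
  assumes "is_subspace W V" "set us \<subseteq> W"
  shows "comb c us \<in> W"
  unfolding comb_def using assms by (intro finsum_in_subspace) (auto simp: subspace_iff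
    dest: nth_mem)

lemma subspace_carrier: "is_subspace (carrier V) V"
  by (auto simp: subspace_iff)

lemma linear_form_comb:
  assumes "linear_form V \<xi>" "set us \<subseteq> carrier V"
  shows "\<xi> (comb c us) = (\<Sum>i<length us. c i * \<xi> (us ! i))"
proof -
  have "us ! i \<in> carrier V" if "i < length us" for i
    using that assms(2) by auto
  then show ?thesis unfolding comb_def
    using assms(1) by (subst linear_form_finsum) (auto simp: linear_form_def intro!: sum.cong)
qed

lemma linear_form_diff_scale:
  assumes "linear_form V \<xi>" "linear_form V \<eta>"
  shows "linear_form V (\<lambda>x. \<xi> x - c * \<eta> x)"
  using assms by (auto simp: linear_form_def algebra_simps)

lemma linear_form_comb_forms:
  assumes "\<And>i. i \<in> A \<Longrightarrow> linear_form V (\<omega> i)"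
  shows "linear_form V (\<lambda>x. \<Sum>i\<in>A. c i * \<omega> i x)"
  using assms by (auto simp: linear_form_def algebra_simps sum.distrib sum_distrib_left)

end

text \<open>A basis \<open>us\<close> of the subspace \<open>W\<close> together with its coordinate forms \<open>\<omega>s\<close>, where the forms are
  defined on all of \<open>V\<close>. The two conditions on the values of the forms replace linear independence and
  generation; being stated with forms, they combine directly with Pluecker coordinates.\<close>

definition dual_basis :: "('k::field, 'a) module \<Rightarrow> 'a set \<Rightarrow> 'a list \<Rightarrow> ('a \<Rightarrow> 'k) list \<Rightarrow> bool" where
  "dual_basis V W us \<omega>s \<longleftrightarrow> length \<omega>s = length us \<and> set us \<subseteq> W \<and> (\<forall>\<omega>\<in>set \<omega>s. linear_form V \<omega>) \<and>
     (\<forall>i<length us. \<forall>j<length us. (\<omega>s ! i) (us ! j) = (if i = j then 1 else 0)) \<and>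
     (\<forall>x\<in>W. (\<forall>\<omega>\<in>set \<omega>s. \<omega> x = 0) \<longrightarrow> x = \<zero>\<^bsub>V\<^esub>)"

context kspace
begin

lemma dual_basis_sum:
  assumes "dual_basis V W us \<omega>s" "j < length us"
  shows "(\<Sum>i<length us. c i * (\<omega>s ! j) (us ! i)) = c j"
proof -
  have "(\<Sum>i<length us. c i * (\<omega>s ! j) (us ! i)) = (\<Sum>i<length us. if j = i then c i else 0)"
    using assms by (intro sum.cong) (auto simp: dual_basis_def)
  then show ?thesis using assms(2) by simp
qed

lemma dual_basis_expansion:
  assumes W: "is_subspace W V" and db: "dual_basis V W us \<omega>s" and x: "x \<in> W"
  shows "x = comb (\<lambda>i. (\<omega>s ! i) x) us"
proof -
  let ?y = "comb (\<lambda>i. (\<omega>s ! i) x) us"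
  have WV: "W \<subseteq> carrier V" using W by (simp add: subspace_iff)
  have us: "set us \<subseteq> W" using db by (simp add: dual_basis_def)
  have y: "?y \<in> W" using comb_in_subspace[OF W us] .
  have "\<omega> (x \<oplus> (- 1) \<odot> ?y) = 0" if "\<omega> \<in> set \<omega>s" for \<omega>
  proof -
    from that obtain j where j: "j < length us" "\<omega> = \<omega>s ! j"
      using db by (metis dual_basis_def in_set_conv_nth)
    have lf: "linear_form V \<omega>" using db that by (simp add: dual_basis_def)
    have "\<omega> ?y = \<omega> x"
      using us WV dual_basis_sum[OF db j(1)] by (subst linear_form_comb[OF lf]) (auto simp: j)
    then show ?thesis using lf x y WV by (simp add: linear_formD subset_iff)
  qed
  moreover have "x \<oplus> (- 1) \<odot> ?y \<in> W" using W x y by (auto simp: subspace_iff)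
  ultimately have "x \<oplus> (- 1) \<odot> ?y = \<zero>" using db by (auto simp: dual_basis_def)
  then show ?thesis using x y WV by (metis eq_if_diff_zero subsetD)
qed

lemma kspace_subspace: "is_subspace W V \<Longrightarrow> kspace (V\<lparr>carrier := W\<rparr>)"
  unfolding kspace_def by (rule subspace_is_vs)

lemma linear_form_subspace:
  "is_subspace W V \<Longrightarrow> linear_form V \<xi> \<Longrightarrow> linear_form (V\<lparr>carrier := W\<rparr>) \<xi>"
  by (auto simp: linear_form_def subspace_iff subset_iff)

lemma form_expansion:
  assumes W: "is_subspace W V" and db: "dual_basis V W us \<omega>s" and x: "x \<in> W"
    and "linear_form (V\<lparr>carrier := W\<rparr>) \<xi>"
  shows "\<xi> x = (\<Sum>i<length us. (\<omega>s ! i) x * \<xi> (us ! i))"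
proof -
  interpret W: kspace "V\<lparr>carrier := W\<rparr>" using kspace_subspace[OF W] .
  have us: "set us \<subseteq> W" using db by (simp add: dual_basis_def)
  have "dual_basis (V\<lparr>carrier := W\<rparr>) W us \<omega>s"
    using db linear_form_subspace[OF W] by (simp add: dual_basis_def)
  from W.dual_basis_expansion[OF _ this x] W.subspace_carrier
  have "x = W.comb (\<lambda>i. (\<omega>s ! i) x) us" by simp
  then have "\<xi> x = \<xi> (W.comb (\<lambda>i. (\<omega>s ! i) x) us)" by simp
  also have "\<dots> = (\<Sum>i<length us. (\<omega>s ! i) x * \<xi> (us ! i))"
    using us by (intro W.linear_form_comb assms(4)) simp
  finally show ?thesis .
qed

lemma dual_basis_distinct:
  assumes "dual_basis V W us \<omega>s"
  shows "distinct us"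
  using assms by (auto simp: dual_basis_def distinct_conv_nth) (metis zero_neq_one)

lemma dual_basis_imp_basis:
  assumes W: "is_subspace W V" and db: "dual_basis V W us \<omega>s"
  shows "vectorspace.basis class_ring (V\<lparr>carrier := W\<rparr>) (set us)"
proof -
  interpret W: kspace "V\<lparr>carrier := W\<rparr>" using kspace_subspace[OF W] .
  have us: "set us \<subseteq> W" using db by (simp add: dual_basis_def)
  have WV: "W \<subseteq> carrier V" using W by (simp add: subspace_iff)
  have dist: "distinct us" using dual_basis_distinct[OF db] .
  have "\<not> W.lin_dep (set us)"
  proof
    assume "W.lin_dep (set us)"
    then obtain A c v where A: "finite A" "A \<subseteq> set us" "W.lincomb c A = \<zero>" "v \<in> A" "c v \<noteq> 0"
      by (auto simp: W.lin_dep_def)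
    then obtain j where j: "j < length us" "v = us ! j" by (metis in_set_conv_nth subsetD)
    have lf: "linear_form (V\<lparr>carrier := W\<rparr>) (\<omega>s ! j)"
      using db j by (intro linear_form_subspace[OF W]) (auto simp: dual_basis_def)
    have "0 = (\<omega>s ! j) (W.lincomb c A)" using A W.linear_form_zero[OF lf] by simp
    also have "\<dots> = (\<Sum>w\<in>A. (\<omega>s ! j) (c w \<odot> w))"
      unfolding W.lincomb_def using A us W
      by (subst W.linear_form_finsum[OF lf]) (auto simp: subspace_iff)
    also have "\<dots> = (\<Sum>w\<in>A. if w = v then c v else 0)"
    proof (rule sum.cong[OF refl])
      fix w assume w: "w \<in> A"
      then obtain i where i: "i < length us" "w = us ! i" using A by (metis in_set_conv_nth subsetD)
      have "(\<omega>s ! j) (c w \<odot> w) = c w * (\<omega>s ! j) w" using lf w A us by (auto simp: linear_form_def)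
      also have "(\<omega>s ! j) w = (if w = v then 1 else 0)"
        using db i j dist by (auto simp: dual_basis_def nth_eq_iff_index_eq)
      finally show "(\<omega>s ! j) (c w \<odot> w) = (if w = v then c v else 0)" by auto
    qed
    also have "\<dots> = c v" using A by simp
    finally show False using A by simp
  qed
  moreover have "W.span (set us) = W"
  proof
    show "W.span (set us) \<subseteq> W" using W.span_is_subset2[of "set us"] us by simp
    show "W \<subseteq> W.span (set us)"
    proof
      fix x assume x: "x \<in> W"
      have sub: "is_subspace (W.span (set us)) (V\<lparr>carrier := W\<rparr>)"
        using us by (intro W.span_is_subspace) simp
      have "dual_basis (V\<lparr>carrier := W\<rparr>) W us \<omega>s"
        using db linear_form_subspace[OF W] by (simp add: dual_basis_def)
      from W.dual_basis_expansion[OF _ this x] W.subspace_carrier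
      have "x = W.comb (\<lambda>i. (\<omega>s ! i) x) us" by simp
      also have "\<dots> \<in> W.span (set us)"
        using us by (intro W.comb_in_subspace[OF sub] W.in_own_span) simp
      finally show "x \<in> W.span (set us)" .
    qed
  qed
  ultimately show ?thesis using us unfolding W.basis_def by simp
qed

lemma dual_basis_dim:
  assumes W: "is_subspace W V" and db: "dual_basis V W us \<omega>s"
  shows "vdim (V\<lparr>carrier := W\<rparr>) = length us"
proof -
  interpret W: kspace "V\<lparr>carrier := W\<rparr>" using kspace_subspace[OF W] .
  have "W.dim = card (set us)" by (rule W.dim_basis[OF finite_set dual_basis_imp_basis[OF W db]])
  then show ?thesis using distinct_card[OF dual_basis_distinct[OF db]] by simp
qed

lemma dual_basis_fd_space:
  assumes W: "is_subspace W V" and db: "dual_basis V W us \<omega>s"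
  shows "fd_space (V\<lparr>carrier := W\<rparr>)"
proof -
  interpret W: kspace "V\<lparr>carrier := W\<rparr>" using kspace_subspace[OF W] .
  have "W.basis (set us)" using dual_basis_imp_basis[OF W db] .
  then have "W.fin_dim"
    unfolding W.fin_dim_def W.basis_def by (intro exI[of _ "set us"]) simp
  then show ?thesis using W.vectorspace_axioms by (simp add: fd_space_def)
qed

text \<open>By induction on the list of separating forms: on the kernel of the first form \<open>f\<close> the others separate
  vectors. If \<open>f\<close> does not vanish on \<open>W\<close>, a vector \<open>x\<close> with \<open>f x = 1\<close> completes the basis, and the forms
  found before are corrected by multiples of \<open>f\<close> so that they vanish at \<open>x\<close>.\<close>

lemma dual_basis_exists:
  assumes "is_subspace W V" "\<forall>\<xi>\<in>set F. linear_form V \<xi>"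
    "\<forall>x\<in>W. (\<forall>\<xi>\<in>set F. \<xi> x = 0) \<longrightarrow> x = \<zero>"
  shows "\<exists>us \<omega>s. dual_basis V W us \<omega>s"
  using assms
proof (induction F arbitrary: W)
  case Nil
  then have "dual_basis V W [] []" by (auto simp: dual_basis_def)
  then show ?case by blast
next
  case (Cons f F)
  let ?W = "{x \<in> W. f x = 0}"
  have f: "linear_form V f" using Cons.prems by simp
  have WV: "W \<subseteq> carrier V" using Cons.prems(1) by (simp add: subspace_iff)
  have sub: "is_subspace ?W V"
    using Cons.prems(1) f linear_form_zero[OF f]
    by (auto simp: subspace_iff linear_form_def subset_iff)
  obtain us \<omega>s where db: "dual_basis V ?W us \<omega>s"
    using Cons.IH[OF sub] Cons.prems by auto
  show ?case
  proof (cases "\<forall>x\<in>W. f x = 0")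
    case True
    then have "?W = W" by auto
    then show ?thesis using db by auto
  next
    case False
    then obtain x0 where x0: "x0 \<in> W" "f x0 \<noteq> 0" by auto
    define x where "x = (1 / f x0) \<odot> x0"
    have x: "x \<in> W" "f x = 1" using x0 Cons.prems(1) f
      by (auto simp: x_def subspace_iff linear_form_def subset_iff)
    let ?\<omega>s = "map (\<lambda>\<omega> y. \<omega> y - \<omega> x * f y) \<omega>s @ [f]"
    have len: "length \<omega>s = length us" using db by (simp add: dual_basis_def)
    have "dual_basis V W (us @ [x]) ?\<omega>s"
      unfolding dual_basis_def
    proof (intro conjI ballI allI impI)
      show "length ?\<omega>s = length (us @ [x])" using len by simp
      show "set (us @ [x]) \<subseteq> W" using db x by (auto simp: dual_basis_def)
      show "linear_form V \<omega>" if "\<omega> \<in> set ?\<omega>s" for \<omega>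
        using that db f by (auto simp: dual_basis_def intro!: linear_form_diff_scale)
      fix i j assume ij: "i < length (us @ [x])" "j < length (us @ [x])"
      have fus: "f (us ! k) = 0" if "k < length us" for k
        using db nth_mem[OF that] by (auto simp: dual_basis_def)
      show "(?\<omega>s ! i) ((us @ [x]) ! j) = (if i = j then 1 else 0)"
        using ij db fus x len by (auto simp: nth_append dual_basis_def less_Suc_eq)
    next
      fix y assume y: "y \<in> W" "\<forall>\<omega>\<in>set ?\<omega>s. \<omega> y = 0"
      then have "y \<in> ?W" "\<forall>\<omega>\<in>set \<omega>s. \<omega> y = 0" by auto
      then show "y = \<zero>" using db by (auto simp: dual_basis_def)
    qed
    then show ?thesis by blast
  qed
qed

lemma coordinate_form:
  assumes "finite B" "basis B"
  obtains \<omega> where "\<And>b. b \<in> B \<Longrightarrow> linear_form V (\<omega> b)"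
    "\<And>b b'. b \<in> B \<Longrightarrow> b' \<in> B \<Longrightarrow> \<omega> b b' = (if b = b' then 1 else 0)"
    "\<And>x. x \<in> carrier V \<Longrightarrow> (\<forall>b\<in>B. \<omega> b x = 0) \<Longrightarrow> x = \<zero>"
proof -
  have B: "B \<subseteq> carrier V" using assms(2) by (simp add: basis_def)
  have ex1: "\<exists>!a. a \<in> extensional B \<and> lincomb a B = x" if "x \<in> carrier V" for x
    using basis_criterion[OF assms(1) B] assms(2) that by (simp add: PiE_def)
  define a where "a x = (THE a. a \<in> extensional B \<and> lincomb a B = x)" for x
  have a: "lincomb (a x) B = x" if "x \<in> carrier V" for x
    using theI'[OF ex1[OF that]] by (simp add: a_def)
  have aeq: "a x b = c b" if "lincomb c B = x" "b \<in> B" for x c b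
  proof -
    have c: "lincomb (restrict c B) B = x" using that(1) B
      by (subst that(1)[symmetric]) (auto simp: lincomb_def intro!: finsum_cong')
    have "x \<in> carrier V" using that(1) B lincomb_closed[of B c] by auto
    from the1_equality[OF ex1[OF this], of "restrict c B"] c
    have "a x = restrict c B" by (simp add: a_def)
    then show ?thesis using that(2) by simp
  qed
  show thesis
  proof
    fix b assume b: "b \<in> B"
    show "linear_form V (\<lambda>x. a x b)"
      unfolding linear_form_def
    proof (intro conjI ballI allI)
      fix x y assume xy: "x \<in> carrier V" "y \<in> carrier V"
      have "lincomb (\<lambda>v. a x v + a y v) B = lincomb (a x) B \<oplus> lincomb (a y) B"
        using B assms(1) unfolding lincomb_def
        by (subst finsum_addf[symmetric]) (auto simp: scale_add_left intro!: finsum_cong')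
      then have "lincomb (\<lambda>v. a x v + a y v) B = x \<oplus> y" using a xy by simp
      from aeq[OF this b] show "a (x \<oplus> y) b = a x b + a y b" .
    next
      fix c x assume x: "x \<in> carrier V"
      have "lincomb (\<lambda>v. c * a x v) B = c \<odot> lincomb (a x) B"
        using B assms(1) unfolding lincomb_def
        by (subst finsum_smult) (auto simp: scale_scale intro!: finsum_cong')
      then have "lincomb (\<lambda>v. c * a x v) B = c \<odot> x" using a x by simp
      from aeq[OF this b] show "a (c \<odot> x) b = c * a x b" .
    qed
    fix b' assume b': "b' \<in> B"
    have "lincomb (\<lambda>v. if v = b' then 1 else 0) B
        = (\<Oplus>v\<in>B. if b' = v then b' else \<zero>)"
      unfolding lincomb_def using B b' by (intro finsum_cong') auto
    also have "\<dots> = b'" using B b' assms(1) by (intro finsum_singleton) auto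
    finally show "a b' b = (if b = b' then 1 else 0)" by (rule aeq[OF _ b])
  next
    fix x assume x: "x \<in> carrier V" "\<forall>b\<in>B. a x b = 0"
    have "x = lincomb (a x) B" using a x by simp
    also have "\<dots> = (\<Oplus>v\<in>B. \<zero>)" unfolding lincomb_def using B x by (intro finsum_cong') auto
    also have "\<dots> = \<zero>" by (rule finsum_zero)
    finally show "x = \<zero>" .
  qed
qed

lemma basis_list_coordinates:
  assumes "distinct us" "basis (set us)"
  shows "\<exists>\<omega>s. dual_basis V (carrier V) us \<omega>s"
proof -
  obtain \<omega> where \<omega>: "\<And>b. b \<in> set us \<Longrightarrow> linear_form V (\<omega> b)"
    "\<And>b b'. b \<in> set us \<Longrightarrow> b' \<in> set us \<Longrightarrow> \<omega> b b' = (if b = b' then 1 else 0)"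
    "\<And>x. x \<in> carrier V \<Longrightarrow> (\<forall>b\<in>set us. \<omega> b x = 0) \<Longrightarrow> x = \<zero>"
    using coordinate_form[OF finite_set assms(2)] by metis
  have "dual_basis V (carrier V) us (map \<omega> us)"
    using \<omega> assms by (auto simp: dual_basis_def basis_def nth_eq_iff_index_eq)
  then show ?thesis by blast
qed

end

lemma fd_spaceD: "fd_space V \<Longrightarrow> kspace V"
  by (simp add: fd_space_def kspace_def)

lemma fd_space_dual_basis:
  fixes V :: "('k::field, 'a) module"
  assumes "fd_space V"
  shows "\<exists>us \<omega>s. dual_basis V (carrier V) us \<omega>s"
proof -
  interpret kspace V using fd_spaceD[OF assms] .
  obtain B where "finite B" "basis B"
    using assms finite_basis_exists by (auto simp: fd_space_def)
  then show ?thesis using basis_list_coordinates by (metis finite_distinct_list)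
qed

text \<open>For a space of functions or of morphisms, finite dimension is seen most easily from finitely many
  evaluations that determine its elements.\<close>

lemma fd_spaceI:
  fixes V :: "('k::field, 'a) module"
  assumes "kspace V" "finite F" "\<And>\<xi>. \<xi> \<in> F \<Longrightarrow> linear_form V \<xi>"
    "\<And>x. x \<in> carrier V \<Longrightarrow> (\<And>\<xi>. \<xi> \<in> F \<Longrightarrow> \<xi> x = 0) \<Longrightarrow> x = \<zero>\<^bsub>V\<^esub>"
  shows "fd_space V"
proof -
  interpret kspace V by fact
  obtain L where "set L = F" using finite_list[OF assms(2)] by blast
  then obtain us \<omega>s where "dual_basis V (carrier V) us \<omega>s"
    using dual_basis_exists[OF subspace_carrier, of L] assms(3,4) by auto
  from dual_basis_fd_space[OF subspace_carrier this] show ?thesis by simp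
qed

lemma fd_space_subspace:
  fixes V :: "('k::field, 'a) module"
  assumes "fd_space V" "is_subspace W V"
  shows "\<exists>us \<omega>s. dual_basis V W us \<omega>s" "fd_space (V\<lparr>carrier := W\<rparr>)"
proof -
  interpret kspace V using fd_spaceD[OF assms(1)] .
  obtain us \<omega>s where "dual_basis V (carrier V) us \<omega>s" using fd_space_dual_basis[OF assms(1)]
    by blast
  then show *: "\<exists>us \<omega>s. dual_basis V W us \<omega>s"
    using assms(2) by (intro dual_basis_exists[of _ \<omega>s]) (auto simp: dual_basis_def subspace_iff)
  then show "fd_space (V\<lparr>carrier := W\<rparr>)" using dual_basis_fd_space[OF assms(2)] by blast
qed

text \<open>The coordinate forms of the basis are defined on \<open>W\<close> only. They are extended to \<open>V\<close> by means of a dual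
  basis of \<open>W\<close> whose forms live on \<open>V\<close>.\<close>

lemma dual_basis_if_basis:
  fixes V :: "('k::field, 'a) module"
  assumes V: "fd_space V" and W: "is_subspace W V"
    and us: "distinct us" "vectorspace.basis class_ring (V\<lparr>carrier := W\<rparr>) (set us)"
  shows "\<exists>\<omega>s. dual_basis V W us \<omega>s"
proof -
  interpret kspace V using fd_spaceD[OF V] .
  interpret W: kspace "V\<lparr>carrier := W\<rparr>" using kspace_subspace[OF W] .
  obtain \<eta>s where \<eta>s: "dual_basis (V\<lparr>carrier := W\<rparr>) W us \<eta>s"
    using W.basis_list_coordinates[OF us] by auto
  obtain vs \<theta>s where \<theta>s: "dual_basis V W vs \<theta>s" using fd_space_subspace(1)[OF V W] by blast
  define ext where "ext \<eta> x = (\<Sum>i<length vs. \<eta> (vs ! i) * (\<theta>s ! i) x)" for \<eta> x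
  have lf: "linear_form V (ext \<eta>)" for \<eta>
    unfolding ext_def using \<theta>s by (intro linear_form_comb_forms) (auto simp: dual_basis_def)
  have ext: "ext \<eta> x = \<eta> x" if "\<eta> \<in> set \<eta>s" "x \<in> W" for \<eta> x
    unfolding ext_def using form_expansion[OF W \<theta>s that(2), of \<eta>] that \<eta>s
    by (simp add: dual_basis_def mult.commute)
  have "dual_basis V W us (map ext \<eta>s)"
    unfolding dual_basis_def
  proof (intro conjI ballI allI impI)
    show "(map ext \<eta>s ! i) (us ! j) = (if i = j then 1 else 0)"
      if "i < length us" "j < length us" for i j
    proof -
      have "us ! j \<in> W" "\<eta>s ! i \<in> set \<eta>s" "i < length \<eta>s"
        using that \<eta>s by (auto simp: dual_basis_def)
      then show ?thesis using that \<eta>s by (simp add: ext) (simp add: dual_basis_def)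
    qed
    show "x = \<zero>\<^bsub>V\<^esub>" if "x \<in> W" "\<forall>\<omega>\<in>set (map ext \<eta>s). \<omega> x = 0" for x
      using that \<eta>s by (auto simp: dual_basis_def ext)
  qed (use \<eta>s lf in \<open>auto simp: dual_basis_def\<close>)
  then show ?thesis by blast
qed

text \<open>The forms belonging to \<open>W\<close> are kept: the new vectors are taken in the common kernel of these forms,
  and the new forms are corrected by multiples of the old ones so that they vanish on \<open>W\<close>.\<close>

lemma dual_basis_extend:
  fixes V :: "('k::field, 'a) module"
  assumes V: "fd_space V" and W: "is_subspace W V"
    and A: "is_subspace A V" and WA: "W \<subseteq> A" and db: "dual_basis V W ws \<omega>s"
  shows "\<exists>us \<eta>s. dual_basis V A (ws @ us) (\<omega>s @ \<eta>s)"
proof -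
  interpret kspace V using fd_spaceD[OF V] .
  let ?A = "{x \<in> A. \<forall>\<omega>\<in>set \<omega>s. \<omega> x = 0}"
  have lf: "linear_form V \<omega>" if "\<omega> \<in> set \<omega>s" for \<omega> using db that by (simp add: dual_basis_def)
  have AV: "A \<subseteq> carrier V" using A by (simp add: subspace_iff)
  have sub: "is_subspace ?A V"
    unfolding subspace_iff
  proof (intro conjI ballI allI)
    show "?A \<subseteq> carrier V" using AV by auto
    show "\<zero>\<^bsub>V\<^esub> \<in> ?A" using A linear_form_zero[OF lf] by (auto simp: subspace_iff)
    show "x \<oplus>\<^bsub>V\<^esub> y \<in> ?A" if "x \<in> ?A" "y \<in> ?A" for x y
      using that A AV by (auto simp: subspace_iff linear_formD[OF lf] subset_iff)
    show "c \<odot>\<^bsub>V\<^esub> x \<in> ?A" if "x \<in> ?A" for c x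
      using that A AV by (auto simp: subspace_iff linear_formD[OF lf] subset_iff)
  qed
  obtain us \<eta>s where us: "dual_basis V ?A us \<eta>s" using fd_space_subspace(1)[OF V sub] by blast
  \<comment> \<open>the correction takes away the values at \<open>ws\<close> and changes nothing where \<open>\<omega>s\<close> vanish\<close>
  define red where "red \<eta> x = \<eta> x - (\<Sum>i<length ws. \<eta> (ws ! i) * (\<omega>s ! i) x)" for \<eta> x
  have len: "length \<omega>s = length ws" "length \<eta>s = length us"
    using db us by (auto simp: dual_basis_def)
  have red_lf: "linear_form V (red \<eta>)" if "linear_form V \<eta>" for \<eta>
  proof -
    have "linear_form V (\<lambda>x. (\<Sum>i<length ws. \<eta> (ws ! i) * (\<omega>s ! i) x))"
      using lf len by (intro linear_form_comb_forms) auto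
    from linear_form_diff_scale[OF that this, of 1] show ?thesis by (simp add: red_def[abs_def])
  qed
  have red_ws: "red \<eta> (ws ! j) = 0" if "j < length ws" for \<eta> j
  proof -
    have "(\<Sum>i<length ws. \<eta> (ws ! i) * (\<omega>s ! i) (ws ! j)) = (\<Sum>i<length ws.
      if i = j then \<eta> (ws ! i) else 0)"
      using db that by (intro sum.cong) (auto simp: dual_basis_def)
    then show ?thesis using that by (simp add: red_def)
  qed
  have red_A: "red \<eta> x = \<eta> x" if "\<forall>\<omega>\<in>set \<omega>s. \<omega> x = 0" for \<eta> x
  proof -
    have "(\<omega>s ! i) x = 0" if "i < length ws" for i
      using that \<open>\<forall>\<omega>\<in>set \<omega>s. \<omega> x = 0\<close> len by (metis nth_mem)
    then show ?thesis by (simp add: red_def)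
  qed
  have usA: "\<omega> (us ! j) = 0" if "\<omega> \<in> set \<omega>s" "j < length us" for \<omega> j
    using us that by (auto simp: dual_basis_def subset_iff)
  have "dual_basis V A (ws @ us) (\<omega>s @ map red \<eta>s)"
    unfolding dual_basis_def
  proof (intro conjI ballI allI impI)
    show "length (\<omega>s @ map red \<eta>s) = length (ws @ us)" using len by simp
    show "set (ws @ us) \<subseteq> A" using db us WA by (auto simp: dual_basis_def)
    show "linear_form V \<omega>" if "\<omega> \<in> set (\<omega>s @ map red \<eta>s)" for \<omega>
      using that lf us by (auto simp: dual_basis_def intro!: red_lf)
    fix i j assume ij: "i < length (ws @ us)" "j < length (ws @ us)"
    show "((\<omega>s @ map red \<eta>s) ! i) ((ws @ us) ! j) = (if i = j then 1 else 0)"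
    proof (cases "i < length ws")
      case True
      then show ?thesis using ij db usA len by (auto simp: nth_append dual_basis_def)
    next
      case False
      then have i: "i - length ws < length us" using ij by auto
      show ?thesis
      proof (cases "j < length ws")
        case True
        then show ?thesis using False red_ws i len by (auto simp: nth_append)
      next
        case j: False
        then have "j - length ws < length us" using ij by auto
        moreover from this have "red (\<eta>s ! (i - length ws)) (us ! (j - length ws))
          = (\<eta>s ! (i - length ws)) (us ! (j - length ws))"
          using usA by (intro red_A) auto
        ultimately show ?thesis using False j i len us by (auto simp: nth_append dual_basis_def)
      qed
    qed
  next
    fix x assume x: "x \<in> A" "\<forall>\<omega>\<in>set (\<omega>s @ map red \<eta>s). \<omega> x = 0"
    then have "x \<in> ?A" by auto
    moreover have "\<eta> x = 0" if "\<eta> \<in> set \<eta>s" for \<eta>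
    proof -
      have "red \<eta> x = 0" using x that by simp
      moreover have "red \<eta> x = \<eta> x" using x by (intro red_A) simp
      ultimately show ?thesis by simp
    qed
    ultimately show "x = \<zero>\<^bsub>V\<^esub>" using us by (auto simp: dual_basis_def)
  qed
  then show ?thesis by blast
qed


section \<open>Pluecker coordinates of a subspace\<close>

text \<open>The matrices of values at \<open>us\<close> and at \<open>vs\<close> differ by the matrix of the change of basis. Its
  determinant is not zero since the coordinate of \<open>vs\<close> at the forms dual to \<open>vs\<close> is \<open>1\<close>.\<close>

lemma pluecker_change_basis:
  fixes V :: "('k::field, 'a) module"
  assumes "kspace V" and W: "is_subspace W V"
    and us: "dual_basis V W us \<omega>s" and vs: "dual_basis V W vs \<theta>s"
  shows "\<exists>c. c \<noteq> 0 \<and> (\<forall>\<xi>s. pluecker_coord V vs \<xi>s = c * pluecker_coord V us \<xi>s)"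
proof -
  interpret kspace V by fact
  have len: "length vs = length us"
    using dual_basis_dim[OF W us] dual_basis_dim[OF W vs] by simp
  let ?n = "length us"
  define B where "B = mat ?n ?n (\<lambda>(i, j). (\<omega>s ! i) (vs ! j))"
  have *: "pluecker_coord V vs \<xi>s = det B * pluecker_coord V us \<xi>s" for \<xi>s
  proof (cases "length \<xi>s = ?n \<and> (\<forall>\<xi>\<in>set \<xi>s. linear_form V \<xi>)")
    case True
    have "mat ?n ?n (\<lambda>(s, t). (\<xi>s ! s) (vs ! t)) = mat ?n ?n (\<lambda>(s, t). (\<xi>s ! s) (us ! t)) * B"
    proof (rule eq_matI; simp add: B_def scalar_prod_def)
      fix s t assume st: "s < ?n" "t < ?n"
      then have "vs ! t \<in> W" using vs len by (auto simp: dual_basis_def)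
      moreover have "linear_form (V\<lparr>carrier := W\<rparr>) (\<xi>s ! s)"
        using st True by (intro linear_form_subspace[OF W]) auto
      ultimately show "(\<xi>s ! s) (vs ! t) = (\<Sum>i = 0..<?n. (\<xi>s ! s) (us ! i) * (\<omega>s ! i) (vs ! t))"
        using form_expansion[OF W us, of "vs ! t" "\<xi>s ! s"]
        by (simp add: atLeast0LessThan mult.commute)
    qed
    moreover have "det (mat ?n ?n (\<lambda>(s, t). (\<xi>s ! s) (us ! t)) * B)
        = det (mat ?n ?n (\<lambda>(s, t). (\<xi>s ! s) (us ! t))) * det B"
      by (rule det_mult) (auto simp: B_def)
    ultimately show ?thesis using True len by (simp add: pluecker_coord_def)
  next
    case False
    then show ?thesis using len by (auto simp: pluecker_coord_def)
  qed
  have "mat (length vs) (length vs) (\<lambda>(s, t). (\<theta>s ! s) (vs ! t)) = 1\<^sub>m (length vs)"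
    by (rule eq_matI) (use vs in \<open>simp_all add: dual_basis_def\<close>)
  then have "pluecker_coord V vs \<theta>s = 1"
    using vs by (simp add: pluecker_coord_def dual_basis_def)
  then have "det B \<noteq> 0" using *[of \<theta>s] by auto
  with * show ?thesis by blast
qed

text \<open>All systems of homogeneous coordinates of a point are multiples of the one given by a single basis. So
  a map on coordinates that is linear in every factor has to be computed for one suitable basis only.\<close>

lemma gr_point_eq:
  fixes V :: "'i \<Rightarrow> ('k::field, 'a) module"
  assumes V: "\<And>i. i \<in> I \<Longrightarrow> fd_space (V i)"
    and W: "\<And>i. i \<in> I \<Longrightarrow> is_subspace (W i) (V i)"
    and us: "\<And>i. i \<in> I \<Longrightarrow> dual_basis (V i) (W i) (us i) (\<omega>s i)"
  shows "gr_point I V W = {\<lambda>i \<xi>s. if i \<in> I then c i * pluecker_coord (V i) (us i) \<xi>s else 0 | c.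
    \<forall>i\<in>I. c i \<noteq> 0}" (is "_ = ?R")
proof
  show "?R \<subseteq> gr_point I V W"
  proof
    fix z assume "z \<in> ?R"
    then obtain c where c: "\<forall>i\<in>I. c i \<noteq> 0"
      "z = (\<lambda>i \<xi>s. if i \<in> I then c i * pluecker_coord (V i) (us i) \<xi>s else 0)" by auto
    have "distinct (us i) \<and> vectorspace.basis class_ring ((V i)\<lparr>carrier := W i\<rparr>) (set (us i))"
      if "i \<in> I" for i
      using kspace.dual_basis_imp_basis[OF fd_spaceD[OF V] W us, OF that that that]
        kspace.dual_basis_distinct[OF fd_spaceD[OF V] us, OF that that] by simp
    with c show "z \<in> gr_point I V W" unfolding gr_point_def by blast
  qed
  show "gr_point I V W \<subseteq> ?R"
  proof
    fix z assume "z \<in> gr_point I V W"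
    then obtain c vs where c: "\<forall>i\<in>I. c i \<noteq> 0 \<and> distinct (vs i) \<and>
        vectorspace.basis class_ring ((V i)\<lparr>carrier := W i\<rparr>) (set (vs i))"
      "z = (\<lambda>i \<xi>s. if i \<in> I then c i * pluecker_coord (V i) (vs i) \<xi>s else 0)"
      unfolding gr_point_def by blast
    have "\<forall>i\<in>I. \<exists>d. d \<noteq> 0 \<and> (\<forall>\<xi>s. pluecker_coord (V i) (vs i) \<xi>s = d * pluecker_coord (V i) (us i)
      \<xi>s)"
    proof
      fix i assume i: "i \<in> I"
      then obtain \<theta>s where "dual_basis (V i) (W i) (vs i) \<theta>s"
        using dual_basis_if_basis[OF V W] c by meson
      from pluecker_change_basis[OF fd_spaceD[OF V] W us this, OF i i i]
      show "\<exists>d. d \<noteq> 0 \<and> (\<forall>\<xi>s. pluecker_coord (V i) (vs i) \<xi>s = d * pluecker_coord (V i) (us i) \<xi>s)"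
        .
    qed
    then obtain d where d: "\<forall>i\<in>I. d i \<noteq> 0 \<and>
        (\<forall>\<xi>s. pluecker_coord (V i) (vs i) \<xi>s = d i * pluecker_coord (V i) (us i) \<xi>s)" by metis
    then have "z = (\<lambda>i \<xi>s. if i \<in> I then (c i * d i) * pluecker_coord (V i) (us i) \<xi>s else 0)"
      unfolding c(2) by (auto simp: fun_eq_iff)
    moreover have "\<forall>i\<in>I. c i * d i \<noteq> 0" using c d by simp
    ultimately show "z \<in> ?R" by (intro CollectI exI[of _ "\<lambda>i. c i * d i"] conjI)
  qed
qed

text \<open>Laplace expansion along the first \<open>s\<close> columns, one after the other. These columns are constants \<open>a i j\<close>,
  and only the remaining ones depend on \<open>us\<close>. Hence the determinant is a linear combination of minors of
  the remaining columns whose coefficients, recorded in \<open>L\<close>, do not depend on \<open>us\<close>.\<close>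

lemma det_constant_columns:
  fixes a :: "nat \<Rightarrow> nat \<Rightarrow> 'k::field" and fs :: "('a \<Rightarrow> 'k) list"
  assumes "s \<le> length fs"
  shows "\<exists>L. (\<forall>(c, gs)\<in>set L. set gs \<subseteq> set fs \<and> length gs = length fs - s) \<and>
    (\<forall>us. length us + s = length fs \<longrightarrow>
      det (mat (length fs) (length fs) (\<lambda>(i, j). if j < s then a i j else (fs ! i) (us ! (j - s))))
      = (\<Sum>(c, gs)\<leftarrow>L. c * det (mat (length us) (length us) (\<lambda>(i, j). (gs ! i) (us ! j)))))"
  using assms
proof (induction s arbitrary: a fs)
  case 0
  show ?case by (intro exI[of _ "[(1, fs)]"]) auto
next
  case (Suc s)
  let ?n = "length fs"
  define del where "del i = take i fs @ drop (Suc i) fs" for i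
  have del: "length (del i) = ?n - 1" "set (del i) \<subseteq> set fs" if "i < ?n" for i
    using that by (auto simp: del_def dest: in_set_takeD in_set_dropD)
  have del_nth: "del i ! k = fs ! (if k < i then k else Suc k)" if "i < ?n" "k < ?n - 1" for i k
    using that by (auto simp: del_def nth_append min_def)
  define good where "good i L \<longleftrightarrow> (\<forall>(c, gs)\<in>set L. set gs \<subseteq> set (del i) \<and> length gs
    = length (del i) - s) \<and>
    (\<forall>us. length us + s = length (del i) \<longrightarrow>
      det (mat (length (del i)) (length (del i)) (\<lambda>(k, j). if j < s then a (if k < i then k else Suc k) (Suc j)
          else (del i ! k) (us ! (j - s))))
      = (\<Sum>(c, gs)\<leftarrow>L. c * det (mat (length us) (length us) (\<lambda>(i, j). (gs ! i) (us ! j)))))" for i L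
  have "\<exists>L. good i L" if "i < ?n" for i
    unfolding good_def
    using Suc.prems del[OF that] by (intro Suc.IH[of "del i" "\<lambda>k j. a (if k < i then k else Suc k) (Suc j)"]) simp
  then have "good i (SOME L. good i L)" if "i < ?n" for i
    using that by (simp add: some_eq_ex)
  then obtain L where "\<And>i. i < ?n \<Longrightarrow> good i (L i)" by (rule that)
  then have L: "\<And>i. i < ?n \<Longrightarrow> \<forall>(c, gs)\<in>set (L i). set gs \<subseteq> set (del i) \<and> length gs
    = length (del i) - s"
    "\<And>i us. i < ?n \<Longrightarrow> length us + s = length (del i) \<Longrightarrow>
      det (mat (length (del i)) (length (del i)) (\<lambda>(k, j). if j < s then a (if k < i then k else Suc k) (Suc j)
          else (del i ! k) (us ! (j - s))))
      = (\<Sum>(c, gs)\<leftarrow>L i. c * det (mat (length us) (length us) (\<lambda>(i, j). (gs ! i) (us ! j))))"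
    by (auto simp: good_def)
  define M where "M = concat (map (\<lambda>i. map (\<lambda>(c, gs). (a i 0 * (- 1) ^ i * c, gs)) (L i)) [0..<?n])"
  show ?case
  proof (intro exI[of _ M] conjI allI impI)
    show "\<forall>(c, gs)\<in>set M. set gs \<subseteq> set fs \<and> length gs = ?n - Suc s"
      using L(1) del by (fastforce simp: M_def)
    fix us :: "'a list" assume us: "length us + Suc s = ?n"
    let ?A = "mat ?n ?n (\<lambda>(i, j). if j < Suc s then a i j else (fs ! i) (us ! (j - Suc s)))"
    let ?D = "\<lambda>gs. det (mat (length us) (length us) (\<lambda>(i, j). (gs ! i) (us ! j)))"
    have "det ?A = (\<Sum>i<?n. ?A $$ (i, 0) * cofactor ?A i 0)"
      using us by (intro laplace_expansion_column) auto
    also have "\<dots> = (\<Sum>i<?n. \<Sum>(c, gs)\<leftarrow>L i. a i 0 * (- 1) ^ i * c * ?D gs)"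
    proof (rule sum.cong[OF refl])
      fix i assume "i \<in> {..<?n}"
      then have i: "i < ?n" by simp
      have "mat_delete ?A i 0 = mat (length (del i)) (length (del i))
          (\<lambda>(k, j). if j < s then a (if k < i then k else Suc k) (Suc j) else (del i ! k)
            (us ! (j - s)))"
        using i del[OF i] by (auto simp: mat_delete_def del_nth)
      then have "cofactor ?A i 0 = (- 1) ^ i * (\<Sum>(c, gs)\<leftarrow>L i. c * ?D gs)"
        using L(2)[OF i, of us] us del[OF i] by (simp add: cofactor_def)
      moreover have "?A $$ (i, 0) = a i 0" using i by (subst index_mat) auto
      ultimately show "?A $$ (i, 0) * cofactor ?A i 0
        = (\<Sum>(c, gs)\<leftarrow>L i. a i 0 * (- 1) ^ i * c * ?D gs)"
        by (simp add: sum_list_const_mult[symmetric] case_prod_unfold mult.assoc)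
    qed
    also have "\<dots> = (\<Sum>(c, gs)\<leftarrow>M. c * ?D gs)"
    proof -
      have concat: "sum_list (map h (concat xss)) = (\<Sum>xs\<leftarrow>xss. sum_list (map h xs))"
        for h :: "'k \<times> ('a \<Rightarrow> 'k) list \<Rightarrow> 'k" and xss by (induction xss) auto
      show ?thesis
        by (simp add: M_def concat comp_def case_prod_unfold interv_sum_list_conv_sum_set_nat
            atLeast0LessThan)
    qed
    finally show "det ?A = (\<Sum>(c, gs)\<leftarrow>M. c * ?D gs)" .
  qed
qed


section \<open>Morphisms given by linear substitutions of coordinates\<close>

text \<open>The new coordinates with index \<open>i\<close> are linear combinations of the old coordinates with the same index
  \<open>i\<close>; the list \<open>C i j\<close> contains the coefficients of the new coordinate \<open>j\<close> and the old coordinates they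
  belong to.\<close>

definition coord_subst :: "('i \<Rightarrow> 'j' \<Rightarrow> ('k \<times> 'j) list) \<Rightarrow> ('i \<Rightarrow> 'j \<Rightarrow> 'k::field) \<Rightarrow> 'i \<Rightarrow> 'j' \<Rightarrow> 'k"
  where
  "coord_subst C z = (\<lambda>i j. \<Sum>(c, l)\<leftarrow>C i j. c * z i l)"

lemma multihomog_scale: "multihomog d p \<Longrightarrow> multihomog d (\<lambda>z. c * p z)"
  using multihomog.mult[OF multihomog.const, of d p c] by simp

lemma multihomog_coord_subst:
  assumes "multihomog d p"
  shows "multihomog d (\<lambda>z. p (coord_subst C z))"
  using assms
proof induction
  case (coord i j)
  have "multihomog (\<lambda>l. if l = i then 1 else 0) (\<lambda>z. \<Sum>(c, l)\<leftarrow>L. c * z i l)" for L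
    by (induction L) (use multihomog_scale[OF multihomog.coord, where c = 0]
      multihomog.add[OF multihomog_scale[OF multihomog.coord]] in \<open>auto simp: split_beta\<close>)
  then show ?case by (simp add: coord_subst_def)
qed (auto intro: multihomog.intros)

text \<open>A substitution that is linear within each factor turns a multihomogeneous polynomial into one of the
  same multidegree, so open sets and regular functions pull back. A point being the set of its systems
  of coordinates, the substitution acts on it by taking images.\<close>

lemma variety_morphism_coord_subst:
  assumes XY: "\<And>x. x \<in> X \<Longrightarrow> coord_subst C ` x \<in> Y"
  shows "variety_morphism X Y (\<lambda>x. coord_subst C ` x)"
proof -
  have op: "zariski_open X {x \<in> X. coord_subst C ` x \<in> T}" if T: "zariski_open Y T" for T
  proof -
    obtain S where S: "\<forall>p\<in>S. \<exists>d. multihomog d p" "T = {y \<in> Y. \<exists>p\<in>S. \<exists>z\<in>y. p z \<noteq> 0}"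
      using T by (auto simp: zariski_open_def)
    let ?S = "(\<lambda>p z. p (coord_subst C z)) ` S"
    have "\<forall>p\<in>?S. \<exists>d. multihomog d p" using S(1) multihomog_coord_subst by blast
    moreover have "{x \<in> X. coord_subst C ` x \<in> T} = {x \<in> X. \<exists>p\<in>?S. \<exists>z\<in>x. p z \<noteq> 0}"
      using S(2) XY by auto
    ultimately show ?thesis unfolding zariski_open_def by blast
  qed
  have "regular_on X {x \<in> X. coord_subst C ` x \<in> T} (\<lambda>x. f (coord_subst C ` x))"
    if f: "regular_on Y T f" for T f
    unfolding regular_on_def
  proof
    fix x assume x: "x \<in> {x \<in> X. coord_subst C ` x \<in> T}"
    then obtain T' d p q where *: "zariski_open Y T'" "coord_subst C ` x \<in> T'" "T' \<subseteq> T"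
      "multihomog d p" "multihomog d q" "\<forall>y\<in>T'. \<forall>z\<in>y. q z \<noteq> 0 \<and> f y = p z / q z"
      using f unfolding regular_on_def by blast
    show "\<exists>T' d p q. zariski_open X T' \<and> x \<in> T' \<and> T' \<subseteq> {x \<in> X. coord_subst C ` x \<in> T} \<and>
        multihomog d p \<and> multihomog d q \<and> (\<forall>y\<in>T'. \<forall>z\<in>y. q z \<noteq> 0 \<and> f (coord_subst C ` y)
          = p z / q z)"
      using op[OF *(1)] x * multihomog_coord_subst[OF *(4), of C] multihomog_coord_subst[OF *(5),
        of C]
      by (intro exI[of _ "{x \<in> X. coord_subst C ` x \<in> T'}"] exI[of _ d]
          exI[of _ "\<lambda>z. p (coord_subst C z)"] exI[of _ "\<lambda>z. q (coord_subst C z)"]) auto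
  qed
  with op XY show ?thesis by (auto simp: variety_morphism_def)
qed

lemma variety_iso_coord_subst:
  assumes "\<And>x. x \<in> X \<Longrightarrow> coord_subst C ` x \<in> Y" "\<And>y. y \<in> Y \<Longrightarrow> coord_subst D ` y \<in> X"
    and "\<And>x. x \<in> X \<Longrightarrow> coord_subst D ` coord_subst C ` x = x"
    and "\<And>y. y \<in> Y \<Longrightarrow> coord_subst C ` coord_subst D ` y = y"
  shows "variety_iso X Y"
  unfolding variety_iso_def
proof (intro exI conjI ballI)
  show "variety_morphism X Y (\<lambda>x. coord_subst C ` x)"
    by (rule variety_morphism_coord_subst) (rule assms(1))
  show "variety_morphism Y X (\<lambda>y. coord_subst D ` y)"
    by (rule variety_morphism_coord_subst) (rule assms(2))
qed (simp_all only: assms(3,4))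


section \<open>Grassmannians of quotient spaces\<close>

locale quotient_space = kspace V for V :: "('k::field, 'a) module" (structure) +
  fixes W :: "'a set"
  assumes W: "is_subspace W V"
begin

abbreviation cls :: "'a \<Rightarrow> 'a set" where "cls x \<equiv> W +> x"
abbreviation quot :: "('k, 'a set) module" where "quot \<equiv> quot_space V W"

lemma W_carrier: "x \<in> W \<Longrightarrow> x \<in> carrier V"
  using W by (auto simp: subspace_iff)

lemma minus_eq_scale: "x \<in> carrier V \<Longrightarrow> \<ominus> x = (- 1) \<odot> x"
  using add_scale_neg[of x] by (intro minus_equality) (auto simp: a_comm)

sublocale cosets: abelian_subgroup W V
proof (rule abelian_subgroupI3)
  show "additive_subgroup W V"
    using W minus_eq_scale
    by (intro additive_subgroup.intro subgroup.intro) (auto simp: subspace_iff subset_iff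
      a_inv_def[symmetric])
qed unfold_locales

lemma cls_eq_iff:
  assumes "x \<in> carrier V" "y \<in> carrier V"
  shows "cls x = cls y \<longleftrightarrow> x \<oplus> (- 1) \<odot> y \<in> W"
proof
  assume "cls x = cls y"
  then have "x \<in> cls y" using cosets.a_rcos_self[OF assms(1)] by simp
  then show "x \<oplus> (- 1) \<odot> y \<in> W"
    using assms cosets.a_rcos_module_imp[of y x] by (simp add: minus_eq_scale)
next
  assume "x \<oplus> (- 1) \<odot> y \<in> W"
  then have "x \<in> cls y" using assms cosets.a_rcos_module_rev[of y x] by (simp add: minus_eq_scale)
  then show "cls x = cls y" using cosets.a_repr_independence'[of x y] assms by auto
qed

lemma in_cls_iff:
  assumes "x \<in> carrier V"
  shows "y \<in> cls x \<longleftrightarrow> y \<in> carrier V \<and> cls y = cls x"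
proof
  assume y: "y \<in> cls x"
  then have "y \<in> carrier V" using assms W_carrier by (auto simp: a_r_coset_def')
  then show "y \<in> carrier V \<and> cls y = cls x"
    using cosets.a_repr_independence'[OF y assms] by auto
qed (use cosets.a_rcos_self in auto)

lemma cls_zero: "cls \<zero> = W"
  using W_carrier by (intro a_coset_add_zero) auto

lemma cls_eq_W_iff: "x \<in> carrier V \<Longrightarrow> cls x = W \<longleftrightarrow> x \<in> W"
  using cls_eq_iff[of x \<zero>] cls_zero by simp

lemma carrier_quot: "carrier quot = cls ` carrier V"
  by (auto simp: quot_space_def A_RCOSETS_def RCOSETS_def a_r_coset_def)

lemma quot_zero: "\<zero>\<^bsub>quot\<^esub> = cls \<zero>"
  by (simp add: quot_space_def cls_zero)

lemma quot_ops:
  assumes "x \<in> carrier V"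
  shows "y \<in> carrier V \<Longrightarrow> cls x \<oplus>\<^bsub>quot\<^esub> cls y = cls (x \<oplus> y)"
    and "c \<odot>\<^bsub>quot\<^esub> cls x = cls (c \<odot> x)"
proof -
  show "cls x \<oplus>\<^bsub>quot\<^esub> cls y = cls (x \<oplus> y)" if "y \<in> carrier V"
    using cosets.a_rcos_sum[OF assms that] by (simp add: quot_space_def)
  have "cls (c \<odot> y) = cls (c \<odot> x)" if "y \<in> cls x" for y
  proof -
    from that have y: "y \<in> carrier V" "y \<oplus> (- 1) \<odot> x \<in> W"
      using in_cls_iff[OF assms] cls_eq_iff[OF _ assms] by auto
    have "c \<odot> y \<oplus> (- 1) \<odot> (c \<odot> x) = c \<odot> (y \<oplus> (- 1) \<odot> x)"
      using y assms by (simp add: scale_add_right scale_scale)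
    also have "\<dots> \<in> W" using W y by (auto simp: subspace_iff)
    finally show ?thesis using y assms by (subst cls_eq_iff) auto
  qed
  then have "(\<Union>y\<in>cls x. cls (c \<odot> y)) = (\<Union>y\<in>cls x. cls (c \<odot> x))" by (intro SUP_cong) auto
  also have "\<dots> = cls (c \<odot> x)" using cosets.a_rcos_self[OF assms] by blast
  finally show "c \<odot>\<^bsub>quot\<^esub> cls x = cls (c \<odot> x)"
    by (simp add: quot_space_def)
qed

sublocale quot: kspace quot
  unfolding kspace_def
proof (rule vs_criteria)
  show "field (class_ring :: 'k ring)" by (rule class_field)
  show "\<zero>\<^bsub>quot\<^esub> \<in> carrier quot" by (auto simp: carrier_quot quot_zero)
  show "\<forall>v\<in>carrier quot. \<exists>neg_v\<in>carrier quot. v \<oplus>\<^bsub>quot\<^esub> neg_v = \<zero>\<^bsub>quot\<^esub>"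
  proof
    fix v assume "v \<in> carrier quot"
    then obtain x where x: "x \<in> carrier V" "v = cls x" by (auto simp: carrier_quot)
    then have "v \<oplus>\<^bsub>quot\<^esub> cls ((- 1) \<odot> x) = \<zero>\<^bsub>quot\<^esub>" by (simp add: quot_ops quot_zero)
    then show "\<exists>neg_v\<in>carrier quot. v \<oplus>\<^bsub>quot\<^esub> neg_v = \<zero>\<^bsub>quot\<^esub>"
      using x by (auto simp: carrier_quot)
  qed
qed (auto simp: carrier_quot quot_ops quot_zero a_assoc a_comm a_lcomm scale_scale scale_add_left
  scale_add_right)

lemma pullback_form: "linear_form quot \<eta> \<Longrightarrow> linear_form V (\<lambda>x. \<eta> (cls x))"
  unfolding linear_form_def carrier_quot by (auto simp: quot_ops[symmetric])

text \<open>For a form \<open>\<xi>\<close> that vanishes on \<open>W\<close> this is the induced form on \<open>V / W\<close>, as then all elements of a coset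
  give the same value.\<close>

definition descend :: "('a \<Rightarrow> 'k) \<Rightarrow> 'a set \<Rightarrow> 'k" where
  "descend \<xi> A = \<xi> (SOME x. x \<in> A)"

lemma descend_cls:
  assumes "linear_form V \<xi>" "\<And>w. w \<in> W \<Longrightarrow> \<xi> w = 0" "x \<in> carrier V"
  shows "descend \<xi> (cls x) = \<xi> x"
proof -
  let ?y = "SOME y. y \<in> cls x"
  have "?y \<in> cls x" using cosets.a_rcos_self[OF assms(3)] by (rule someI)
  then have y: "?y \<in> carrier V" "?y \<oplus> (- 1) \<odot> x \<in> W"
    using in_cls_iff[OF assms(3)] cls_eq_iff[OF _ assms(3)] by auto
  have "\<xi> ?y + (- 1) * \<xi> x = 0"
    using assms(2)[OF y(2)] linear_formD[OF assms(1)] y assms(3) by simp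
  then show ?thesis by (simp add: descend_def)
qed

lemma linear_form_descend:
  assumes "linear_form V \<xi>" "\<And>w. w \<in> W \<Longrightarrow> \<xi> w = 0"
  shows "linear_form quot (descend \<xi>)"
  unfolding linear_form_def carrier_quot
  using linear_formD[OF assms(1)] by (auto simp: quot_ops descend_cls[OF assms])

lemma subspace_image:
  assumes "is_subspace A V"
  shows "is_subspace (cls ` A) quot"
proof -
  have *: "\<zero> \<in> A" "\<And>x y. x \<in> A \<Longrightarrow> y \<in> A \<Longrightarrow> x \<oplus> y \<in> A" "\<And>c x. x \<in> A \<Longrightarrow> c \<odot> x \<in> A"
    "\<And>x. x \<in> A \<Longrightarrow> x \<in> carrier V" using assms by (auto simp: subspace_iff)
  show ?thesis unfolding quot.subspace_iff
    using * by (auto simp: carrier_quot quot_ops quot_zero)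
qed

lemma subspace_preimage:
  assumes "is_subspace B quot"
  shows "is_subspace {x \<in> carrier V. cls x \<in> B} V"
  using assms unfolding subspace_iff quot.subspace_iff
  by (auto simp: quot_ops[symmetric] quot_zero[symmetric])

lemma preimage_contains:
  assumes "is_subspace B quot"
  shows "W \<subseteq> {x \<in> carrier V. cls x \<in> B}"
proof
  fix x assume x: "x \<in> W"
  then have "cls x = \<zero>\<^bsub>quot\<^esub>" using cls_eq_W_iff W_carrier by (simp add: quot_space_def)
  then show "x \<in> {x \<in> carrier V. cls x \<in> B}"
    using x assms W_carrier by (simp add: quot.subspace_iff)
qed

lemma image_preimage:
  assumes "is_subspace B quot"
  shows "cls ` {x \<in> carrier V. cls x \<in> B} = B"
  using assms unfolding quot.subspace_iff carrier_quot by auto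

lemma dual_basis_append:
  assumes "dual_basis V A (ws @ us) (\<omega>s @ \<eta>s)" "length \<omega>s = length ws"
  shows "\<And>i j. i < length ws \<Longrightarrow> j < length us \<Longrightarrow> (\<omega>s ! i) (us ! j) = 0"
    and "\<And>i j. i < length us \<Longrightarrow> j < length ws \<Longrightarrow> (\<eta>s ! i) (ws ! j) = 0"
    and "\<And>i j. i < length us \<Longrightarrow> j < length us \<Longrightarrow> (\<eta>s ! i) (us ! j) = (if i = j then 1 else 0)"
    and "length \<eta>s = length us"
proof -
  have *: "((\<omega>s @ \<eta>s) ! i) ((ws @ us) ! j) = (if i = j then 1 else 0)"
    if "i < length (ws @ us)" "j < length (ws @ us)" for i j
    using assms that by (auto simp: dual_basis_def)
  show "(\<omega>s ! i) (us ! j) = 0" if "i < length ws" "j < length us" for i j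
    using *[of i "length ws + j"] that assms(2) by (simp add: nth_append)
  show "(\<eta>s ! i) (ws ! j) = 0" if "i < length us" "j < length ws" for i j
    using *[of "length ws + i" j] that assms(2) by (simp add: nth_append)
  show "(\<eta>s ! i) (us ! j) = (if i = j then 1 else 0)" if "i < length us" "j < length us" for i j
    using *[of "length ws + i" "length ws + j"] that assms(2) by (simp add: nth_append)
  show "length \<eta>s = length us" using assms by (simp add: dual_basis_def)
qed

lemma form_vanishes_on_W:
  assumes "dual_basis V W ws \<omega>s" "linear_form V \<xi>" "\<And>j. j < length ws \<Longrightarrow> \<xi> (ws ! j) = 0" "w \<in> W"
  shows "\<xi> w = 0"
  using form_expansion[OF W assms(1,4) linear_form_subspace[OF W assms(2)]] assms(3) by simp

text \<open>The forms \<open>\<eta>s\<close> vanish on \<open>W\<close>, because they vanish at \<open>ws\<close>, and so descend to \<open>V / W\<close>. If they all vanish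
  at the class of \<open>x\<close>, then subtracting from \<open>x\<close> its component in \<open>W\<close> gives a common zero of all forms.\<close>

lemma dual_basis_quot:
  assumes A: "is_subspace A V" "W \<subseteq> A" and ws: "dual_basis V W ws \<omega>s"
    and us: "dual_basis V A (ws @ us) (\<omega>s @ \<eta>s)"
  shows "dual_basis quot (cls ` A) (map cls us) (map descend \<eta>s)"
proof -
  have len: "length \<omega>s = length ws" using ws by (simp add: dual_basis_def)
  note app = dual_basis_append[OF us len]
  have AV: "x \<in> carrier V" if "x \<in> A" for x using that A by (auto simp: subspace_iff)
  have lf: "linear_form V \<eta>" if "\<eta> \<in> set \<eta>s" for \<eta> using us that by (simp add: dual_basis_def)
  have van: "\<eta> w = 0" if "\<eta> \<in> set \<eta>s" "w \<in> W" for \<eta> w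
  proof (rule form_vanishes_on_W[OF ws lf[OF that(1)] _ that(2)])
    fix j assume "j < length ws"
    then show "\<eta> (ws ! j) = 0" using that(1) app by (metis in_set_conv_nth)
  qed
  show ?thesis
    unfolding dual_basis_def
  proof (intro conjI ballI allI impI)
    show "length (map descend \<eta>s) = length (map cls us)" using app by simp
    show "set (map cls us) \<subseteq> cls ` A" using us by (auto simp: dual_basis_def)
    show "linear_form quot \<omega>" if "\<omega> \<in> set (map descend \<eta>s)" for \<omega>
      using that lf van by (auto intro!: linear_form_descend)
    show "(map descend \<eta>s ! i) (map cls us ! j) = (if i = j then 1 else 0)"
      if "i < length (map cls us)" "j < length (map cls us)" for i j
    proof -
      have mem: "\<eta>s ! i \<in> set \<eta>s" using that app(4) by simp
      have "us ! j \<in> set us" using that by simp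
      then have "us ! j \<in> carrier V" using us AV by (auto simp: dual_basis_def)
      from descend_cls[OF lf van this, OF mem mem] show ?thesis
        using that app(3,4) by simp
    qed
    fix a assume a: "a \<in> cls ` A" "\<forall>\<omega>\<in>set (map descend \<eta>s). \<omega> a = 0"
    then obtain x where x: "x \<in> A" "a = cls x" by auto
    define y where "y = comb (\<lambda>i. (\<omega>s ! i) x) ws"
    have wsW: "set ws \<subseteq> W" using ws by (simp add: dual_basis_def)
    have y: "y \<in> W" using comb_in_subspace[OF W wsW] by (simp add: y_def)
    let ?z = "x \<oplus> (- 1) \<odot> y"
    have z: "?z \<in> A" using x y A by (auto simp: subspace_iff)
    have yV: "y \<in> carrier V" using y W_carrier by simp
    have "\<omega> ?z = 0" if "\<omega> \<in> set (\<omega>s @ \<eta>s)" for \<omega>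
    proof -
      have lf': "linear_form V \<omega>" using us that by (simp add: dual_basis_def)
      have "\<omega> ?z = \<omega> x - \<omega> y" using linear_formD[OF lf'] x yV AV by simp
      also have "\<dots> = 0"
      proof (cases "\<omega> \<in> set \<eta>s")
        case True
        have "descend \<omega> (cls x) = \<omega> x" using lf van True x AV by (intro descend_cls) auto
        then have "\<omega> x = 0" using a x True by simp
        then show ?thesis using van[OF True y] by simp
      next
        case False
        then have "\<omega> \<in> set \<omega>s" using that by simp
        then obtain j where j: "j < length ws" "\<omega> = \<omega>s ! j" using len by (metis in_set_conv_nth)
        have "\<omega> y = \<omega> x"
          unfolding y_def using wsW W_carrier dual_basis_sum[OF ws j(1)]
          by (subst linear_form_comb[OF lf']) (auto simp: j)
        then show ?thesis by simp
      qed
      finally show ?thesis .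
    qed
    then have "?z = \<zero>" using us z by (simp add: dual_basis_def)
    then have "x = y" using x y AV W_carrier by (metis eq_if_diff_zero)
    then show "a = \<zero>\<^bsub>quot\<^esub>" using y x cls_eq_W_iff W_carrier by (simp add: quot_space_def)
  qed
qed

text \<open>Since \<open>\<omega>s\<close> are dual to \<open>ws\<close> and vanish at \<open>us\<close>, and forms pulled back from \<open>V / W\<close> vanish on \<open>W\<close>, the matrix of values at \<open>ws @ us\<close> is
  block diagonal, with a unit matrix as its first block.\<close>

lemma pluecker_quot:
  assumes ws: "dual_basis V W ws \<omega>s" and us: "\<And>i j. i < length ws \<Longrightarrow> j < length us \<Longrightarrow>
    (\<omega>s ! i) (us ! j) = 0"
    and \<eta>s: "\<forall>\<eta>\<in>set \<eta>s. linear_form quot \<eta>"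
  shows "pluecker_coord quot (map cls us) \<eta>s
    = pluecker_coord V (ws @ us) (\<omega>s @ map (\<lambda>\<eta> x. \<eta> (cls x)) \<eta>s)"
proof -
  have len: "length \<omega>s = length ws" using ws by (simp add: dual_basis_def)
  have lf: "\<forall>\<omega>\<in>set \<omega>s. linear_form V \<omega>" using ws by (simp add: dual_basis_def)
  let ?s = "length ws" and ?t = "length us"
  let ?\<xi>s = "\<omega>s @ map (\<lambda>\<eta> x. \<eta> (cls x)) \<eta>s"
  show ?thesis
  proof (cases "length \<eta>s = ?t")
    case True
    let ?A = "mat ?t ?t (\<lambda>(s, t). (\<eta>s ! s) (cls (us ! t)))"
    have van: "(\<eta>s ! i) (cls (ws ! j)) = 0" if "i < ?t" "j < ?s" for i j
    proof -
      have "ws ! j \<in> W" using ws that by (auto simp: dual_basis_def)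
      then have "cls (ws ! j) = \<zero>\<^bsub>quot\<^esub>" using cls_eq_W_iff W_carrier by (simp add: quot_space_def)
      then show ?thesis using quot.linear_form_zero \<eta>s that True by simp
    qed
    have "mat (?s + ?t) (?s + ?t) (\<lambda>(s, t). (?\<xi>s ! s) ((ws @ us) ! t))
        = four_block_mat (1\<^sub>m ?s) (0\<^sub>m ?s ?t) (0\<^sub>m ?t ?s) ?A" (is "?M = ?B")
    proof (rule eq_matI)
      fix i j assume ij: "i < dim_row ?B" "j < dim_col ?B"
      have w: "(\<omega>s ! i) (ws ! j) = (if i = j then 1 else 0)" if "i < ?s" "j < ?s" for i j
        using ws that by (simp add: dual_basis_def)
      show "?M $$ (i, j) = ?B $$ (i, j)"
      proof (cases "i < ?s")
        case True
        then show ?thesis using ij len us w by (auto simp: nth_append)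
      next
        case False
        then show ?thesis using ij len van \<open>length \<eta>s = ?t\<close> by (auto simp: nth_append)
      qed
    qed auto
    then have "det ?M = det (1\<^sub>m ?s) * det ?A"
      by (simp only:) (rule det_four_block_mat_upper_right_zero[of _ ?s _ ?t]; simp)
    moreover have "mat ?t ?t (\<lambda>(s, t). (\<eta>s ! s) (map cls us ! t)) = ?A" by (rule eq_matI) auto
    ultimately show ?thesis using True lf len \<eta>s by (auto simp: pluecker_coord_def pullback_form)
  next
    case False
    then show ?thesis using len by (simp add: pluecker_coord_def)
  qed
qed

text \<open>From a form \<open>\<xi>\<close> one can subtract a combination of \<open>\<omega>s\<close> that agrees with \<open>\<xi>\<close> on \<open>W\<close>. The difference
  descends to \<open>V / W\<close> and takes the same values as \<open>\<xi>\<close> at \<open>us\<close>, where \<open>\<omega>s\<close> vanish. So in the matrix of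
  values the columns of \<open>ws\<close> are constant, and the others depend on the classes of \<open>us\<close> only.\<close>

lemma pluecker_lift:
  assumes ws: "dual_basis V W ws \<omega>s"
  shows "\<exists>L. \<forall>us. set us \<subseteq> carrier V \<and> (\<forall>i<length ws. \<forall>j<length us. (\<omega>s ! i) (us ! j) = 0) \<longrightarrow>
    pluecker_coord V (ws @ us) \<xi>s = (\<Sum>(c, \<eta>s)\<leftarrow>L. c * pluecker_coord quot (map cls us) \<eta>s)"
proof (cases "length ws \<le> length \<xi>s \<and> (\<forall>\<xi>\<in>set \<xi>s. linear_form V \<xi>)")
  case False
  then have "pluecker_coord V (ws @ us) \<xi>s = 0" for us by (auto simp: pluecker_coord_def)
  then show ?thesis by (intro exI[of _ "[]"]) simp
next
  case True
  let ?s = "length ws" and ?n = "length \<xi>s"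
  have len: "length \<omega>s = ?s" using ws by (simp add: dual_basis_def)
  define red where "red \<xi> x = \<xi> x - (\<Sum>i<?s. \<xi> (ws ! i) * (\<omega>s ! i) x)" for \<xi> x
  have red_lf: "linear_form V (red \<xi>)" if "linear_form V \<xi>" for \<xi>
  proof -
    have "linear_form V (\<lambda>x. (\<Sum>i<?s. \<xi> (ws ! i) * (\<omega>s ! i) x))"
      using ws by (intro linear_form_comb_forms) (auto simp: dual_basis_def)
    from linear_form_diff_scale[OF that this, of 1] show ?thesis by (simp add: red_def[abs_def])
  qed
  have red_van: "red \<xi> w = 0" if "linear_form V \<xi>" "w \<in> W" for \<xi> w
  proof -
    have "\<xi> w = (\<Sum>i<?s. (\<omega>s ! i) w * \<xi> (ws ! i))"
      by (rule form_expansion[OF W ws that(2) linear_form_subspace[OF W that(1)]])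
    then show ?thesis by (simp add: red_def mult.commute)
  qed
  define fs where "fs = map (\<lambda>\<xi>. descend (red \<xi>)) \<xi>s"
  have fs: "length fs = ?n" by (simp add: fs_def)
  have fs_lf: "linear_form quot f" if "f \<in> set fs" for f
    using that True red_lf red_van by (auto simp: fs_def intro!: linear_form_descend)
  obtain L where L: "\<forall>(c, gs)\<in>set L. set gs \<subseteq> set fs \<and> length gs = ?n - ?s"
    "\<And>us. length us + ?s = ?n \<Longrightarrow>
      det (mat ?n ?n (\<lambda>(i, j). if j < ?s then (\<xi>s ! i) (ws ! j) else (fs ! i) (us ! (j - ?s))))
      = (\<Sum>(c, gs)\<leftarrow>L. c * det (mat (length us) (length us) (\<lambda>(i, j). (gs ! i) (us ! j))))"
    using det_constant_columns[of ?s fs "\<lambda>i j. (\<xi>s ! i) (ws ! j)"] True fs by auto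
  show ?thesis
  proof (intro exI[of _ L] allI impI)
    fix us assume us: "set us \<subseteq> carrier V \<and> (\<forall>i<?s. \<forall>j<length us. (\<omega>s ! i) (us ! j) = 0)"
    show "pluecker_coord V (ws @ us) \<xi>s = (\<Sum>(c, \<eta>s)\<leftarrow>L. c * pluecker_coord quot (map cls us) \<eta>s)"
    proof (cases "length us + ?s = ?n")
      case False
      then have "pluecker_coord V (ws @ us) \<xi>s = 0" by (simp add: pluecker_coord_def)
      moreover have "pluecker_coord quot (map cls us) gs = 0" if "(c, gs) \<in> set L" for c gs
      proof -
        have "length gs = ?n - ?s" using L(1) that by blast
        then have "length gs \<noteq> length us" using False True by linarith
        then show ?thesis by (simp add: pluecker_coord_def)
      qed
      then have "(\<Sum>(c, \<eta>s)\<leftarrow>L. c * pluecker_coord quot (map cls us) \<eta>s) = (\<Sum>(c, \<eta>s)\<leftarrow>L. 0)"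
        by (intro arg_cong[of _ _ sum_list] map_cong) auto
      ultimately show ?thesis by (simp add: case_prod_unfold)
    next
      case len': True
      have "mat ?n ?n (\<lambda>(s, t). (\<xi>s ! s) ((ws @ us) ! t))
        = mat ?n ?n (\<lambda>(i, j). if j < ?s then (\<xi>s ! i) (ws ! j) else (fs ! i)
          (map cls us ! (j - ?s)))"
      proof (rule eq_matI; simp; intro conjI impI)
        fix i j assume ij: "i < ?n" "j < ?n"
        show "(\<xi>s ! i) ((ws @ us) ! j) = (\<xi>s ! i) (ws ! j)" if "j < ?s"
          using that by (simp add: nth_append)
        show "(\<xi>s ! i) ((ws @ us) ! j) = (fs ! i) (map cls us ! (j - ?s))" if "\<not> j < ?s"
        proof -
          have j: "j - ?s < length us" using that ij len' by simp
          have \<xi>: "linear_form V (\<xi>s ! i)" using True ij by simp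
          have "us ! (j - ?s) \<in> carrier V" using us j by auto
          then have "(fs ! i) (cls (us ! (j - ?s))) = red (\<xi>s ! i) (us ! (j - ?s))"
            using ij red_lf red_van \<xi> by (simp add: fs_def descend_cls)
          also have "\<dots> = (\<xi>s ! i) (us ! (j - ?s))" using us j by (simp add: red_def)
          finally show ?thesis using j that by (simp add: nth_append)
        qed
      qed
      then have "pluecker_coord V (ws @ us) \<xi>s
          = (\<Sum>(c, gs)\<leftarrow>L. c * det (mat (length us) (length us) (\<lambda>(i, j). (gs ! i) (map cls us ! j))))"
        using L(2)[of "map cls us"] len' True by (simp add: pluecker_coord_def add.commute)
      also have "\<dots> = (\<Sum>(c, \<eta>s)\<leftarrow>L. c * pluecker_coord quot (map cls us) \<eta>s)"
        using L(1) fs_lf len' by (intro arg_cong[of _ _ sum_list] map_cong)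
          (auto simp: pluecker_coord_def subset_iff)
      finally show ?thesis .
    qed
  qed
qed

lemma dim_quot:
  assumes V: "fd_space V" and A: "is_subspace A V" "W \<subseteq> A"
  shows "vdim (quot\<lparr>carrier := cls ` A\<rparr>) + vdim (V\<lparr>carrier := W\<rparr>) = vdim (V\<lparr>carrier := A\<rparr>)"
proof -
  obtain ws \<omega>s where ws: "dual_basis V W ws \<omega>s" using fd_space_subspace(1)[OF V W] by blast
  obtain us \<eta>s where us: "dual_basis V A (ws @ us) (\<omega>s @ \<eta>s)"
    using dual_basis_extend[OF V W A ws] by blast
  show ?thesis
    using dual_basis_dim[OF W ws] dual_basis_dim[OF A(1) us]
      quot.dual_basis_dim[OF subspace_image[OF A(1)] dual_basis_quot[OF A ws us]] by simp
qed

lemma fd_space_quot: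
  assumes V: "fd_space V"
  shows "fd_space quot"
proof -
  have A: "is_subspace (carrier V) V" "W \<subseteq> carrier V"
    using subspace_carrier W by (auto simp: subspace_iff)
  obtain ws \<omega>s where ws: "dual_basis V W ws \<omega>s" using fd_space_subspace(1)[OF V W] by blast
  obtain us \<eta>s where us: "dual_basis V (carrier V) (ws @ us) (\<omega>s @ \<eta>s)"
    using dual_basis_extend[OF V W A ws] by blast
  from quot.dual_basis_fd_space[OF subspace_image[OF A(1)] dual_basis_quot[OF A ws us]]
  show ?thesis by (simp add: carrier_quot[symmetric])
qed

end

text \<open>The two linear substitutions come from \<open>pluecker_quot\<close> and \<open>pluecker_lift\<close>. They depend on a chosen dual
  basis of \<open>W i\<close>, which is extended to one of \<open>A i\<close> in order to see that they exchange the points of \<open>A\<close>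
  and of its quotient.\<close>

theorem grassmannian_quotient_iso:
  fixes V :: "'i \<Rightarrow> ('k::field, 'a) module"
  assumes V: "\<And>i. i \<in> I \<Longrightarrow> fd_space (V i)"
    and W: "\<And>i. i \<in> I \<Longrightarrow> is_subspace (W i) (V i)"
    and \<A>: "\<And>A i. A \<in> \<A> \<Longrightarrow> i \<in> I \<Longrightarrow> is_subspace (A i) (V i) \<and> W i \<subseteq> A i"
  shows "variety_iso (gr_point I V ` \<A>)
    ((\<lambda>A. gr_point I (\<lambda>i. quot_space (V i) (W i)) (\<lambda>i. (\<lambda>x. W i +>\<^bsub>V i\<^esub> x) ` A i)) ` \<A>)"
proof -
  let ?Q = "\<lambda>i. quot_space (V i) (W i)" and ?\<pi> = "\<lambda>i x. W i +>\<^bsub>V i\<^esub> x"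
  have qs: "quotient_space (V i) (W i)" if "i \<in> I" for i
    using fd_spaceD[OF V[OF that]] W[OF that]
    by (simp add: quotient_space_def quotient_space_axioms_def)
  obtain ws \<omega>s where ws: "\<And>i. i \<in> I \<Longrightarrow> dual_basis (V i) (W i) (ws i) (\<omega>s i)"
    using fd_space_subspace(1)[OF V W] by metis
  \<comment> \<open>\<open>D\<close> records the expansions of the coordinates of \<open>A i\<close>, and \<open>C\<close> those of the quotient\<close>
  define good where "good i \<xi>s L \<longleftrightarrow> (\<forall>us. set us \<subseteq> carrier (V i) \<and>
      (\<forall>j<length (ws i). \<forall>k<length us. (\<omega>s i ! j) (us ! k) = 0) \<longrightarrow>
      pluecker_coord (V i) (ws i @ us) \<xi>s = (\<Sum>(c, \<eta>s)\<leftarrow>L. c * pluecker_coord (?Q i) (map (?\<pi> i) us)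
        \<eta>s))"
    for i \<xi>s L
  have ex_good: "\<exists>L. good i \<xi>s L" if "i \<in> I" for i \<xi>s
    unfolding good_def by (rule quotient_space.pluecker_lift[OF qs[OF that] ws[OF that]])
  define D where "D i \<xi>s = (if i \<in> I then SOME L. good i \<xi>s L else [])" for i \<xi>s
  have good: "good i \<xi>s (D i \<xi>s)" if "i \<in> I" for i \<xi>s
    using someI_ex[OF ex_good[OF that]] that by (simp add: D_def)
  define C :: "'i \<Rightarrow> ('a set \<Rightarrow> 'k) list \<Rightarrow> ('k \<times> ('a \<Rightarrow> 'k) list) list" where
    "C i \<eta>s = (if i \<in> I \<and> (\<forall>\<eta>\<in>set \<eta>s. linear_form (?Q i) \<eta>)
      then [(1, \<omega>s i @ map (\<lambda>\<eta> x. \<eta> (?\<pi> i x)) \<eta>s)] else [])" for i \<eta>s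
  let ?P = "\<lambda>A. gr_point I V A" and ?R = "\<lambda>A. gr_point I ?Q (\<lambda>i. ?\<pi> i ` A i)"
  have *: "coord_subst C ` ?P A = ?R A \<and> coord_subst D ` ?R A = ?P A" if A: "A \<in> \<A>" for A
  proof -
    have subs: "is_subspace (A i) (V i)" "W i \<subseteq> A i" if "i \<in> I" for i
      using \<A>[OF A that] by auto
    obtain us \<eta>s where us: "\<And>i. i \<in> I \<Longrightarrow> dual_basis (V i) (A i) (ws i @ us i) (\<omega>s i @ \<eta>s i)"
      using dual_basis_extend[OF V W subs ws] by metis
    let ?z = "\<lambda>c i \<xi>s. if i \<in> I then c i * pluecker_coord (V i) (ws i @ us i) \<xi>s else 0"
    let ?y = "\<lambda>c i \<xi>s. if i \<in> I then c i * pluecker_coord (?Q i) (map (?\<pi> i) (us i)) \<xi>s else 0"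
    have P: "?P A = ?z ` {c. \<forall>i\<in>I. c i \<noteq> 0}"
      unfolding setcompr_eq_image[symmetric] by (rule gr_point_eq[OF V subs(1) us])
    have R: "?R A = ?y ` {c. \<forall>i\<in>I. c i \<noteq> 0}"
      unfolding setcompr_eq_image[symmetric]
      by (rule gr_point_eq[OF quotient_space.fd_space_quot[OF qs V] quotient_space.subspace_image[OF qs subs(1)]
          quotient_space.dual_basis_quot[OF qs subs ws us]])
    have zero: "(\<omega>s i ! j) (us i ! k) = 0" if "i \<in> I" "j < length (ws i)" "k < length (us i)"
      for i j k
      using quotient_space.dual_basis_append(1)[OF qs us] ws that by (auto simp: dual_basis_def)
    have us_V: "set (us i) \<subseteq> carrier (V i)" if "i \<in> I" for i
      using us[OF that] subs[OF that] by (auto simp: dual_basis_def VectorSpace.subspace_def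
        submodule_def)
    have C: "coord_subst C (?z c) = ?y c" for c
    proof (intro ext)
      fix i \<eta>s
      show "coord_subst C (?z c) i \<eta>s = ?y c i \<eta>s"
      proof (cases "i \<in> I \<and> (\<forall>\<eta>\<in>set \<eta>s. linear_form (?Q i) \<eta>)")
        case True
        then have "pluecker_coord (?Q i) (map (?\<pi> i) (us i)) \<eta>s
          = pluecker_coord (V i) (ws i @ us i) (\<omega>s i @ map (\<lambda>\<eta> x. \<eta> (?\<pi> i x)) \<eta>s)"
          by (intro quotient_space.pluecker_quot[OF qs ws] zero) auto
        then show ?thesis using True by (simp add: coord_subst_def C_def)
      next
        case False
        then show ?thesis by (auto simp: coord_subst_def C_def pluecker_coord_def)
      qed
    qed
    have D: "coord_subst D (?y c) = ?z c" for c
    proof (intro ext)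
      fix i \<xi>s
      show "coord_subst D (?y c) i \<xi>s = ?z c i \<xi>s"
      proof (cases "i \<in> I")
        case True
        have "pluecker_coord (V i) (ws i @ us i) \<xi>s
            = (\<Sum>(c, \<eta>s)\<leftarrow>D i \<xi>s. c * pluecker_coord (?Q i) (map (?\<pi> i) (us i)) \<eta>s)"
          using good[OF True, of \<xi>s] us_V[OF True] zero[OF True] unfolding good_def by blast
        then show ?thesis using True
          by (simp add: coord_subst_def sum_list_const_mult[symmetric] case_prod_unfold
            mult.left_commute)
      next
        case False
        then show ?thesis by (simp add: coord_subst_def D_def)
      qed
    qed
    show ?thesis by (simp only: P R image_image C D)
  qed
  show ?thesis
  proof (rule variety_iso_coord_subst[of _ C _ D])
    fix x assume "x \<in> ?P ` \<A>"
    then obtain A where A: "A \<in> \<A>" "x = ?P A" by (rule imageE) simp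
    show "coord_subst C ` x \<in> ?R ` \<A>" unfolding A(2) using *[OF A(1)] A(1) by simp
    show "coord_subst D ` coord_subst C ` x = x" unfolding A(2) using *[OF A(1)] by simp
  next
    fix y assume "y \<in> ?R ` \<A>"
    then obtain A where A: "A \<in> \<A>" "y = ?R A" by (rule imageE) simp
    show "coord_subst D ` y \<in> ?P ` \<A>" unfolding A(2) using *[OF A(1)] A(1) by simp
    show "coord_subst C ` coord_subst D ` y = y" unfolding A(2) using *[OF A(1)] by simp
  qed
qed


section \<open>Linear maps\<close>

lemma module_homI:
  assumes "\<And>x. x \<in> carrier A \<Longrightarrow> f x \<in> carrier B"
    and "\<And>x y. x \<in> carrier A \<Longrightarrow> y \<in> carrier A \<Longrightarrow> f (x \<oplus>\<^bsub>A\<^esub> y) = f x \<oplus>\<^bsub>B\<^esub> f y"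
    and "\<And>c x. x \<in> carrier A \<Longrightarrow> f (c \<odot>\<^bsub>A\<^esub> x) = c \<odot>\<^bsub>B\<^esub> f x"
  shows "f \<in> module_hom class_ring A B"
  using assms by (auto simp: module_hom_def)

lemma module_homD:
  assumes "f \<in> module_hom class_ring A B"
  shows "x \<in> carrier A \<Longrightarrow> f x \<in> carrier B"
    and "x \<in> carrier A \<Longrightarrow> y \<in> carrier A \<Longrightarrow> f (x \<oplus>\<^bsub>A\<^esub> y) = f x \<oplus>\<^bsub>B\<^esub> f y"
    and "x \<in> carrier A \<Longrightarrow> f (c \<odot>\<^bsub>A\<^esub> x) = c \<odot>\<^bsub>B\<^esub> f x"
  using assms by (auto simp: module_hom_def)

lemma module_hom_zero:
  fixes A :: "('k::field, 'a) module"
  assumes "kspace A" "kspace B" "f \<in> module_hom class_ring A B"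
  shows "f \<zero>\<^bsub>A\<^esub> = \<zero>\<^bsub>B\<^esub>"
proof -
  interpret A: kspace A by fact
  interpret B: kspace B by fact
  have "f (0 \<odot>\<^bsub>A\<^esub> \<zero>\<^bsub>A\<^esub>) = 0 \<odot>\<^bsub>B\<^esub> f \<zero>\<^bsub>A\<^esub>"
    by (rule module_homD(3)[OF assms(3)]) simp
  then show ?thesis using module_homD(1)[OF assms(3)] by simp
qed

lemma module_hom_finsum:
  fixes A :: "('k::field, 'a) module"
  assumes "kspace A" "kspace B" "f \<in> module_hom class_ring A B" "g \<in> S \<rightarrow> carrier A"
  shows "f (\<Oplus>\<^bsub>A\<^esub>i\<in>S. g i) = (\<Oplus>\<^bsub>B\<^esub>i\<in>S. f (g i))"
proof -
  interpret A: kspace A by fact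
  interpret B: kspace B by fact
  show ?thesis
    using assms(4)
  proof (induction S rule: infinite_finite_induct)
    case (insert x S)
    have "f (finsum A g (insert x S)) = f (g x \<oplus>\<^bsub>A\<^esub> finsum A g S)"
      using insert by (subst A.finsum_insert) auto
    also have "\<dots> = f (g x) \<oplus>\<^bsub>B\<^esub> f (finsum A g S)"
      using insert by (intro module_homD(2)[OF assms(3)]) auto
    also have "\<dots> = (\<Oplus>\<^bsub>B\<^esub>i\<in>insert x S. f (g i))"
      using insert module_homD(1)[OF assms(3)] by (subst B.finsum_insert) auto
    finally show ?case .
  qed (auto simp: module_hom_zero[OF assms(1-3)])
qed

lemma linear_form_compose:
  assumes "f \<in> module_hom class_ring A B" "linear_form B \<xi>"
  shows "linear_form A (\<lambda>x. \<xi> (f x))"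
  using assms by (auto simp: linear_form_def module_hom_def Pi_iff)

lemma image_subspace:
  fixes A :: "('k::field, 'a) module"
  assumes A: "kspace A" and B: "kspace B" and f: "f \<in> module_hom class_ring A B"
  shows "is_subspace (f ` carrier A) B"
proof -
  interpret A: kspace A by (rule A)
  interpret B: kspace B by (rule B)
  note f' = module_homD[OF f]
  show ?thesis
    unfolding B.subspace_iff
  proof (intro conjI ballI allI)
    show "f ` carrier A \<subseteq> carrier B" using f'(1) by auto
    show "\<zero>\<^bsub>B\<^esub> \<in> f ` carrier A" using module_hom_zero[OF A B f] by (metis A.zero_closed imageI)
    show "x \<oplus>\<^bsub>B\<^esub> y \<in> f ` carrier A" if "x \<in> f ` carrier A" "y \<in> f ` carrier A" for x y
      using that f'(2)[symmetric] by auto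
    show "c \<odot>\<^bsub>B\<^esub> x \<in> f ` carrier A" if "x \<in> f ` carrier A" for c x
      using that f'(3)[symmetric] by auto
  qed
qed

lemma module_hom_bij_dim:
  fixes A :: "('k::field, 'a) module"
  assumes A: "fd_space A" and B: "kspace B" and f: "f \<in> module_hom class_ring A B"
    and bij: "bij_betw f (carrier A) (carrier B)"
  shows "vdim A = vdim B"
proof -
  interpret A: kspace A using fd_spaceD[OF A] .
  interpret B: kspace B by (rule B)
  interpret linear_map class_ring A B f
    by unfold_locales (rule f)
  show ?thesis
    using dim_eq A bij by (auto simp: fd_space_def bij_betw_def)
qed

lemma (in kspace) subspace_trans:
  assumes "is_subspace W V" "is_subspace Z (V\<lparr>carrier := W\<rparr>)"
  shows "is_subspace Z V"
  using assms kspace.subspace_iff[OF kspace_subspace[OF assms(1)], of Z]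
  by (auto simp: subspace_iff)

lemma (in kspace) subspace_within:
  assumes "is_subspace W V" "is_subspace Z V" "Z \<subseteq> W"
  shows "is_subspace Z (V\<lparr>carrier := W\<rparr>)"
  using assms kspace.subspace_iff[OF kspace_subspace[OF assms(1)], of Z]
  by (auto simp: subspace_iff)

lemma dim_zero_subspace:
  fixes V :: "('k::field, 'a) module"
  assumes V: "fd_space V" and W: "is_subspace W V" and "vdim (V\<lparr>carrier := W\<rparr>) = 0"
  shows "W = {\<zero>\<^bsub>V\<^esub>}"
proof -
  interpret kspace V using fd_spaceD[OF V] .
  obtain us \<omega>s where db: "dual_basis V W us \<omega>s" using fd_space_subspace(1)[OF V W] by blast
  then have "us = []" using dual_basis_dim[OF W] assms(3) by simp
  then have "\<forall>x\<in>W. x = \<zero>\<^bsub>V\<^esub>" using db by (simp add: dual_basis_def)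
  then show ?thesis using W by (auto simp: subspace_iff)
qed

lemma gr_point_cong:
  "(\<And>i. i \<in> I \<Longrightarrow> W i = W' i) \<Longrightarrow> gr_point I V W = gr_point I V W'"
  by (simp add: gr_point_def)

text \<open>The union is the form in which the quotient functor applies a linear map to a coset.\<close>

lemma coset_image_union:
  fixes A :: "('k::field, 'a) module" and B :: "('k, 'b) module"
  assumes A: "quotient_space A W" and B: "quotient_space B Z"
    and f: "f \<in> module_hom class_ring A B" and WZ: "f ` W \<subseteq> Z" and y: "y \<in> carrier A"
  shows "(\<Union>x\<in>W +>\<^bsub>A\<^esub> y. Z +>\<^bsub>B\<^esub> f x) = Z +>\<^bsub>B\<^esub> f y"
proof -
  interpret A: quotient_space A W by (rule A)
  interpret B: quotient_space B Z by (rule B)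
  note f' = module_homD[OF f]
  have "Z +>\<^bsub>B\<^esub> f x = Z +>\<^bsub>B\<^esub> f y" if "x \<in> W +>\<^bsub>A\<^esub> y" for x
  proof -
    from that have x: "x \<in> carrier A" "x \<oplus>\<^bsub>A\<^esub> (- 1) \<odot>\<^bsub>A\<^esub> y \<in> W"
      using A.in_cls_iff[OF y] A.cls_eq_iff[OF _ y] by auto
    have "f x \<oplus>\<^bsub>B\<^esub> (- 1) \<odot>\<^bsub>B\<^esub> f y = f (x \<oplus>\<^bsub>A\<^esub> (- 1) \<odot>\<^bsub>A\<^esub> y)"
      using x y f' by simp
    also have "\<dots> \<in> Z" using WZ x by auto
    finally show ?thesis using B.cls_eq_iff f' x y by simp
  qed
  then have "(\<Union>x\<in>W +>\<^bsub>A\<^esub> y. Z +>\<^bsub>B\<^esub> f x) = (\<Union>x\<in>W +>\<^bsub>A\<^esub> y. Z +>\<^bsub>B\<^esub> f y)" by (intro SUP_cong) auto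
  also have "\<dots> = Z +>\<^bsub>B\<^esub> f y" using A.cosets.a_rcos_self[OF y] by blast
  finally show ?thesis .
qed


section \<open>Paths in Dynkin quivers\<close>

text \<open>The vertices are numbered such that each vertex \<open>v > 0\<close> has at most one smaller neighbour \<open>p v\<close>: its
  predecessor on the chain or, for the vertex \<open>n - 1\<close> of types \<open>D\<close> and \<open>E\<close>, the vertex to which it is
  attached.\<close>

lemma dynkin_parent:
  assumes "simply_laced_dynkin n E"
  shows "\<exists>p. (\<forall>v>0. p v < v) \<and> E \<subseteq> {{p v, v} | v. 0 < v \<and> v < n}"
proof -
  have A: "dynkin_A m \<subseteq> {{v - 1, v} | v. 0 < v \<and> v < m}" for m
  proof
    fix e assume "e \<in> dynkin_A m"
    then obtain i where "e = {i, Suc i}" "Suc i < m" by (auto simp: dynkin_A_def)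
    then show "e \<in> {{v - 1, v} | v. 0 < v \<and> v < m}"
      by (intro CollectI exI[of _ "Suc i"]) auto
  qed
  have branch: "\<exists>p. (\<forall>v>0. p v < v) \<and> insert {b, n - 1} (dynkin_A (n - 1)) \<subseteq> {{p v, v} | v. 0 < v
    \<and> v < n}"
    if b: "b < n - 1" for b
  proof (intro exI conjI)
    let ?p = "\<lambda>v. if v = n - 1 then b else v - 1"
    show "\<forall>v>0. ?p v < v" using b by auto
    show "insert {b, n - 1} (dynkin_A (n - 1)) \<subseteq> {{?p v, v} | v. 0 < v \<and> v < n}"
    proof
      fix e assume "e \<in> insert {b, n - 1} (dynkin_A (n - 1))"
      then consider "e = {b, n - 1}" | v where "e = {v - 1, v}" "0 < v" "v < n - 1"
        using A[of "n - 1"] by blast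
      then show "e \<in> {{?p v, v} | v. 0 < v \<and> v < n}"
      proof cases
        case 1
        then show ?thesis using b by (intro CollectI exI[of _ "n - 1"]) auto
      next
        case 2
        then show ?thesis by (intro CollectI exI[of _ v]) auto
      qed
    qed
  qed
  from assms consider "E = dynkin_A n" | "4 \<le> n" "E = dynkin_D n" | "n \<in> {6, 7, 8}" "E = dynkin_E n"
    by (auto simp: simply_laced_dynkin_def)
  then show ?thesis
  proof cases
    case 1
    then show ?thesis using A[of n] by (intro exI[of _ "\<lambda>v. v - 1"]) auto
  next
    case 2
    then show ?thesis using branch[of "n - 3"] by (simp add: dynkin_D_def)
  next
    case 3
    then show ?thesis using branch[of 2] by (auto simp: dynkin_E_def)
  qed
qed

text \<open>On a tree with parent map \<open>p\<close>, the differences of a function along the edges can be prescribed.\<close>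

lemma tree_potential:
  fixes p :: "nat \<Rightarrow> nat" and s :: "nat \<Rightarrow> int"
  assumes "\<forall>v>0. p v < v"
  shows "\<exists>g. \<forall>v. 0 < v \<and> v < n \<longrightarrow> g v = g (p v) + s v"
proof (induction n)
  case (Suc n)
  then obtain g where g: "\<forall>v. 0 < v \<and> v < n \<longrightarrow> g v = g (p v) + s v" by blast
  have "p v \<noteq> n" if "0 < v" "v \<le> n" for v using assms that by (metis leD order_trans)
  with g have "\<forall>v. 0 < v \<and> v < Suc n \<longrightarrow>
      (g(n := g (p n) + s n)) v = (g(n := g (p n) + s n)) (p v) + s v"
    by (auto simp: less_Suc_eq)
  then show ?case by blast
qed simp

text \<open>The height changes by \<open>1\<close> between a vertex and its parent, the sign being given by the orientation of
  the edge. The orientation is well defined because an edge comes from exactly one arrow.\<close>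

lemma dynkin_height:
  fixes Q :: "('q, 'e) pre_digraph"
  assumes "dynkin_quiver Q"
  shows "\<exists>h :: 'q \<Rightarrow> int. \<forall>a\<in>arcs Q. h (head Q a) = h (tail Q a) + 1"
proof -
  obtain n E \<nu> where wf: "wf_digraph Q" and E: "simply_laced_dynkin n E"
    and \<nu>: "bij_betw \<nu> (verts Q) {..<n}"
    and arcs: "bij_betw (\<lambda>a. {\<nu> (tail Q a), \<nu> (head Q a)}) (arcs Q) E"
    using assms by (auto simp: dynkin_quiver_def)
  obtain p where p: "\<forall>v>0. p v < v" "E \<subseteq> {{p v, v} | v. 0 < v \<and> v < n}"
    using dynkin_parent[OF E] by blast
  define s where "s v = (if \<exists>a\<in>arcs Q. \<nu> (tail Q a) = p v \<and> \<nu> (head Q a)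
    = v then 1 else - 1 :: int)" for v
  obtain g where g: "\<forall>v. 0 < v \<and> v < n \<longrightarrow> g v = g (p v) + s v"
    using tree_potential[OF p(1)] by blast
  have "g (\<nu> (head Q a)) = g (\<nu> (tail Q a)) + 1" if a: "a \<in> arcs Q" for a
  proof -
    have "{\<nu> (tail Q a), \<nu> (head Q a)} \<in> E" using arcs a by (auto simp: bij_betw_def)
    then obtain v where v: "{\<nu> (tail Q a), \<nu> (head Q a)} = {p v, v}" "0 < v" "v < n"
      using p(2) by blast
    have neq: "p v \<noteq> v" using p(1) v(2) by (metis less_irrefl)
    from v(1) consider "\<nu> (tail Q a) = p v" "\<nu> (head Q a) = v" | "\<nu> (tail Q a) = v" "\<nu> (head Q a)
      = p v"
      by (auto simp: doubleton_eq_iff)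
    then show ?thesis
    proof cases
      case 1
      then have "s v = 1" using a by (auto simp: s_def)
      then show ?thesis using g v 1 by simp
    next
      case 2
      have "\<not> (\<exists>b\<in>arcs Q. \<nu> (tail Q b) = p v \<and> \<nu> (head Q b) = v)"
      proof
        assume "\<exists>b\<in>arcs Q. \<nu> (tail Q b) = p v \<and> \<nu> (head Q b) = v"
        then obtain b where b: "b \<in> arcs Q" "\<nu> (tail Q b) = p v" "\<nu> (head Q b) = v" by blast
        then have "{\<nu> (tail Q a), \<nu> (head Q a)} = {\<nu> (tail Q b), \<nu> (head Q b)}" using 2 by auto
        then have "a = b" using arcs a b(1) by (auto simp: bij_betw_def dest: inj_onD)
        then show False using b 2 neq by simp
      qed
      then have "s v = - 1" by (simp add: s_def)
      then show ?thesis using g v 2 by simp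
    qed
  qed
  then show ?thesis by (intro exI[of _ "\<lambda>i. g (\<nu> i)"]) simp
qed

locale path_finite = wf_digraph Q for Q :: "('q, 'e) pre_digraph" +
  assumes finite_verts: "finite (verts Q)"
    and finite_walks: "finite {p. \<exists>i j. awalk i p j}"

text \<open>The length of a path is the difference of the heights of its ends, and is therefore bounded.\<close>

lemma dynkin_path_finite:
  assumes "dynkin_quiver Q"
  shows "path_finite Q"
proof -
  obtain n E \<nu> where wf: "wf_digraph Q" and E: "simply_laced_dynkin n E"
    and \<nu>: "bij_betw \<nu> (verts Q) {..<n}"
    and arcs: "bij_betw (\<lambda>a. {\<nu> (tail Q a), \<nu> (head Q a)}) (arcs Q) E"
    using assms by (auto simp: dynkin_quiver_def)
  interpret wf_digraph Q by (rule wf)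
  have fv: "finite (verts Q)" using bij_betw_finite[OF \<nu>] by simp
  obtain p where "E \<subseteq> {{p v, v} | v. 0 < v \<and> v < n}"
    using dynkin_parent[OF E] by blast
  moreover have "finite ((\<lambda>v. {p v, v}) ` {..<n})" by simp
  ultimately have "finite E" by (rule_tac finite_subset) auto
  then have fa: "finite (arcs Q)" using bij_betw_finite[OF arcs] by simp
  obtain h :: "'a \<Rightarrow> int" where h: "\<forall>a\<in>arcs Q. h (head Q a) = h (tail Q a) + 1"
    using dynkin_height[OF assms] by blast
  have len: "h j = h i + int (length p)" if "awalk i p j" for i p j
    using that
  proof (induction p arbitrary: i)
    case (Cons a p)
    then show ?case using h by (auto simp: awalk_Cons_iff)
  qed (simp add: awalk_Nil_iff)
  \<comment> \<open>twice the sum of the absolute values of the heights bounds every difference of heights\<close>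
  define K where "K = nat (2 * (\<Sum>i\<in>verts Q. \<bar>h i\<bar>))"
  have "{p. \<exists>i j. awalk i p j} \<subseteq> {p. set p \<subseteq> arcs Q \<and> length p \<le> K}"
  proof clarify
    fix p i j assume w: "awalk i p j"
    then have "i \<in> verts Q" "j \<in> verts Q" by auto
    then have "\<bar>h i\<bar> \<le> (\<Sum>i\<in>verts Q. \<bar>h i\<bar>)" "\<bar>h j\<bar> \<le> (\<Sum>i\<in>verts Q. \<bar>h i\<bar>)"
      using fv by (auto intro: member_le_sum)
    then have "length p \<le> K" using len[OF w] by (simp add: K_def)
    moreover have "set p \<subseteq> arcs Q" using w by auto
    ultimately show "set p \<subseteq> arcs Q \<and> length p \<le> K" by simp
  qed
  then have "finite {p. \<exists>i j. awalk i p j}" using finite_lists_length_le[OF fa] finite_subset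
    by blast
  then show ?thesis using wf fv by (simp add: path_finite_def path_finite_axioms_def)
qed


section \<open>Morphisms of representations\<close>

lemma fd_repD:
  assumes "fd_rep Q V"
  shows "i \<in> verts Q \<Longrightarrow> fd_space (rsp V i)"
    and "i \<in> verts Q \<Longrightarrow> kspace (rsp V i)"
    and "a \<in> arcs Q \<Longrightarrow> rmap V a \<in> module_hom class_ring (rsp V (tail Q a)) (rsp V (head Q a))"
  using assms fd_spaceD by (auto simp: fd_rep_def)

lemma rep_homD:
  assumes "f \<in> rep_hom Q V W"
  shows "i \<in> verts Q \<Longrightarrow> f i \<in> module_hom class_ring (rsp V i) (rsp W i)"
    and "i \<in> verts Q \<Longrightarrow> x \<in> carrier (rsp V i) \<Longrightarrow> f i x \<in> carrier (rsp W i)"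
    and "a \<in> arcs Q \<Longrightarrow> x \<in> carrier (rsp V (tail Q a)) \<Longrightarrow>
        f (head Q a) (rmap V a x) = rmap W a (f (tail Q a) x)"
  using assms by (auto simp: rep_hom_def module_hom_def)

lemma rep_homI:
  assumes "\<And>i. i \<in> verts Q \<Longrightarrow> g i \<in> module_hom class_ring (rsp V i) (rsp W i)"
    and "\<And>a x. a \<in> arcs Q \<Longrightarrow> x \<in> carrier (rsp V (tail Q a)) \<Longrightarrow>
        g (head Q a) (rmap V a x) = rmap W a (g (tail Q a) x)"
    and V: "fd_rep Q V" and wf: "wf_digraph Q"
    and f: "f = (\<lambda>i\<in>verts Q. \<lambda>x\<in>carrier (rsp V i). g i x)"
  shows "f \<in> rep_hom Q V W"
proof -
  have g: "f i x = g i x" if "i \<in> verts Q" "x \<in> carrier (rsp V i)" for i x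
    using that f by simp
  have "f i \<in> module_hom class_ring (rsp V i) (rsp W i)" if i: "i \<in> verts Q" for i
  proof -
    interpret kspace "rsp V i" using fd_repD[OF V] i by blast
    show ?thesis
      using module_homD[OF assms(1)[OF i]] by (intro module_homI) (auto simp: g[OF i])
  qed
  moreover have "f (head Q a) (rmap V a x) = rmap W a (f (tail Q a) x)"
    if "a \<in> arcs Q" "x \<in> carrier (rsp V (tail Q a))" for a x
  proof -
    have "tail Q a \<in> verts Q" "head Q a \<in> verts Q"
      using wf that(1) by (auto simp: wf_digraph_def)
    moreover have "rmap V a x \<in> carrier (rsp V (head Q a))"
      using module_homD(1)[OF fd_repD(3)[OF V]] that by blast
    ultimately show ?thesis using that assms(2) g by simp
  qed
  moreover have "f \<in> (\<Pi>\<^sub>E i\<in>verts Q. carrier (rsp V i) \<rightarrow>\<^sub>E carrier (rsp W i))"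
    using module_homD(1)[OF assms(1)] f by (auto simp: PiE_iff)
  ultimately show ?thesis by (simp add: rep_hom_def)
qed

lemma rep_hom_ext:
  assumes "f \<in> rep_hom Q V W" "g \<in> rep_hom Q V W'"
    and "\<And>i x. i \<in> verts Q \<Longrightarrow> x \<in> carrier (rsp V i) \<Longrightarrow> f i x = g i x"
  shows "f = g"
proof (rule extensionalityI)
  show "f \<in> extensional (verts Q)" "g \<in> extensional (verts Q)"
    using assms by (auto simp: rep_hom_def PiE_iff)
  fix i assume i: "i \<in> verts Q"
  then have "f i \<in> extensional (carrier (rsp V i))" "g i \<in> extensional (carrier (rsp V i))"
    using assms by (auto simp: rep_hom_def PiE_iff)
  then show "f i = g i" using assms(3)[OF i] by (rule extensionalityI)
qed

lemma rep_comp_apply: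
  "i \<in> verts Q \<Longrightarrow> x \<in> carrier (rsp V i) \<Longrightarrow> rep_comp Q V g f i x = g i (f i x)"
  by (simp add: rep_comp_def compose_def)

lemma rep_comp_hom:
  assumes "wf_digraph Q" "fd_rep Q A" "f \<in> rep_hom Q A B" "g \<in> rep_hom Q B C"
  shows "rep_comp Q A g f \<in> rep_hom Q A C"
proof (rule rep_homI[OF _ _ assms(2,1)])
  show "rep_comp Q A g f = (\<lambda>i\<in>verts Q. \<lambda>x\<in>carrier (rsp A i). g i (f i x))"
    by (simp add: rep_comp_def compose_def)
  show "(\<lambda>x. g i (f i x)) \<in> module_hom class_ring (rsp A i) (rsp C i)" if "i \<in> verts Q" for i
    using module_homD[OF rep_homD(1)[OF assms(3) that]]
      module_homD[OF rep_homD(1)[OF assms(4) that]]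
    by (intro module_homI) auto
  show "g (head Q a) (f (head Q a) (rmap A a x)) = rmap C a (g (tail Q a) (f (tail Q a) x))"
    if "a \<in> arcs Q" "x \<in> carrier (rsp A (tail Q a))" for a x
  proof -
    have "tail Q a \<in> verts Q" using assms(1) that(1) by (simp add: wf_digraph_def)
    then show ?thesis
      using that rep_homD(3)[OF assms(3) that] rep_homD(3)[OF assms(4) that(1)]
        rep_homD(2)[OF assms(3)]
      by simp
  qed
qed

lemma rep_comp_assoc:
  assumes "f \<in> rep_hom Q A B"
  shows "rep_comp Q A (rep_comp Q B h g) f = rep_comp Q A h (rep_comp Q A g f)"
proof (rule ext)
  fix i
  show "rep_comp Q A (rep_comp Q B h g) f i = rep_comp Q A h (rep_comp Q A g f) i"
    using rep_homD(2)[OF assms] by (cases "i \<in> verts Q") (auto simp: rep_comp_def compose_def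
      restrict_def fun_eq_iff)
qed

lemma rep_id_hom:
  assumes "wf_digraph Q" "fd_rep Q V"
  shows "rep_id Q V \<in> rep_hom Q V V"
  by (rule rep_homI[OF _ _ assms(2,1), where g = "\<lambda>i x. x"])
    (auto simp: rep_id_def intro: module_homI)

lemma rep_comp_id:
  assumes "h \<in> rep_hom Q V W"
  shows "rep_comp Q V h (rep_id Q V) = h"
proof -
  have h: "h i \<in> extensional (carrier (rsp V i))" if "i \<in> verts Q" for i
    using assms that by (auto simp: rep_hom_def PiE_iff)
  have "h \<in> extensional (verts Q)" using assms by (simp add: rep_hom_def PiE_iff)
  then show ?thesis
    using h by (intro extensionalityI[of _ "verts Q"])
      (auto simp: rep_comp_def rep_id_def compose_def restrict_def fun_eq_iff extensional_def)
qed

lemma hom_space_simps [simp]: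
  "carrier (hom_space Q V W) = rep_hom Q V W"
  "\<zero>\<^bsub>hom_space Q V W\<^esub> = (\<lambda>i\<in>verts Q. \<lambda>x\<in>carrier (rsp V i). \<zero>\<^bsub>rsp W i\<^esub>)"
  "f \<oplus>\<^bsub>hom_space Q V W\<^esub> g = (\<lambda>i\<in>verts Q. \<lambda>x\<in>carrier (rsp V i). f i x \<oplus>\<^bsub>rsp W i\<^esub> g i x)"
  "c \<odot>\<^bsub>hom_space Q V W\<^esub> f = (\<lambda>i\<in>verts Q. \<lambda>x\<in>carrier (rsp V i). c \<odot>\<^bsub>rsp W i\<^esub> f i x)"
  by (simp_all add: hom_space_def)

lemma hom_space_closed:
  fixes W :: "('q, 'e, 'k::field, 'b) quiver_rep"
  assumes wf: "wf_digraph Q" and V: "fd_rep Q V" and W: "fd_rep Q W"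
  shows "\<zero>\<^bsub>hom_space Q V W\<^esub> \<in> rep_hom Q V W"
    and "f \<in> rep_hom Q V W \<Longrightarrow> g \<in> rep_hom Q V W \<Longrightarrow> f \<oplus>\<^bsub>hom_space Q V W\<^esub> g \<in> rep_hom Q V W"
    and "f \<in> rep_hom Q V W \<Longrightarrow> c \<odot>\<^bsub>hom_space Q V W\<^esub> f \<in> rep_hom Q V W"
proof -
  have tv: "tail Q a \<in> verts Q" "head Q a \<in> verts Q" if "a \<in> arcs Q" for a
    using wf that by (auto simp: wf_digraph_def)
  note rm = module_homD[OF fd_repD(3)[OF W]]
  show "\<zero>\<^bsub>hom_space Q V W\<^esub> \<in> rep_hom Q V W"
  proof (rule rep_homI[OF _ _ V wf])
    fix i assume i: "i \<in> verts Q"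
    interpret kspace "rsp W i" using fd_repD[OF W] i by blast
    show "(\<lambda>x. \<zero>\<^bsub>rsp W i\<^esub>) \<in> module_hom class_ring (rsp V i) (rsp W i)"
      by (rule module_homI) auto
  next
    fix a x assume a: "a \<in> arcs Q"
    show "\<zero>\<^bsub>rsp W (head Q a)\<^esub> = rmap W a \<zero>\<^bsub>rsp W (tail Q a)\<^esub>"
      using module_hom_zero[OF fd_repD(2)[OF W] fd_repD(2)[OF W] fd_repD(3)[OF W a]] tv[OF a]
      by simp
  qed simp
  show "f \<oplus>\<^bsub>hom_space Q V W\<^esub> g \<in> rep_hom Q V W" if f: "f \<in> rep_hom Q V W" and g: "g \<in> rep_hom Q V W"
  proof (rule rep_homI[OF _ _ V wf])
    fix i assume i: "i \<in> verts Q"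
    interpret kspace "rsp W i" using fd_repD[OF W] i by blast
    show "(\<lambda>x. f i x \<oplus>\<^bsub>rsp W i\<^esub> g i x) \<in> module_hom class_ring (rsp V i) (rsp W i)"
      using module_homD[OF rep_homD(1)[OF f i]] module_homD[OF rep_homD(1)[OF g i]]
      by (intro module_homI) (auto simp: scale_add_right a_assoc a_comm a_lcomm)
  next
    fix a x assume a: "a \<in> arcs Q" and x: "x \<in> carrier (rsp V (tail Q a))"
    show "f (head Q a) (rmap V a x) \<oplus>\<^bsub>rsp W (head Q a)\<^esub> g (head Q a) (rmap V a x)
        = rmap W a (f (tail Q a) x \<oplus>\<^bsub>rsp W (tail Q a)\<^esub> g (tail Q a) x)"
      using rep_homD(3)[OF f a x] rep_homD(3)[OF g a x] rm(2)[OF a] rep_homD(2)[OF f tv(1)[OF a] x]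
        rep_homD(2)[OF g tv(1)[OF a] x] by simp
  qed simp
  show "c \<odot>\<^bsub>hom_space Q V W\<^esub> f \<in> rep_hom Q V W" if f: "f \<in> rep_hom Q V W"
  proof (rule rep_homI[OF _ _ V wf])
    fix i assume i: "i \<in> verts Q"
    interpret kspace "rsp W i" using fd_repD[OF W] i by blast
    show "(\<lambda>x. c \<odot>\<^bsub>rsp W i\<^esub> f i x) \<in> module_hom class_ring (rsp V i) (rsp W i)"
      using module_homD[OF rep_homD(1)[OF f i]]
      by (intro module_homI) (auto simp: scale_add_right scale_scale mult.commute)
  next
    fix a x assume a: "a \<in> arcs Q" and x: "x \<in> carrier (rsp V (tail Q a))"
    show "c \<odot>\<^bsub>rsp W (head Q a)\<^esub> f (head Q a) (rmap V a x)
        = rmap W a (c \<odot>\<^bsub>rsp W (tail Q a)\<^esub> f (tail Q a) x)"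
      using rep_homD(3)[OF f a x] rm(3)[OF a] rep_homD(2)[OF f tv(1)[OF a] x] by simp
  qed simp
qed

lemma rep_hom_restrict:
  assumes "f \<in> rep_hom Q V W"
  shows "(\<lambda>i\<in>verts Q. \<lambda>x\<in>carrier (rsp V i). f i x) = f"
proof -
  have "f i \<in> extensional (carrier (rsp V i))" if "i \<in> verts Q" for i
    using assms that by (auto simp: rep_hom_def PiE_iff)
  moreover have "f \<in> extensional (verts Q)" using assms by (simp add: rep_hom_def PiE_iff)
  ultimately show ?thesis
    by (intro extensionalityI[of _ "verts Q"]) (auto simp: extensional_restrict)
qed

lemma hom_space_kspace:
  fixes W :: "('q, 'e, 'k::field, 'b) quiver_rep"
  assumes wf: "wf_digraph Q" and V: "fd_rep Q V" and W: "fd_rep Q W"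
  shows "kspace (hom_space Q V W)"
  unfolding kspace_def
proof (rule vs_criteria)
  let ?H = "hom_space Q V W"
  show "field (class_ring :: 'k ring)" by (rule class_field)
  note closed = hom_space_closed[OF wf V W]
  have eqI: "f = g" if "f \<in> rep_hom Q V W" "g \<in> rep_hom Q V W"
    "\<And>i x. i \<in> verts Q \<Longrightarrow> x \<in> carrier (rsp V i) \<Longrightarrow> kspace (rsp W i) \<Longrightarrow> f i x = g i x" for f g
    using rep_hom_ext[OF that(1,2)] that(3) fd_repD(2)[OF W] by blast
  note K = kspace.vadd_comm kspace.vadd_assoc kspace.vadd_zero kspace.scale_scale kspace.scale_one
    kspace.scale_add_left kspace.scale_add_right
  have app: "\<zero>\<^bsub>?H\<^esub> i x = \<zero>\<^bsub>rsp W i\<^esub>" "(f \<oplus>\<^bsub>?H\<^esub> g) i x = f i x \<oplus>\<^bsub>rsp W i\<^esub> g i x"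
    "(c \<odot>\<^bsub>?H\<^esub> f) i x = c \<odot>\<^bsub>rsp W i\<^esub> f i x" if "i \<in> verts Q" "x \<in> carrier (rsp V i)" for f g c i x
    using that by simp_all
  have c: "carrier ?H = rep_hom Q V W" by simp
  note [simp del] = hom_space_simps
  show "\<zero>\<^bsub>?H\<^esub> \<in> carrier ?H" "\<forall>v w. v \<in> carrier ?H \<and> w \<in> carrier ?H \<longrightarrow> v \<oplus>\<^bsub>?H\<^esub> w \<in> carrier ?H"
    "\<forall>c v. c \<in> carrier class_ring \<and> v \<in> carrier ?H \<longrightarrow> c \<odot>\<^bsub>?H\<^esub> v \<in> carrier ?H"
    using closed by (auto simp: c)
  show "\<forall>v\<in>carrier ?H. \<exists>w\<in>carrier ?H. v \<oplus>\<^bsub>?H\<^esub> w = \<zero>\<^bsub>?H\<^esub>"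
  proof
    fix v assume v: "v \<in> carrier ?H"
    show "\<exists>w\<in>carrier ?H. v \<oplus>\<^bsub>?H\<^esub> w = \<zero>\<^bsub>?H\<^esub>"
      using v closed by (intro bexI[of _ "(- 1) \<odot>\<^bsub>?H\<^esub> v"] eqI) (auto simp: c app kspace.add_scale_neg
        rep_homD(2))
  qed
  show "\<forall>v w. v \<in> carrier ?H \<and> w \<in> carrier ?H \<longrightarrow> v \<oplus>\<^bsub>?H\<^esub> w = w \<oplus>\<^bsub>?H\<^esub> v"
    using closed by (auto intro!: eqI simp: c app rep_homD(2) K(1))
  show "\<forall>v w x. v \<in> carrier ?H \<and> w \<in> carrier ?H \<and> x \<in> carrier ?H \<longrightarrow> (v \<oplus>\<^bsub>?H\<^esub> w) \<oplus>\<^bsub>?H\<^esub> x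
    = v \<oplus>\<^bsub>?H\<^esub> (w \<oplus>\<^bsub>?H\<^esub> x)"
    using closed by (auto intro!: eqI simp: c app rep_homD(2) K(2))
  show "\<forall>v\<in>carrier ?H. v \<oplus>\<^bsub>?H\<^esub> \<zero>\<^bsub>?H\<^esub> = v"
    using closed by (auto intro!: eqI simp: c app rep_homD(2) K(3))
  show "\<forall>a b v. a \<in> carrier class_ring \<and> b \<in> carrier class_ring \<and> v \<in> carrier ?H \<longrightarrow>
      (a \<otimes>\<^bsub>class_ring\<^esub> b) \<odot>\<^bsub>?H\<^esub> v = a \<odot>\<^bsub>?H\<^esub> (b \<odot>\<^bsub>?H\<^esub> v)"
    using closed by (auto intro!: eqI simp: c app rep_homD(2) K(4))
  show "\<forall>v\<in>carrier ?H. \<one>\<^bsub>class_ring\<^esub> \<odot>\<^bsub>?H\<^esub> v = v"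
    using closed by (auto intro!: eqI simp: c app rep_homD(2) K(5))
  show "\<forall>a b v. a \<in> carrier class_ring \<and> b \<in> carrier class_ring \<and> v \<in> carrier ?H \<longrightarrow>
      (a \<oplus>\<^bsub>class_ring\<^esub> b) \<odot>\<^bsub>?H\<^esub> v = a \<odot>\<^bsub>?H\<^esub> v \<oplus>\<^bsub>?H\<^esub> b \<odot>\<^bsub>?H\<^esub> v"
    using closed by (auto intro!: eqI simp: c app rep_homD(2) K(6))
  show "\<forall>a v w. a \<in> carrier class_ring \<and> v \<in> carrier ?H \<and> w \<in> carrier ?H \<longrightarrow>
      a \<odot>\<^bsub>?H\<^esub> (v \<oplus>\<^bsub>?H\<^esub> w) = a \<odot>\<^bsub>?H\<^esub> v \<oplus>\<^bsub>?H\<^esub> a \<odot>\<^bsub>?H\<^esub> w"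
    using closed by (auto intro!: eqI simp: c app rep_homD(2) K(7))
qed

lemma eval_hom:
  "i \<in> verts Q \<Longrightarrow> x \<in> carrier (rsp V i) \<Longrightarrow> (\<lambda>h. h i x) \<in> module_hom class_ring (hom_space Q V W)
    (rsp W i)"
  by (intro module_homI) (auto simp: rep_homD(2))

text \<open>A morphism is determined by its values at bases of the spaces of \<open>V\<close>, and such a value by its
  coordinates in a space of \<open>W\<close>.\<close>

lemma hom_space_fd:
  fixes W :: "('q, 'e, 'k::field, 'b) quiver_rep"
  assumes wf: "wf_digraph Q" and fin: "finite (verts Q)" and V: "fd_rep Q V" and W: "fd_rep Q W"
  shows "fd_space (hom_space Q V W)"
proof -
  have "\<forall>i\<in>verts Q. \<exists>us \<omega>s. dual_basis (rsp V i) (carrier (rsp V i)) us \<omega>s"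
    using fd_space_dual_basis fd_repD(1)[OF V] by blast
  then obtain us \<omega>s where us: "\<And>i. i \<in> verts Q \<Longrightarrow> dual_basis (rsp V i) (carrier (rsp V i)) (us i)
    (\<omega>s i)"
    by metis
  have "\<forall>i\<in>verts Q. \<exists>ws \<theta>s. dual_basis (rsp W i) (carrier (rsp W i)) ws \<theta>s"
    using fd_space_dual_basis fd_repD(1)[OF W] by blast
  then obtain ws \<theta>s where ws: "\<And>i. i \<in> verts Q \<Longrightarrow> dual_basis (rsp W i) (carrier (rsp W i)) (ws i)
    (\<theta>s i)"
    by metis
  let ?F = "\<Union>i\<in>verts Q. (\<lambda>(u, \<theta>) h. \<theta> (h i u)) ` (set (us i) \<times> set (\<theta>s i))"
  show ?thesis
  proof (rule fd_spaceI[OF hom_space_kspace[OF wf V W], of ?F])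
    show "finite ?F" using fin by auto
    show "linear_form (hom_space Q V W) \<xi>" if \<xi>: "\<xi> \<in> ?F" for \<xi>
    proof -
      from \<xi> obtain i u \<theta> where i: "i \<in> verts Q" "u \<in> set (us i)" "\<theta> \<in> set (\<theta>s i)" "\<xi>
        = (\<lambda>h. \<theta> (h i u))"
        by auto
      then have "u \<in> carrier (rsp V i)" "linear_form (rsp W i) \<theta>"
        using us[OF i(1)] ws[OF i(1)] by (auto simp: dual_basis_def)
      then show ?thesis unfolding i(4) by (intro linear_form_compose[OF eval_hom[OF i(1)]])
    qed
    fix h assume h: "h \<in> carrier (hom_space Q V W)" "\<And>\<xi>. \<xi> \<in> ?F \<Longrightarrow> \<xi> h = 0"
    have hV: "h \<in> rep_hom Q V W" using h by simp
    show "h = \<zero>\<^bsub>hom_space Q V W\<^esub>"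
    proof (rule rep_hom_ext[OF hV hom_space_closed(1)[OF wf V W]])
      fix i x assume i: "i \<in> verts Q" "x \<in> carrier (rsp V i)"
      interpret V: kspace "rsp V i" using fd_repD(2)[OF V i(1)] .
      interpret W: kspace "rsp W i" using fd_repD(2)[OF W i(1)] .
      have hom: "h i \<in> module_hom class_ring (rsp V i) (rsp W i)" by (rule rep_homD(1)[OF hV i(1)])
      have "\<theta> (h i x) = 0" if \<theta>: "\<theta> \<in> set (\<theta>s i)" for \<theta>
      proof -
        have "linear_form (rsp W i) \<theta>" using ws[OF i(1)] \<theta> by (simp add: dual_basis_def)
        then have lf: "linear_form (rsp V i) (\<lambda>x. \<theta> (h i x))" by (rule linear_form_compose[OF hom])
        have "\<theta> (h i (us i ! k)) = 0" if "k < length (us i)" for k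
          using h(2)[of "\<lambda>h. \<theta> (h i (us i ! k))"] i \<theta> that by force
        then show ?thesis
          using V.form_expansion[OF V.subspace_carrier us[OF i(1)] i(2), of "\<lambda>x. \<theta> (h i x)"] lf
          by simp
      qed
      then have "h i x = \<zero>\<^bsub>rsp W i\<^esub>"
        using ws[OF i(1)] rep_homD(2)[OF hV i] by (simp add: dual_basis_def)
      then show "h i x = \<zero>\<^bsub>hom_space Q V W\<^esub> i x" using i by simp
    qed
  qed
qed

lemma precompose_hom:
  assumes "wf_digraph Q" "fd_rep Q A" "f \<in> rep_hom Q A B"
  shows "(\<lambda>g. rep_comp Q A g f) \<in> module_hom class_ring (hom_space Q B C) (hom_space Q A C)"
proof (rule module_homI)
  show "rep_comp Q A g f \<in> carrier (hom_space Q A C)" if "g \<in> carrier (hom_space Q B C)" for g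
    using rep_comp_hom[OF assms] that by simp
qed (use rep_homD(2)[OF assms(3)] in \<open>auto simp: rep_comp_def compose_def restrict_def fun_eq_iff\<close>)

lemma rep_id_comp:
  assumes "f \<in> rep_hom Q A B"
  shows "rep_comp Q A (rep_id Q B) f = f"
proof -
  have "rep_comp Q A (rep_id Q B) f = (\<lambda>i\<in>verts Q. \<lambda>x\<in>carrier (rsp A i). f i x)"
    unfolding rep_comp_def rep_id_def compose_def
    by (intro restrict_ext) (simp add: rep_homD(2)[OF assms])
  then show ?thesis using rep_hom_restrict[OF assms] by simp
qed

lemma sub_rep_simps [simp]:
  "rsp (sub_rep M U) i = (rsp M i)\<lparr>carrier := U i\<rparr>" "rmap (sub_rep M U) = rmap M"
  by (simp_all add: sub_rep_def)

lemma subspace_subset: "is_subspace W V \<Longrightarrow> W \<subseteq> carrier V"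
  by (simp add: VectorSpace.subspace_def submodule_def)

lemma subrepsD:
  assumes "U \<in> subreps Q M"
  shows "i \<in> verts Q \<Longrightarrow> is_subspace (U i) (rsp M i)"
    and "a \<in> arcs Q \<Longrightarrow> x \<in> U (tail Q a) \<Longrightarrow> rmap M a x \<in> U (head Q a)"
  using assms by (auto simp: subreps_def subspaces_def PiE_iff)

lemma sub_rep_fd:
  assumes wf: "wf_digraph Q" and M: "fd_rep Q M" and U: "U \<in> subreps Q M"
  shows "fd_rep Q (sub_rep M U)"
  unfolding fd_rep_def
proof (intro conjI ballI)
  fix i assume "i \<in> verts Q"
  then show "fd_space (rsp (sub_rep M U) i)"
    using fd_space_subspace(2)[OF fd_repD(1)[OF M] subrepsD(1)[OF U]] by simp
next
  fix a assume a: "a \<in> arcs Q"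
  then have v: "tail Q a \<in> verts Q" using wf by (simp add: wf_digraph_def)
  have "U (tail Q a) \<subseteq> carrier (rsp M (tail Q a))"
    by (rule subspace_subset[OF subrepsD(1)[OF U v]])
  then show "rmap (sub_rep M U) a \<in> module_hom class_ring (rsp (sub_rep M U) (tail Q a))
    (rsp (sub_rep M U) (head Q a))"
    using subrepsD(2)[OF U a] module_homD[OF fd_repD(3)[OF M a]]
    by (intro module_homI) (auto simp: subset_iff)
qed

lemma rep_hom_sub_rep:
  assumes "wf_digraph Q" "fd_rep Q M" "U \<in> subreps Q M"
  shows "h \<in> rep_hom Q P (sub_rep M U) \<longleftrightarrow>
    h \<in> rep_hom Q P M \<and> (\<forall>i\<in>verts Q. \<forall>x\<in>carrier (rsp P i). h i x \<in> U i)"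
proof -
  have "U i \<subseteq> carrier (rsp M i)" if "i \<in> verts Q" for i
    by (rule subspace_subset[OF subrepsD(1)[OF assms(3) that]])
  then show ?thesis
    by (auto simp: rep_hom_def module_hom_def PiE_iff Pi_iff subset_iff)
qed

lemma hom_space_sub_rep:
  "hom_space Q P (sub_rep M U) = (hom_space Q P M)\<lparr>carrier := rep_hom Q P (sub_rep M U)\<rparr>"
  by (simp add: hom_space_def)


section \<open>Indecomposable projectives\<close>

definition path_act :: "('q, 'e, 'k, 'a) quiver_rep \<Rightarrow> 'e list \<Rightarrow> 'a \<Rightarrow> 'a" where
  "path_act V p x = foldl (\<lambda>y a. rmap V a y) x p"

lemma path_act_simps [simp]:
  "path_act V [] x = x" "path_act V (p @ [a]) x = rmap V a (path_act V p x)"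
  by (simp_all add: path_act_def)

text \<open>The direct sum of the representations \<open>P\<^sub>i\<close>, where \<open>i\<close> runs through the list \<open>is\<close>: the indicator function
  of \<open>(p, n)\<close> is the path \<open>p\<close> in the summand number \<open>n\<close>. The representation \<open>P\<^sub>i\<close> itself is the
  case of a single summand, which has number \<open>0\<close>.\<close>

definition free_rep :: "('q, 'e) pre_digraph \<Rightarrow> 'q list \<Rightarrow> ('q, 'e, 'k::field) qrep" where
  "free_rep Q is = \<lparr>
     rsp = (\<lambda>j. \<lparr>
       carrier = {f. \<forall>p n. f (p, n) \<noteq> 0 \<longrightarrow> n < length is \<and> pre_digraph.awalk Q (is ! n) p j},
       mult = undefined, one = undefined,
       zero = (\<lambda>_. 0), add = (\<lambda>f g x. f x + g x), smult = (\<lambda>c f x. c * f x)\<rparr>),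
     rmap = (\<lambda>a f (p, n). if p \<noteq> [] \<and> last p = a then f (butlast p, n) else 0)\<rparr>"

lemma free_rep_simps:
  "carrier (rsp (free_rep Q is) j) = {f. \<forall>p n. f (p, n) \<noteq> 0 \<longrightarrow> n < length is
    \<and> pre_digraph.awalk Q (is ! n) p j}"
  "\<zero>\<^bsub>rsp (free_rep Q is) j\<^esub> = (\<lambda>_. 0)"
  "f \<oplus>\<^bsub>rsp (free_rep Q is) j\<^esub> g = (\<lambda>x. f x + g x)"
  "c \<odot>\<^bsub>rsp (free_rep Q is) j\<^esub> f = (\<lambda>x. c * f x)"
  "rmap (free_rep Q is) a f = (\<lambda>(p, n). if p \<noteq> [] \<and> last p = a then f (butlast p, n) else 0)"
  by (simp_all add: free_rep_def)

context path_finite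
begin

lemma finite_walks_between: "finite {p. awalk i p j}"
  by (rule finite_subset[OF _ finite_walks]) auto

lemma awalk_snoc_iff: "awalk i (p @ [a]) j \<longleftrightarrow> a \<in> arcs Q \<and> head Q a = j \<and> awalk i p (tail Q a)"
proof -
  have "awalk i (p @ [a]) j \<longleftrightarrow> awalk i p (awlast i p) \<and> awalk (awlast i p) [a] j"
    by (rule awalk_append_iff)
  also have "\<dots> \<longleftrightarrow> a \<in> arcs Q \<and> head Q a = j \<and> awalk i p (tail Q a)"
    by (auto simp: awalk_Cons_iff awalk_Nil_iff)
  finally show ?thesis .
qed

lemma path_act_hom:
  fixes V :: "('q, 'e, 'k::field, 'a) quiver_rep"
  assumes V: "fd_rep Q V" and "awalk i p j"
  shows "path_act V p \<in> module_hom class_ring (rsp V i) (rsp V j)"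
  using assms(2)
proof (induction p arbitrary: j rule: rev_induct)
  case Nil
  then show ?case by (auto simp: awalk_Nil_iff intro: module_homI)
next
  case (snoc a p)
  then have a: "a \<in> arcs Q" "head Q a = j" "awalk i p (tail Q a)" by (auto simp: awalk_snoc_iff)
  show ?case
    using module_homD[OF snoc.IH[OF a(3)]] module_homD[OF fd_repD(3)[OF V a(1)]] a(2)
    by (intro module_homI) auto
qed

lemma rep_hom_path_act:
  assumes V: "fd_rep Q V" and h: "h \<in> rep_hom Q V W" and "awalk i p j" "x \<in> carrier (rsp V i)"
  shows "h j (path_act V p x) = path_act W p (h i x)"
  using assms(3)
proof (induction p arbitrary: j rule: rev_induct)
  case (snoc a p)
  then have a: "a \<in> arcs Q" "head Q a = j" "awalk i p (tail Q a)" by (auto simp: awalk_snoc_iff)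
  have "path_act V p x \<in> carrier (rsp V (tail Q a))"
    using module_homD(1)[OF path_act_hom[OF V a(3)]] assms(4) .
  then show ?case using rep_homD(3)[OF h a(1)] a(2) snoc.IH[OF a(3)] by auto
qed (auto simp: awalk_Nil_iff)

lemma singleton_nth_walk: "n < length [i] \<and> awalk ([i] ! n) p j \<longleftrightarrow> n = 0 \<and> awalk i p j"
  by (cases n) auto

lemma proj_rep_eq_free: "(proj_rep Q i :: ('q, 'e, 'k::field) qrep) = free_rep Q [i]"
proof -
  have *: "finite {x. f x \<noteq> 0}" if "\<forall>p n. f (p, n) \<noteq> 0 \<longrightarrow> n = 0 \<and> awalk i p j"
    for f :: "('e, 'k::field) vec_elem" and j
  proof (rule finite_subset)
    show "{x. f x \<noteq> 0} \<subseteq> {p. awalk i p j} \<times> {0}" using that by auto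
  qed (use finite_walks_between in auto)
  have "{f. finite {x. f x \<noteq> 0} \<and> (\<forall>p n. f (p, n) \<noteq> 0 \<longrightarrow> n = 0 \<and> awalk i p j)} =
     {f. \<forall>p n. f (p, n) \<noteq> (0::'k) \<longrightarrow> n < length [i] \<and> awalk ([i] ! n) p j}" for j
    unfolding singleton_nth_walk
  proof (rule Collect_cong)
    fix f :: "('e, 'k) vec_elem"
    show "(finite {x. f x \<noteq> 0} \<and> (\<forall>p n. f (p, n) \<noteq> 0 \<longrightarrow> n = 0 \<and> awalk i p j)) =
      (\<forall>p n. f (p, n) \<noteq> 0 \<longrightarrow> n = 0 \<and> awalk i p j)"
      using *[of f j] by argo
  qed
  then show ?thesis by (simp add: proj_rep_def free_rep_def)
qed

lemma free_rep_kspace: "kspace (rsp (free_rep Q is :: ('q, 'e, 'k::field) qrep) j)"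
  unfolding kspace_def
proof (rule vs_criteria)
  show "field (class_ring :: 'k ring)" by (rule class_field)
  let ?F = "rsp (free_rep Q is :: ('q, 'e, 'k::field) qrep) j"
  show "\<forall>v\<in>carrier ?F. \<exists>w\<in>carrier ?F. v \<oplus>\<^bsub>?F\<^esub> w = \<zero>\<^bsub>?F\<^esub>"
  proof
    fix v assume "v \<in> carrier ?F"
    then show "\<exists>w\<in>carrier ?F. v \<oplus>\<^bsub>?F\<^esub> w = \<zero>\<^bsub>?F\<^esub>"
      by (intro bexI[of _ "\<lambda>x. - v x"]) (auto simp: free_rep_simps)
  qed
  show "\<forall>v w. v \<in> carrier ?F \<and> w \<in> carrier ?F \<longrightarrow> v \<oplus>\<^bsub>?F\<^esub> w \<in> carrier ?F"
    unfolding free_rep_simps by (auto 0 0) (metis add.right_neutral)+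
qed (auto simp: free_rep_simps algebra_simps)

lemma free_rep_fd: "fd_rep Q (free_rep Q is :: ('q, 'e, 'k::field) qrep)"
  unfolding fd_rep_def
proof (intro conjI ballI)
  let ?F = "free_rep Q is :: ('q, 'e, 'k::field) qrep"
  fix j
  let ?S = "\<Union>n<length is. {p. awalk (is ! n) p j} \<times> {n}"
  show "fd_space (rsp ?F j)"
  proof (rule fd_spaceI[OF free_rep_kspace, of "(\<lambda>x f. f x) ` ?S"])
    show "finite ((\<lambda>x f. f x) ` ?S)" using finite_walks_between by auto
    show "linear_form (rsp ?F j) \<xi>" if "\<xi> \<in> (\<lambda>x f. f x) ` ?S" for \<xi>
      using that by (auto simp: linear_form_def free_rep_simps)
    fix f assume f: "f \<in> carrier (rsp ?F j)" "\<And>\<xi>. \<xi> \<in> (\<lambda>x f. f x) ` ?S \<Longrightarrow> \<xi> f = 0"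
    have "f (p, n) = 0" for p n
    proof (rule ccontr)
      assume "f (p, n) \<noteq> 0"
      then have "(p, n) \<in> ?S" using f(1) by (auto simp: free_rep_simps)
      then show False using f(2)[of "\<lambda>f. f (p, n)"] \<open>f (p, n) \<noteq> 0\<close> by blast
    qed
    then show "f = \<zero>\<^bsub>rsp ?F j\<^esub>" by (auto simp: free_rep_simps)
  qed
next
  let ?F = "free_rep Q is :: ('q, 'e, 'k::field) qrep"
  fix a assume a: "a \<in> arcs Q"
  show "rmap ?F a \<in> module_hom class_ring (rsp ?F (tail Q a)) (rsp ?F (head Q a))"
  proof (rule module_homI)
    fix f assume f: "f \<in> carrier (rsp ?F (tail Q a))"
    have "n < length is \<and> awalk (is ! n) p (head Q a)" if "rmap ?F a f (p, n) \<noteq> 0" for p n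
    proof -
      from that have p: "p \<noteq> []" "last p = a" "f (butlast p, n) \<noteq> 0"
        by (auto simp: free_rep_simps split: if_splits)
      then have "n < length is" "awalk (is ! n) (butlast p) (tail Q a)"
        using f by (auto simp: free_rep_simps)
      then have "awalk (is ! n) (butlast p @ [a]) (head Q a)" using a by (simp only: awalk_snoc_iff)
      then show ?thesis using p \<open>n < length is\<close> by (metis append_butlast_last_id)
    qed
    then show "rmap ?F a f \<in> carrier (rsp ?F (head Q a))" by (simp add: free_rep_simps(1))
  qed (auto simp: free_rep_simps fun_eq_iff)
qed

abbreviation proj_at :: "'q \<Rightarrow> 'q \<Rightarrow> ('k::field, ('e, 'k) vec_elem) module" where
  "proj_at i j \<equiv> rsp (proj_rep Q i) j"

lemmas proj_simps = free_rep_simps[of Q "[i]" for i, folded proj_rep_eq_free]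

lemma proj_carrier: "f \<in> carrier (proj_at i j) \<longleftrightarrow> (\<forall>p n. f (p, n) \<noteq> 0 \<longrightarrow> n = 0 \<and> awalk i p j)"
  by (simp only: proj_simps singleton_nth_walk mem_Collect_eq)

lemma proj_fd: "fd_rep Q (proj_rep Q i :: ('q, 'e, 'k::field) qrep)"
  unfolding proj_rep_eq_free by (rule free_rep_fd)

lemma proj_kspace: "kspace (proj_at i j)"
  unfolding proj_rep_eq_free by (rule free_rep_kspace)

lemma trivial_path_mem: "i \<in> verts Q \<Longrightarrow> (trivial_path :: ('e, 'k::field) vec_elem) \<in> carrier
  (proj_at i i)"
  by (auto simp: proj_carrier trivial_path_def awalk_Nil_iff)

text \<open>The morphism \<open>P\<^sub>i \<rightarrow> V\<close> that sends the trivial path to \<open>x\<close>, hence the path \<open>p\<close> to \<open>p x\<close>.\<close>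

definition yoneda :: "('q, 'e, 'k::field, 'a) quiver_rep \<Rightarrow> 'q \<Rightarrow> 'a \<Rightarrow> 'q \<Rightarrow> ('e, 'k) vec_elem \<Rightarrow> 'a"
  where
  "yoneda V i x = (\<lambda>j\<in>verts Q. \<lambda>f\<in>carrier (proj_at i j).
     \<Oplus>\<^bsub>rsp V j\<^esub>p\<in>{p. awalk i p j}. f (p, 0) \<odot>\<^bsub>rsp V j\<^esub> path_act V p x)"

lemma yoneda_hom:
  fixes V :: "('q, 'e, 'k::field, 'a) quiver_rep"
  assumes V: "fd_rep Q V" and i: "i \<in> verts Q" and x: "x \<in> carrier (rsp V i)"
  shows "yoneda V i x \<in> rep_hom Q (proj_rep Q i) V"
proof (rule rep_homI[OF _ _ proj_fd wf_digraph_axioms])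
  show "yoneda V i x = (\<lambda>j\<in>verts Q. \<lambda>f\<in>carrier (proj_at i j).
      (\<lambda>j f. \<Oplus>\<^bsub>rsp V j\<^esub>p\<in>{p. awalk i p j}. f (p, 0) \<odot>\<^bsub>rsp V j\<^esub> path_act V p x) j f)"
    by (simp add: yoneda_def)
  have act: "path_act V p x \<in> carrier (rsp V j)" if "awalk i p j" for p j
    using module_homD(1)[OF path_act_hom[OF V that] x] .
  show "(\<lambda>f. \<Oplus>\<^bsub>rsp V j\<^esub>p\<in>{p. awalk i p j}. f (p, 0) \<odot>\<^bsub>rsp V j\<^esub> path_act V p x)
      \<in> module_hom class_ring (proj_at i j) (rsp V j)" if j: "j \<in> verts Q" for j
  proof -
    interpret V: kspace "rsp V j" using fd_repD(2)[OF V j] .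
    show ?thesis
    proof (rule module_homI)
      fix f g :: "('e, 'k) vec_elem" assume "f \<in> carrier (proj_at i j)" "g \<in> carrier (proj_at i j)"
      have "(\<Oplus>\<^bsub>rsp V j\<^esub>p\<in>{p. awalk i p j}. (f \<oplus>\<^bsub>proj_at i j\<^esub> g) (p, 0) \<odot>\<^bsub>rsp V j\<^esub> path_act V p x)
        = (\<Oplus>\<^bsub>rsp V j\<^esub>p\<in>{p. awalk i p j}. f (p, 0) \<odot>\<^bsub>rsp V j\<^esub> path_act V p x \<oplus>\<^bsub>rsp V j\<^esub>
            g (p, 0) \<odot>\<^bsub>rsp V j\<^esub> path_act V p x)"
        using act by (intro V.finsum_cong') (auto simp: proj_simps V.scale_add_left)
      also have "\<dots> = (\<Oplus>\<^bsub>rsp V j\<^esub>p\<in>{p. awalk i p j}. f (p, 0) \<odot>\<^bsub>rsp V j\<^esub> path_act V p x) \<oplus>\<^bsub>rsp V j\<^esub>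
          (\<Oplus>\<^bsub>rsp V j\<^esub>p\<in>{p. awalk i p j}. g (p, 0) \<odot>\<^bsub>rsp V j\<^esub> path_act V p x)"
        using act by (intro V.finsum_addf) auto
      finally show "(\<Oplus>\<^bsub>rsp V j\<^esub>p\<in>{p. awalk i p j}. (f \<oplus>\<^bsub>proj_at i j\<^esub> g) (p, 0) \<odot>\<^bsub>rsp V j\<^esub> path_act V p x)
        = (\<Oplus>\<^bsub>rsp V j\<^esub>p\<in>{p. awalk i p j}. f (p, 0) \<odot>\<^bsub>rsp V j\<^esub> path_act V p x) \<oplus>\<^bsub>rsp V j\<^esub>
          (\<Oplus>\<^bsub>rsp V j\<^esub>p\<in>{p. awalk i p j}. g (p, 0) \<odot>\<^bsub>rsp V j\<^esub> path_act V p x)" .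
    next
      fix f :: "('e, 'k) vec_elem" and c assume "f \<in> carrier (proj_at i j)"
      show "(\<Oplus>\<^bsub>rsp V j\<^esub>p\<in>{p. awalk i p j}. (c \<odot>\<^bsub>proj_at i j\<^esub> f) (p, 0) \<odot>\<^bsub>rsp V j\<^esub> path_act V p x)
        = c \<odot>\<^bsub>rsp V j\<^esub> (\<Oplus>\<^bsub>rsp V j\<^esub>p\<in>{p. awalk i p j}. f (p, 0) \<odot>\<^bsub>rsp V j\<^esub> path_act V p x)"
        using act finite_walks_between by (subst V.finsum_smult)
          (auto simp: proj_simps V.scale_scale intro!: V.finsum_cong')
    qed (use act in \<open>auto intro!: V.finsum_closed\<close>)
  qed
  fix a and f :: "('e, 'k) vec_elem" assume a: "a \<in> arcs Q"
    and f: "f \<in> carrier (proj_at i (tail Q a))"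
  have v: "tail Q a \<in> verts Q" "head Q a \<in> verts Q" using a by auto
  interpret V: kspace "rsp V (head Q a)" using fd_repD(2)[OF V v(2)] .
  let ?t = "\<lambda>p. rmap (proj_rep Q i) a f (p, 0) \<odot>\<^bsub>rsp V (head Q a)\<^esub> path_act V p x"
  \<comment> \<open>only the paths that end with the arrow \<open>a\<close> occur in the image of \<open>f\<close> under \<open>a\<close>\<close>
  have "(\<Oplus>\<^bsub>rsp V (head Q a)\<^esub>p\<in>{p. awalk i p (head Q a)}. ?t p)
      = (\<Oplus>\<^bsub>rsp V (head Q a)\<^esub>p\<in>(\<lambda>p. p @ [a]) ` {p. awalk i p (tail Q a)}. ?t p)"
  proof (rule V.add.finprod_mono_neutral_cong_right[OF finite_walks_between])
    show "(\<lambda>p. p @ [a]) ` {p. awalk i p (tail Q a)} \<subseteq> {p. awalk i p (head Q a)}"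
      using a by (auto simp: awalk_snoc_iff arc_implies_awalk)
    show "?t p = \<zero>\<^bsub>rsp V (head Q a)\<^esub>"
      if p: "p \<in> {p. awalk i p (head Q a)} - (\<lambda>p. p @ [a]) ` {p. awalk i p (tail Q a)}" for p
    proof -
      have "\<not> (p \<noteq> [] \<and> last p = a \<and> f (butlast p, 0) \<noteq> 0)"
      proof
        assume *: "p \<noteq> [] \<and> last p = a \<and> f (butlast p, 0) \<noteq> 0"
        then have "awalk i (butlast p) (tail Q a)" using f by (auto simp: proj_carrier)
        moreover have "p = butlast p @ [a]" using * by auto
        ultimately show False using p by blast
      qed
      then have "rmap (proj_rep Q i) a f (p, 0) = 0" by (auto simp: proj_simps)
      then show ?thesis using act p by simp
    qed
  qed (use act in auto)
  also have "\<dots> = (\<Oplus>\<^bsub>rsp V (head Q a)\<^esub>p\<in>{p. awalk i p (tail Q a)}. ?t (p @ [a]))"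
    using act a by (intro V.finsum_reindex) (auto simp: inj_on_def awalk_snoc_iff arc_implies_awalk
      simp del: path_act_simps)
  also have "\<dots> = (\<Oplus>\<^bsub>rsp V (head Q a)\<^esub>p\<in>{p. awalk i p (tail Q a)}.
      rmap V a (f (p, 0) \<odot>\<^bsub>rsp V (tail Q a)\<^esub> path_act V p x))"
    using act module_homD[OF fd_repD(3)[OF V a]]
    by (intro V.finsum_cong') (auto simp: proj_simps)
  also have "\<dots> = rmap V a (\<Oplus>\<^bsub>rsp V (tail Q a)\<^esub>p\<in>{p. awalk i p (tail Q a)}. f (p, 0) \<odot>\<^bsub>rsp V (tail Q a)\<^esub>
    path_act V p x)"
    using act kspace.scale_closed[OF fd_repD(2)[OF V v(1)]]
    by (intro module_hom_finsum[OF fd_repD(2)[OF V v(1)] V.kspace_axioms fd_repD(3)[OF V a], symmetric]) auto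
  finally show "(\<Oplus>\<^bsub>rsp V (head Q a)\<^esub>p\<in>{p. awalk i p (head Q a)}. ?t p)
      = rmap V a (\<Oplus>\<^bsub>rsp V (tail Q a)\<^esub>p\<in>{p. awalk i p (tail Q a)}. f (p, 0) \<odot>\<^bsub>rsp V (tail Q a)\<^esub> path_act
        V p x)" .
qed

lemma yoneda_trivial_path:
  fixes V :: "('q, 'e, 'k::field, 'a) quiver_rep"
  assumes V: "fd_rep Q V" and i: "i \<in> verts Q" and x: "x \<in> carrier (rsp V i)"
  shows "yoneda V i x i trivial_path = x"
proof -
  interpret V: kspace "rsp V i" using fd_repD(2)[OF V i] .
  have act: "path_act V p x \<in> carrier (rsp V i)" if "awalk i p i" for p
    using module_homD(1)[OF path_act_hom[OF V that] x] .
  have "yoneda V i x i trivial_path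
      = (\<Oplus>\<^bsub>rsp V i\<^esub>p\<in>{p. awalk i p i}. trivial_path (p, 0) \<odot>\<^bsub>rsp V i\<^esub> path_act V p x)"
    using i by (simp add: yoneda_def trivial_path_mem)
  also have "\<dots> = (\<Oplus>\<^bsub>rsp V i\<^esub>p\<in>{p. awalk i p i}. if [] = p then path_act V p x else \<zero>\<^bsub>rsp V i\<^esub>)"
    using act x by (intro V.finsum_cong') (auto simp: trivial_path_def)
  also have "\<dots> = path_act V [] x"
    using i act finite_walks_between by (intro V.finsum_singleton) (auto simp: awalk_Nil_iff)
  finally show ?thesis by simp
qed

lemma path_act_trivial_path:
  "path_act (proj_rep Q i) p trivial_path = (\<lambda>x. if x = (p, 0) then 1 else 0)"
proof (induction p rule: rev_induct)
  case (snoc a p)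
  then show ?case by (auto simp: proj_simps fun_eq_iff)
qed (simp add: trivial_path_def)

text \<open>The vectors of \<open>P\<^sub>i\<close> are linear combinations of paths, and a path is its own action on the trivial
  path. So a morphism is determined by the image of the trivial path.\<close>

lemma yoneda_unique:
  fixes V :: "('q, 'e, 'k::field, 'a) quiver_rep"
  assumes V: "fd_rep Q V" and i: "i \<in> verts Q" and h: "h \<in> rep_hom Q (proj_rep Q i) V"
  shows "h = yoneda V i (h i trivial_path)"
proof (rule rep_hom_ext[OF h yoneda_hom[OF V i]])
  note triv = trivial_path_mem[OF i]
  show "h i trivial_path \<in> carrier (rsp V i)" using rep_homD(2)[OF h i triv] .
  fix j and f :: "('e, 'k) vec_elem" assume j: "j \<in> verts Q" and f: "f \<in> carrier (proj_at i j)"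
  interpret P: kspace "proj_at i j :: ('k, ('e, 'k) vec_elem) module" by (rule proj_kspace)
  interpret V: kspace "rsp V j" using fd_repD(2)[OF V j] .
  let ?P = "proj_rep Q i :: ('q, 'e, 'k) qrep"
  have act: "path_act ?P p trivial_path \<in> carrier (proj_at i j)" if "awalk i p j" for p
    using module_homD(1)[OF path_act_hom[OF proj_fd that] triv] .
  let ?g = "\<lambda>p. f (p, 0) \<odot>\<^bsub>proj_at i j\<^esub> path_act ?P p trivial_path"
  have fin: "(\<Oplus>\<^bsub>proj_at i j\<^esub>p\<in>S. ?g p) x = (\<Sum>p\<in>S. ?g p x)" if "S \<subseteq> {p. awalk i p j}" for S x
  proof -
    have "finite S" using finite_subset[OF that finite_walks_between] .
    then show ?thesis
      using that
    proof (induction S)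
      case (insert q S)
      then have "finsum (proj_at i j) ?g (insert q S) = ?g q \<oplus>\<^bsub>proj_at i j\<^esub> finsum (proj_at i j) ?g S"
        using act by (intro P.finsum_insert) auto
      then show ?case using insert by (simp add: proj_simps(3))
    qed (simp add: proj_simps(2))
  qed
  have "f = (\<Oplus>\<^bsub>proj_at i j\<^esub>p\<in>{p. awalk i p j}. ?g p)"
  proof
    fix x :: "'e list \<times> nat"
    obtain q n where x: "x = (q, n)" by (cases x)
    have "(\<Sum>p\<in>{p. awalk i p j}. ?g p x) = (\<Sum>p\<in>{p. awalk i p j}.
      if q = p then (if n = 0 then f x else 0) else 0)"
      by (intro sum.cong) (auto simp: path_act_trivial_path proj_simps(4) x)
    also have "\<dots> = (if awalk i q j then if n = 0 then f x else 0 else 0)"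
      using finite_walks_between by simp
    also have "\<dots> = f x" using f x by (auto simp: proj_carrier)
    finally show "f x = (\<Oplus>\<^bsub>proj_at i j\<^esub>p\<in>{p. awalk i p j}. ?g p) x" using fin by simp
  qed
  then have "h j f = h j (\<Oplus>\<^bsub>proj_at i j\<^esub>p\<in>{p. awalk i p j}. ?g p)" by simp
  also have "\<dots> = (\<Oplus>\<^bsub>rsp V j\<^esub>p\<in>{p. awalk i p j}. h j (?g p))"
    using act by (intro module_hom_finsum[OF proj_kspace V.kspace_axioms rep_homD(1)[OF h j]]) auto
  also have "\<dots> = (\<Oplus>\<^bsub>rsp V j\<^esub>p\<in>{p. awalk i p j}. f (p, 0) \<odot>\<^bsub>rsp V j\<^esub> path_act V p (h i trivial_path))"
    using module_homD(1)[OF path_act_hom[OF V]] rep_homD(2)[OF h i triv]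
    by (intro V.finsum_cong')
      (auto simp: module_homD(3)[OF rep_homD(1)[OF h j]] act rep_hom_path_act[OF proj_fd h _ triv])
  finally show "h j f = yoneda V i (h i trivial_path) j f" using j f by (simp add: yoneda_def)
qed

lemma yoneda_natural:
  fixes V :: "('q, 'e, 'k::field, 'a) quiver_rep" and W :: "('q, 'e, 'k, 'b) quiver_rep"
  assumes V: "fd_rep Q V" and W: "fd_rep Q W" and i: "i \<in> verts Q" and x: "x \<in> carrier (rsp V i)"
    and h: "h \<in> rep_hom Q V W"
  shows "rep_comp Q (proj_rep Q i) h (yoneda V i x) = yoneda W i (h i x)"
proof -
  have "rep_comp Q (proj_rep Q i) h (yoneda V i x) \<in> rep_hom Q (proj_rep Q i) W"
    by (rule rep_comp_hom[OF wf_digraph_axioms proj_fd yoneda_hom[OF V i x] h])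
  moreover have "rep_comp Q (proj_rep Q i) h (yoneda V i x) i trivial_path = h i x"
    using i by (simp add: rep_comp_apply trivial_path_mem yoneda_trivial_path[OF V i x])
  ultimately show ?thesis using yoneda_unique[OF W i] by metis
qed

text \<open>By the Yoneda lemma it suffices to lift the image of the trivial path.\<close>

lemma proj_rep_projective: 
  assumes i: "i \<in> verts Q"
  shows "projective_rep Q (proj_rep Q i :: ('q, 'e, 'k::field) qrep)"
  unfolding projective_rep_def
proof (intro conjI allI ballI impI proj_fd)
  fix A B :: "('q, 'e, 'k) qrep" and g h
  assume g: "g \<in> rep_hom Q A B" and h: "h \<in> rep_hom Q (proj_rep Q i) B"
    and *: "fd_rep Q A \<and> fd_rep Q B \<and> (\<forall>i\<in>verts Q. g i ` carrier (rsp A i) = carrier (rsp B i))"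
  have "h i trivial_path \<in> g i ` carrier (rsp A i)"
    using rep_homD(2)[OF h i trivial_path_mem[OF i]] * i by simp
  then obtain x where x: "x \<in> carrier (rsp A i)" "g i x = h i trivial_path" by force
  show "\<exists>h'\<in>rep_hom Q (proj_rep Q i) A. rep_comp Q (proj_rep Q i) g h' = h"
  proof (rule bexI[OF _ yoneda_hom])
    show "rep_comp Q (proj_rep Q i) g (yoneda A i x) = h"
      using yoneda_natural[OF _ _ i x(1) g] yoneda_unique[OF _ i h] x * by simp
  qed (use * i x in auto)
qed

lemma proj_obj_in: "i \<in> verts Q \<Longrightarrow> proj_obj Q i \<in> (h_objs Q :: ('q, 'e, 'k::field) h_obj set)"
proof -
  assume i: "i \<in> verts Q"
  let ?P = "proj_rep Q i :: ('q, 'e, 'k) qrep"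
  have "R' = zero_subrep Q ?P"
    if d: "rep_decomp Q ?P R R'" and R: "\<forall>j\<in>verts Q. rep_id Q ?P j ` carrier (rsp ?P j) \<subseteq> R j"
      for R R'
  proof (rule extensionalityI)
    show "R' \<in> extensional (verts Q)" using d by (auto simp: rep_decomp_def subreps_def PiE_iff)
    show "zero_subrep Q ?P \<in> extensional (verts Q)" by (simp add: zero_subrep_def)
    fix j assume j: "j \<in> verts Q"
    have "R' j \<subseteq> carrier (rsp ?P j)"
      using d j by (auto simp: rep_decomp_def subreps_def PiE_iff subspaces_def
        VectorSpace.subspace_def submodule_def)
    also have "carrier (rsp ?P j) \<subseteq> R j" using R j by (force simp: rep_id_def)
    finally have "R' j = R j \<inter> R' j" by auto
    then show "R' j = zero_subrep Q ?P j" using d j by (simp add: rep_decomp_def zero_subrep_def)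
  qed
  then show ?thesis
    using proj_rep_projective[OF i] rep_id_hom[OF wf_digraph_axioms proj_fd, of i]
    by (auto simp: h_objs_def proj_obj_def rep_id_def inj_on_def)
qed

end


section \<open>Projectives and sums of indecomposable projectives\<close>

context path_finite
begin

text \<open>The projection of the direct sum to its summand number \<open>n\<close>, the index \<open>n\<close> being changed to \<open>0\<close>.\<close>

definition component :: "'q list \<Rightarrow> nat \<Rightarrow> 'q \<Rightarrow> ('e, 'k::field) vec_elem \<Rightarrow> ('e, 'k) vec_elem" where
  "component is n = (\<lambda>j\<in>verts Q. \<lambda>f\<in>carrier (rsp (free_rep Q is) j). \<lambda>(p, m).
    if m = 0 then f (p, n) else 0)"

lemma component_hom:
  assumes n: "n < length is"
  shows "(component is n :: 'q \<Rightarrow> ('e, 'k::field) vec_elem \<Rightarrow> _) \<in> rep_hom Q (free_rep Q is)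
    (proj_rep Q (is ! n))"
proof (rule rep_homI[OF _ _ free_rep_fd wf_digraph_axioms])
  show "(component is n :: 'q \<Rightarrow> ('e, 'k) vec_elem \<Rightarrow> _)
    = (\<lambda>j\<in>verts Q. \<lambda>f\<in>carrier (rsp (free_rep Q is) j).
      (\<lambda>j f (p, m). if m = 0 then f (p, n) else 0) j f)"
    by (simp add: component_def)
  show "(\<lambda>(f :: ('e, 'k) vec_elem) (p, m). if m = 0 then f (p, n) else 0)
      \<in> module_hom class_ring (rsp (free_rep Q is) j) (proj_at (is ! n) j)" for j
  proof (rule module_homI)
    fix f :: "('e, 'k) vec_elem" assume "f \<in> carrier (rsp (free_rep Q is) j)"
    then show "(\<lambda>(p, m). if m = 0 then f (p, n) else 0) \<in> carrier (proj_at (is ! n) j)"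
      by (auto simp: proj_carrier free_rep_simps(1) split: if_splits)
  qed (auto simp: proj_simps free_rep_simps fun_eq_iff)
qed (auto simp: proj_simps free_rep_simps fun_eq_iff)

lemma component_generator:
  assumes "j \<in> verts Q" "m < length is" "is ! m = j" "n < length is"
  shows "(\<lambda>x. if x = ([], m) then 1 else 0) \<in> carrier
    (rsp (free_rep Q is :: ('q, 'e, 'k::field) qrep) j)"
    and "component is n j (\<lambda>x. if x = ([], m) then 1 else 0 :: 'k) =
      (if m = n then trivial_path else (\<lambda>_. 0))"
proof -
  show *: "(\<lambda>x. if x = ([], m) then 1 else 0) \<in> carrier (rsp (free_rep Q is :: ('q, 'e, 'k) qrep)
    j)"
    using assms by (auto simp: free_rep_simps awalk_Nil_iff)
  show "component is n j (\<lambda>x. if x = ([], m) then 1 else 0 :: 'k) =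
      (if m = n then trivial_path else (\<lambda>_. 0))"
    using assms * by (auto simp: component_def trivial_path_def fun_eq_iff)
qed

lemma hom_finsum_apply:
  fixes W :: "('q, 'e, 'k::field, 'b) quiver_rep"
  assumes V: "fd_rep Q V" and W: "fd_rep Q W" and r: "r \<in> S \<rightarrow> rep_hom Q V W"
    and i: "i \<in> verts Q" "x \<in> carrier (rsp V i)"
  shows "(\<Oplus>\<^bsub>hom_space Q V W\<^esub>n\<in>S. r n) i x = (\<Oplus>\<^bsub>rsp W i\<^esub>n\<in>S. r n i x)"
  using module_hom_finsum[OF hom_space_kspace[OF wf_digraph_axioms V W] fd_repD(2)[OF W i(1)]
    eval_hom[OF i], of r S] r
  by simp

text \<open>The elements of bases of all spaces of \<open>P\<close> define a surjective morphism \<open>g\<close> onto \<open>P\<close> from a direct sum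
  of representations \<open>P\<^sub>i\<close>. As \<open>P\<close> is projective, \<open>g\<close> has a section \<open>s\<close>, and \<open>a n\<close> are its components.\<close>

lemma projective_dual_basis:
  fixes P :: "('q, 'e, 'k::field) qrep"
  assumes P: "projective_rep Q P"
  shows "\<exists>N is xs a. (\<forall>n<N. is n \<in> verts Q \<and> xs n \<in> carrier (rsp P (is n)) \<and>
      a n \<in> rep_hom Q P (proj_rep Q (is n))) \<and>
    (\<forall>j\<in>verts Q. \<forall>y\<in>carrier (rsp P j). y = (\<Oplus>\<^bsub>rsp P j\<^esub>n\<in>{..<N::nat}. yoneda P (is n) (xs n) j (a n j y)))"
proof -
  have PV: "fd_rep Q P" using P by (simp add: projective_rep_def)
  have "\<forall>i\<in>verts Q. \<exists>us \<omega>s. dual_basis (rsp P i) (carrier (rsp P i)) us \<omega>s"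
    using fd_space_dual_basis fd_repD(1)[OF PV] by blast
  then obtain us \<omega>s where us: "\<And>i. i \<in> verts Q \<Longrightarrow> dual_basis (rsp P i) (carrier (rsp P i)) (us i)
    (\<omega>s i)"
    by metis
  obtain L where L: "set L = (\<Union>i\<in>verts Q. {i} \<times> set (us i))"
    using finite_list[of "\<Union>i\<in>verts Q. {i} \<times> set (us i)"] finite_verts by auto
  define N where "N = length L"
  define ixs where "ixs = map fst L"
  define xs where "xs n = snd (L ! n)" for n
  have len: "length ixs = N" by (simp add: ixs_def N_def)
  have L_mem: "ixs ! n \<in> verts Q" "xs n \<in> carrier (rsp P (ixs ! n))" if "n < N" for n
  proof -
    have "L ! n \<in> (\<Union>i\<in>verts Q. {i} \<times> set (us i))" using that L by (metis N_def nth_mem)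
    then obtain i u where *: "i \<in> verts Q" "u \<in> set (us i)" "L ! n = (i, u)" by auto
    moreover have "u \<in> carrier (rsp P i)" using us[OF *(1)] *(2) by (auto simp: dual_basis_def)
    ultimately show "ixs ! n \<in> verts Q" "xs n \<in> carrier (rsp P (ixs ! n))"
      using that by (auto simp: ixs_def xs_def N_def)
  qed
  let ?F = "free_rep Q ixs :: ('q, 'e, 'k) qrep"
  note F = free_rep_fd[of ixs, where 'k = 'k]
  have comp: "component ixs n \<in> rep_hom Q ?F (proj_rep Q (ixs ! n))" if "n < N" for n
    using component_hom[of n ixs] that len by simp
  define r where "r n = rep_comp Q ?F (yoneda P (ixs ! n) (xs n)) (component ixs n)" for n
  have r: "r n \<in> rep_hom Q ?F P" if "n < N" for n
    unfolding r_def using that L_mem comp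
    by (intro rep_comp_hom[OF wf_digraph_axioms F _ yoneda_hom[OF PV]]) auto
  define g where "g = (\<Oplus>\<^bsub>hom_space Q ?F P\<^esub>n\<in>{..<N}. r n)"
  interpret H: kspace "hom_space Q ?F P" by (rule hom_space_kspace[OF wf_digraph_axioms F PV])
  have g: "g \<in> rep_hom Q ?F P" using H.finsum_closed[of r "{..<N}"] r by (auto simp: g_def)
  have g_apply: "g j z = (\<Oplus>\<^bsub>rsp P j\<^esub>n\<in>{..<N}. yoneda P (ixs ! n) (xs n) j (component ixs n j z))"
    if "j \<in> verts Q" "z \<in> carrier (rsp ?F j)" for j z
  proof -
    have "g j z = (\<Oplus>\<^bsub>rsp P j\<^esub>n\<in>{..<N}. r n j z)"
      unfolding g_def using r by (intro hom_finsum_apply[OF F PV _ that]) auto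
    then show ?thesis by (simp add: r_def rep_comp_apply that)
  qed
  have surj: "g j ` carrier (rsp ?F j) = carrier (rsp P j)" if j: "j \<in> verts Q" for j
  proof
    interpret P: kspace "rsp P j" by (rule fd_repD(2)[OF PV j])
    interpret F: kspace "rsp ?F j" by (rule fd_repD(2)[OF F j])
    note gj = module_homD[OF rep_homD(1)[OF g j]]
    show "g j ` carrier (rsp ?F j) \<subseteq> carrier (rsp P j)" using gj(1) by auto
    have sub: "is_subspace (g j ` carrier (rsp ?F j)) (rsp P j)"
      by (rule image_subspace[OF F.kspace_axioms P.kspace_axioms rep_homD(1)[OF g j]])
    have "set (us j) \<subseteq> g j ` carrier (rsp ?F j)"
    proof
      fix u assume u: "u \<in> set (us j)"
      then have "(j, u) \<in> set L" using L j by auto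
      then obtain m where m: "m < N" "L ! m = (j, u)" by (metis N_def in_set_conv_nth)
      then have m': "ixs ! m = j" "xs m = u" by (auto simp: ixs_def xs_def N_def)
      define z :: "('e, 'k) vec_elem" where "z = (\<lambda>x. if x = ([], m) then 1 else 0 :: 'k)"
      have z: "z \<in> carrier (rsp ?F j)" and comp_z: "component ixs n j z
        = (if m = n then trivial_path else (\<lambda>_. 0))"
        if "n < N" for n
        using component_generator[OF j, of m ixs n] m m' that len by (auto simp: z_def)
      have yz: "yoneda P (ixs ! n) (xs n) j (component ixs n j z) = (if m = n then u else \<zero>\<^bsub>rsp P j\<^esub>)"
        if n: "n < N" for n
      proof (cases "m = n")
        case True
        then show ?thesis using comp_z[OF n] yoneda_trivial_path[OF PV] m' L_mem[OF n] by auto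
      next
        case False
        have "yoneda P (ixs ! n) (xs n) j \<zero>\<^bsub>proj_at (ixs ! n) j\<^esub> = \<zero>\<^bsub>rsp P j\<^esub>"
          using L_mem[OF n] by (intro module_hom_zero[OF proj_kspace P.kspace_axioms
            rep_homD(1)[OF yoneda_hom[OF PV] j]]) auto
        then show ?thesis using comp_z[OF n] False by (simp add: proj_simps(2))
      qed
      have uP: "u \<in> carrier (rsp P j)" using us[OF j] u by (auto simp: dual_basis_def)
      have "g j z = (\<Oplus>\<^bsub>rsp P j\<^esub>n\<in>{..<N}. if m = n then u else \<zero>\<^bsub>rsp P j\<^esub>)"
        using g_apply[OF j z[OF m(1)]] yz uP by (auto intro!: P.finsum_cong')
      also have "\<dots> = u" using m(1) uP by (intro P.finsum_singleton) auto
      finally show "u \<in> g j ` carrier (rsp ?F j)" using z[OF m(1)] by force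
    qed
    from P.comb_in_subspace[OF sub this] show "carrier (rsp P j) \<subseteq> g j ` carrier (rsp ?F j)"
      using P.dual_basis_expansion[OF P.subspace_carrier us[OF j]] by (metis subsetI)
  qed
  have "rep_id Q P \<in> rep_hom Q P P" by (rule rep_id_hom[OF wf_digraph_axioms PV])
  then obtain s where s: "s \<in> rep_hom Q P ?F" "rep_comp Q P g s = rep_id Q P"
    using P g F PV surj unfolding projective_rep_def by blast
  let ?a = "\<lambda>n. rep_comp Q P (component ixs n) s"
  show ?thesis
  proof (intro exI[of _ N] exI[of _ "\<lambda>n. ixs ! n"] exI[of _ xs] exI[of _ ?a] conjI allI impI ballI)
    fix n assume n: "n < N"
    show "ixs ! n \<in> verts Q" "xs n \<in> carrier (rsp P (ixs ! n))" using L_mem[OF n] by auto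
    show "?a n \<in> rep_hom Q P (proj_rep Q (ixs ! n))"
      by (rule rep_comp_hom[OF wf_digraph_axioms PV s(1) comp[OF n]])
  next
    fix j y assume j: "j \<in> verts Q" and y: "y \<in> carrier (rsp P j)"
    have "y = rep_id Q P j y" using j y by (simp add: rep_id_def)
    also have "\<dots> = g j (s j y)" using s(2) j y by (metis rep_comp_apply)
    also have "\<dots> = (\<Oplus>\<^bsub>rsp P j\<^esub>n\<in>{..<N}. yoneda P (ixs ! n) (xs n) j (?a n j y))"
      using g_apply[OF j rep_homD(2)[OF s(1) j y]] j y by (simp add: rep_comp_apply)
    finally show "y = (\<Oplus>\<^bsub>rsp P j\<^esub>n\<in>{..<N}. yoneda P (ixs ! n) (xs n) j (?a n j y))" .
  qed
qed

text \<open>One applies \<open>h\<close> to the expansion of \<open>y\<close>; a composite \<open>P\<^sub>i \<rightarrow> P \<rightarrow> M\<close> is given by the image in \<open>M\<close> of the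
  element of \<open>P\<close> that gives \<open>P\<^sub>i \<rightarrow> P\<close>.\<close>

lemma projective_hom_expansion:
  fixes P :: "('q, 'e, 'k::field) qrep"
  assumes P: "projective_rep Q P"
  shows "\<exists>N is xs a. (\<forall>n<N. is n \<in> verts Q \<and> xs n \<in> carrier (rsp P (is n)) \<and>
      a n \<in> rep_hom Q P (proj_rep Q (is n))) \<and>
    (\<forall>M :: ('q, 'e, 'k, 'm) quiver_rep. \<forall>h\<in>rep_hom Q P M. fd_rep Q M \<longrightarrow>
      (\<forall>j\<in>verts Q. \<forall>y\<in>carrier (rsp P j).
      h j y = (\<Oplus>\<^bsub>rsp M j\<^esub>n\<in>{..<N::nat}. yoneda M (is n) (h (is n) (xs n)) j (a n j y))))"
proof -
  have PV: "fd_rep Q P" using P by (simp add: projective_rep_def)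
  obtain N :: nat and ixs xs a where *: "\<And>n. n < N \<Longrightarrow> ixs n \<in> verts Q
    \<and> xs n \<in> carrier (rsp P (ixs n)) \<and>
      a n \<in> rep_hom Q P (proj_rep Q (ixs n))"
    "\<And>j y. j \<in> verts Q \<Longrightarrow> y \<in> carrier (rsp P j) \<Longrightarrow>
      y = (\<Oplus>\<^bsub>rsp P j\<^esub>n\<in>{..<N}. yoneda P (ixs n) (xs n) j (a n j y))"
    using projective_dual_basis[OF P] by blast
  show ?thesis
  proof (intro exI[of _ N] exI[of _ ixs] exI[of _ xs] exI[of _ a] conjI allI impI ballI)
    fix M :: "('q, 'e, 'k, 'm) quiver_rep" and h j y
    assume h: "h \<in> rep_hom Q P M" and M: "fd_rep Q M" and j: "j \<in> verts Q"
      and y: "y \<in> carrier (rsp P j)"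
    interpret M: kspace "rsp M j" by (rule fd_repD(2)[OF M j])
    let ?z = "\<lambda>n. yoneda P (ixs n) (xs n) j (a n j y)"
    have anj: "a n j y \<in> carrier (proj_at (ixs n) j)" if "n < N" for n
      using rep_homD(2)[OF _ j y] *(1)[OF that] by blast
    have z: "?z n \<in> carrier (rsp P j)" if "n < N" for n
      using rep_homD(2)[OF yoneda_hom[OF PV] j anj[OF that]] *(1)[OF that] by blast
    have hz: "h j (?z n) = yoneda M (ixs n) (h (ixs n) (xs n)) j (a n j y)" if n: "n < N" for n
      using yoneda_natural[OF PV M _ _ h, of "ixs n" "xs n"] *(1)[OF n] j anj[OF n]
      by (metis rep_comp_apply)
    have "h j y = h j (\<Oplus>\<^bsub>rsp P j\<^esub>n\<in>{..<N}. ?z n)" using *(2)[OF j y] by simp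
    also have "\<dots> = (\<Oplus>\<^bsub>rsp M j\<^esub>n\<in>{..<N}. h j (?z n))"
      using z by (intro module_hom_finsum[OF fd_repD(2)[OF PV j] M.kspace_axioms rep_homD(1)[OF h j]]) auto
    also have "\<dots> = (\<Oplus>\<^bsub>rsp M j\<^esub>n\<in>{..<N}. yoneda M (ixs n) (h (ixs n) (xs n)) j (a n j y))"
      using hz rep_homD(2)[OF h j z] by (intro M.finsum_cong') auto
    finally show "h j y = (\<Oplus>\<^bsub>rsp M j\<^esub>n\<in>{..<N}. yoneda M (ixs n) (h (ixs n) (xs n)) j (a n j y))" .
  qed (use *(1) in auto)
qed

end


section \<open>The functors attached to representations\<close>

text \<open>The image of \<open>Hom (Q, M) \<rightarrow> Hom (P, M)\<close> for \<open>X = (P \<subset> Q)\<close>.\<close>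

definition hat_vectors :: "('q, 'e) pre_digraph \<Rightarrow> ('q, 'e, 'k::field, 'm) quiver_rep \<Rightarrow>
  ('q, 'e, 'k) h_obj \<Rightarrow>
    ('q \<Rightarrow> ('e, 'k) vec_elem \<Rightarrow> 'm) set" where
  "hat_vectors Q M X = (\<lambda>h. rep_comp Q (hsub X) h (hinc X)) ` rep_hom Q (hamb X) M"

lemma hat_fobj: "fobj (hat_functor Q M) X = (hom_space Q (hsub X) M)\<lparr>carrier := hat_vectors Q M X\<rparr>"
  by (simp add: hat_functor_def hat_vectors_def)

lemma hat_fmap: "fmap (hat_functor Q M) X Y \<phi> g = rep_comp Q (hsub X) g (fst \<phi>)"
  by (simp add: hat_functor_def)

lemma h_objsD:
  assumes "X \<in> h_objs Q"
  shows "projective_rep Q (hsub X)" "projective_rep Q (hamb X)" "fd_rep Q (hsub X)"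
    "fd_rep Q (hamb X)"
    "hinc X \<in> rep_hom Q (hsub X) (hamb X)"
  using assms by (auto simp: h_objs_def projective_rep_def)

context path_finite
begin

lemma hat_subspace:
  assumes M: "fd_rep Q M" and X: "X \<in> h_objs Q"
  shows "is_subspace (hat_vectors Q M X) (hom_space Q (hsub X) M)"
  using image_subspace[OF hom_space_kspace[OF wf_digraph_axioms h_objsD(4)[OF X] M]
      hom_space_kspace[OF wf_digraph_axioms h_objsD(3)[OF X] M]
      precompose_hom[OF wf_digraph_axioms h_objsD(3)[OF X] h_objsD(5)[OF X]]]
  by (simp add: hat_vectors_def)

lemma hat_fd:
  assumes M: "fd_rep Q M" and X: "X \<in> h_objs Q"
  shows "fd_space (fobj (hat_functor Q M) X)"
  unfolding hat_fobj
  by (rule fd_space_subspace(2)[OF hom_space_fd[OF wf_digraph_axioms finite_verts h_objsD(3)[OF X]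
    M] hat_subspace[OF M X]])

lemma hat_vectors_hom:
  assumes M: "fd_rep Q M" and X: "X \<in> h_objs Q" and "g \<in> hat_vectors Q M X"
  shows "g \<in> rep_hom Q (hsub X) M"
  using assms(3) rep_comp_hom[OF wf_digraph_axioms h_objsD(3)[OF X] h_objsD(5)[OF X]]
  by (auto simp: hat_vectors_def)

lemma hat_fmap_closed:
  assumes M: "fd_rep Q M" and X: "X \<in> h_objs Q" and Y: "Y \<in> h_objs Q" and \<phi>: "\<phi> \<in> h_hom Q X Y"
    and g: "g \<in> hat_vectors Q M Y"
  shows "rep_comp Q (hsub X) g (fst \<phi>) \<in> hat_vectors Q M X"
proof -
  obtain h where h: "h \<in> rep_hom Q (hamb Y) M" "g = rep_comp Q (hsub Y) h (hinc Y)"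
    using g by (auto simp: hat_vectors_def)
  obtain a b where ab: "\<phi> = (a, b)" "a \<in> rep_hom Q (hsub X) (hsub Y)"
    "b \<in> rep_hom Q (hamb X) (hamb Y)"
    "rep_comp Q (hsub X) b (hinc X) = rep_comp Q (hsub X) (hinc Y) a"
    using \<phi> by (auto simp: h_hom_def)
  have "rep_comp Q (hsub X) g a = rep_comp Q (hsub X) h (rep_comp Q (hsub X) (hinc Y) a)"
    unfolding h(2) by (rule rep_comp_assoc[OF ab(2)])
  also have "\<dots> = rep_comp Q (hsub X) (rep_comp Q (hamb X) h b) (hinc X)"
    unfolding ab(4)[symmetric] by (rule rep_comp_assoc[OF h_objsD(5)[OF X], symmetric])
  also have "\<dots> \<in> hat_vectors Q M X"
    using rep_comp_hom[OF wf_digraph_axioms h_objsD(4)[OF X] ab(3) h(1)]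
    by (auto simp: hat_vectors_def)
  finally show ?thesis by (simp add: ab(1))
qed

lemma hat_fmap_hom:
  assumes M: "fd_rep Q M" and X: "X \<in> h_objs Q" and Y: "Y \<in> h_objs Q" and \<phi>: "\<phi> \<in> h_hom Q X Y"
  shows "fmap (hat_functor Q M) X Y \<phi> \<in> module_hom class_ring (fobj (hat_functor Q M) Y)
    (fobj (hat_functor Q M) X)"
proof -
  have "fst \<phi> \<in> rep_hom Q (hsub X) (hsub Y)" using \<phi> by (auto simp: h_hom_def)
  note pre = module_homD[OF precompose_hom[OF wf_digraph_axioms h_objsD(3)[OF X] this]]
  show ?thesis
  proof (rule module_homI)
    show "fmap (hat_functor Q M) X Y \<phi> x \<in> carrier (fobj (hat_functor Q M) X)"
      if "x \<in> carrier (fobj (hat_functor Q M) Y)" for x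
      using hat_fmap_closed[OF M X Y \<phi>] that by (simp add: hat_fobj hat_fmap)
    show "fmap (hat_functor Q M) X Y \<phi> (x \<oplus>\<^bsub>fobj (hat_functor Q M) Y\<^esub> y) =
        fmap (hat_functor Q M) X Y \<phi> x \<oplus>\<^bsub>fobj (hat_functor Q M) X\<^esub> fmap (hat_functor Q M) X Y \<phi> y"
      if "x \<in> carrier (fobj (hat_functor Q M) Y)" "y \<in> carrier (fobj (hat_functor Q M) Y)" for x y
      using pre(2)[of x M y] that hat_vectors_hom[OF M Y]
      by (simp add: hat_fobj hat_fmap del: hom_space_simps(2-4))
    show "fmap (hat_functor Q M) X Y \<phi> (c \<odot>\<^bsub>fobj (hat_functor Q M) Y\<^esub> x) =
        c \<odot>\<^bsub>fobj (hat_functor Q M) X\<^esub> fmap (hat_functor Q M) X Y \<phi> x"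
      if "x \<in> carrier (fobj (hat_functor Q M) Y)" for c x
      using pre(3)[of x M c] that hat_vectors_hom[OF M Y]
      by (simp add: hat_fobj hat_fmap del: hom_space_simps(2-4))
  qed
qed

lemma hat_sub_eq: "X \<in> h_objs Q \<Longrightarrow> hat_sub Q M U X = hat_vectors Q (sub_rep M U) X"
  by (simp add: hat_sub_def hat_fobj)

lemma hat_sub_rep_fobj:
  "X \<in> h_objs Q \<Longrightarrow> fobj (hat_functor Q (sub_rep M U)) X = (fobj (hat_functor Q M) X)\<lparr>carrier :=
    hat_sub Q M U X\<rparr>"
  by (simp add: hat_fobj hat_sub_eq hom_space_sub_rep)

lemma hat_sub_subspace:
  assumes M: "fd_rep Q M" and U: "U \<in> subreps Q M" and X: "X \<in> h_objs Q"
  shows "is_subspace (hat_sub Q M U X) (fobj (hat_functor Q M) X)"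
proof -
  note S = sub_rep_fd[OF wf_digraph_axioms M U]
  interpret H: kspace "hom_space Q (hsub X) M"
    by (rule hom_space_kspace[OF wf_digraph_axioms h_objsD(3)[OF X] M])
  interpret S: kspace "hom_space Q (hsub X) (sub_rep M U)"
    by (rule hom_space_kspace[OF wf_digraph_axioms h_objsD(3)[OF X] S])
  have sub: "hat_vectors Q (sub_rep M U) X \<subseteq> hat_vectors Q M X"
    using rep_hom_sub_rep[OF wf_digraph_axioms M U] by (auto simp: hat_vectors_def)
  have "is_subspace (hat_vectors Q (sub_rep M U) X) (hom_space Q (hsub X) M)"
    using hat_subspace[OF S X] hat_subspace[OF M X] sub
    unfolding H.subspace_iff S.subspace_iff
    by (auto simp: hom_space_sub_rep simp del: hom_space_simps(2-4))
  then show ?thesis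
    unfolding hat_fobj hat_sub_eq[OF X] by (rule H.subspace_within[OF hat_subspace[OF M X] _ sub])
qed

lemma hat_quotient_space:
  assumes M: "fd_rep Q M" and U: "U \<in> subreps Q M" and X: "X \<in> h_objs Q"
  shows "quotient_space (fobj (hat_functor Q M) X) (hat_sub Q M U X)"
  using hat_sub_subspace[OF assms] fd_spaceD[OF hat_fd[OF M X]]
  by (simp add: quotient_space_def quotient_space_axioms_def)

lemma hat_vectors_proj_obj:
  assumes "i \<in> verts Q"
  shows "hat_vectors Q M (proj_obj Q i) = rep_hom Q (proj_rep Q i) M"
  using rep_comp_id[of _ Q "proj_rep Q i" M] by (force simp: hat_vectors_def proj_obj_def)

lemma subfunctorsD:
  assumes "G \<in> subfunctors Q F" "X \<in> h_objs Q"
  shows "is_subspace (G X) (fobj F X)"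
    and "Y \<in> h_objs Q \<Longrightarrow> \<phi> \<in> h_hom Q X Y \<Longrightarrow> g \<in> G Y \<Longrightarrow> fmap F X Y \<phi> g \<in> G X"
  using assms by (auto simp: subfunctors_def subspaces_def PiE_iff image_subset_iff)

text \<open>Let \<open>g\<close> be the restriction to \<open>P\<close> of \<open>h : Q \<rightarrow> U\<close>, where \<open>X = (P \<subset> Q)\<close>. Then \<open>h\<close> is a sum of composites
  \<open>Q \<rightarrow> P\<^sub>i \<rightarrow> U\<close>. The second factor lies in \<open>G (P\<^sub>i = P\<^sub>i)\<close> as \<open>res G = U\<close>, and the first one defines a
  morphism \<open>X \<rightarrow> (P\<^sub>i = P\<^sub>i)\<close>, along which \<open>G\<close> maps the second factor to the restriction of the composite.\<close>

lemma hat_sub_in_subfunctor: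
  fixes M :: "('q, 'e, 'k::field, 'm) quiver_rep"
  assumes M: "fd_rep Q M" and U: "U \<in> subreps Q M" and G: "G \<in> subfunctors Q (hat_functor Q M)"
    and res: "res_sub Q G = U" and X: "X \<in> h_objs Q"
  shows "hat_sub Q M U X \<subseteq> G X"
proof
  interpret H: kspace "hom_space Q (hsub X) M"
    by (rule hom_space_kspace[OF wf_digraph_axioms h_objsD(3)[OF X] M])
  have GX: "is_subspace (G X) (hom_space Q (hsub X) M)"
    using H.subspace_trans[OF hat_subspace[OF M X]] subfunctorsD(1)[OF G X] by (simp add: hat_fobj)
  fix g assume "g \<in> hat_sub Q M U X"
  then obtain h where h: "h \<in> rep_hom Q (hamb X) (sub_rep M U)"
    and g: "g = rep_comp Q (hsub X) h (hinc X)"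
    by (auto simp: hat_sub_eq[OF X] hat_vectors_def)
  have hM: "h \<in> rep_hom Q (hamb X) M" and hU: "\<And>i x. i \<in> verts Q \<Longrightarrow> x \<in> carrier (rsp (hamb X) i) \<Longrightarrow>
    h i x \<in> U i"
    using h rep_hom_sub_rep[OF wf_digraph_axioms M U, of h "hamb X"] by blast+
  obtain N :: nat and ixs xs a where *: "\<And>n. n < N \<Longrightarrow> ixs n \<in> verts Q
    \<and> xs n \<in> carrier (rsp (hamb X) (ixs n)) \<and>
      a n \<in> rep_hom Q (hamb X) (proj_rep Q (ixs n))"
    "\<And>(M :: ('q, 'e, 'k, 'm) quiver_rep) h j y. h \<in> rep_hom Q (hamb X) M \<Longrightarrow> fd_rep Q M \<Longrightarrow>
      j \<in> verts Q \<Longrightarrow> y \<in> carrier (rsp (hamb X) j) \<Longrightarrow>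
      h j y = (\<Oplus>\<^bsub>rsp M j\<^esub>n\<in>{..<N::nat}. yoneda M (ixs n) (h (ixs n) (xs n)) j (a n j y))"
    using projective_hom_expansion[OF h_objsD(2)[OF X], where ?'m = 'm] by blast
  let ?i = "\<lambda>n. rep_comp Q (hsub X) (a n) (hinc X)"
  let ?y = "\<lambda>n. yoneda M (ixs n) (h (ixs n) (xs n))"
  let ?t = "\<lambda>n. rep_comp Q (hsub X) (?y n) (?i n)"
  have i: "?i n \<in> rep_hom Q (hsub X) (proj_rep Q (ixs n))" if "n < N" for n
    using *(1)[OF that] by (intro rep_comp_hom[OF wf_digraph_axioms h_objsD(3)[OF X] h_objsD(5)[OF X]]) simp
  have t: "?t n \<in> G X" if n: "n < N" for n
  proof -
    let ?P = "proj_obj Q (ixs n) :: ('q, 'e, 'k) h_obj"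
    have v: "ixs n \<in> verts Q" using *(1)[OF n] by simp
    note P = proj_obj_in[OF v, where 'k = 'k]
    have "h (ixs n) (xs n) \<in> res_sub Q G (ixs n)" using hU *(1)[OF n] res by simp
    then obtain k where k: "k \<in> G ?P" "k (ixs n) trivial_path = h (ixs n) (xs n)"
      using v by (auto simp: res_sub_def)
    have "k \<in> hat_vectors Q M ?P"
      using subspace_subset[OF subfunctorsD(1)[OF G P]] k(1) by (auto simp: hat_fobj)
    then have "k \<in> rep_hom Q (proj_rep Q (ixs n)) M" using hat_vectors_proj_obj[OF v] by blast
    \<comment> \<open>an element of \<open>G (P\<^sub>i = P\<^sub>i)\<close> is determined by its value at the trivial path\<close>
    then have k': "k = ?y n" using yoneda_unique[OF M v] k(2) by metis
    have "(?i n, a n) \<in> h_hom Q X ?P"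
      using i[OF n] *(1)[OF n] rep_id_comp[OF i[OF n]] by (simp add: h_hom_def proj_obj_def)
    from subfunctorsD(2)[OF G X P this k(1)] show ?thesis by (simp add: hat_fmap k')
  qed
  have tM: "?t n \<in> rep_hom Q (hsub X) M" if "n < N" for n
    using t[OF that] GX by (auto simp: H.subspace_iff)
  have gM: "g \<in> rep_hom Q (hsub X) M"
    unfolding g by (rule rep_comp_hom[OF wf_digraph_axioms h_objsD(3)[OF X] h_objsD(5)[OF X] hM])
  have "(\<Oplus>\<^bsub>hom_space Q (hsub X) M\<^esub>n\<in>{..<N}. ?t n) \<in> G X"
    using t by (intro H.finsum_in_subspace[OF GX]) auto
  moreover have "g = (\<Oplus>\<^bsub>hom_space Q (hsub X) M\<^esub>n\<in>{..<N}. ?t n)"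
  proof (rule rep_hom_ext[OF gM])
    show "(\<Oplus>\<^bsub>hom_space Q (hsub X) M\<^esub>n\<in>{..<N}. ?t n) \<in> rep_hom Q (hsub X) M"
      using H.finsum_closed[of ?t "{..<N}"] tM by auto
    fix j x assume j: "j \<in> verts Q" and x: "x \<in> carrier (rsp (hsub X) j)"
    have inc: "hinc X j x \<in> carrier (rsp (hamb X) j)" by (rule rep_homD(2)[OF h_objsD(5)[OF X] j x])
    have "(\<Oplus>\<^bsub>hom_space Q (hsub X) M\<^esub>n\<in>{..<N}. ?t n) j x = (\<Oplus>\<^bsub>rsp M j\<^esub>n\<in>{..<N}. ?t n j x)"
      using tM by (intro hom_finsum_apply[OF h_objsD(3)[OF X] M _ j x]) auto
    also have "\<dots> = (\<Oplus>\<^bsub>rsp M j\<^esub>n\<in>{..<N}. ?y n j (a n j (hinc X j x)))"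
      using j x by (simp add: rep_comp_apply)
    also have "\<dots> = h j (hinc X j x)" by (rule *(2)[OF hM M j inc, symmetric])
    also have "\<dots> = g j x" unfolding g using j x by (simp add: rep_comp_apply)
    finally show "g j x = (\<Oplus>\<^bsub>hom_space Q (hsub X) M\<^esub>n\<in>{..<N}. ?t n) j x" by simp
  qed
  ultimately show "g \<in> G X" by simp
qed

text \<open>At \<open>(P\<^sub>i = P\<^sub>i)\<close> the functor takes the value \<open>Hom (P\<^sub>i, N)\<close>, which is the space of \<open>N\<close> at \<open>i\<close> by the Yoneda
  lemma.\<close>

lemma hat_dim_proj_obj:
  fixes N :: "('q, 'e, 'k::field, 'm) quiver_rep"
  assumes N: "fd_rep Q N" and i: "i \<in> verts Q"
  shows "vdim (fobj (hat_functor Q N) (proj_obj Q i)) = vdim (rsp N i)"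
proof (rule module_hom_bij_dim[OF hat_fd[OF N proj_obj_in[OF i]] fd_repD(2)[OF N i]])
  have eq: "fobj (hat_functor Q N) (proj_obj Q i) = hom_space Q (proj_rep Q i) N"
    using hat_vectors_proj_obj[OF i, of N] by (simp add: hat_fobj proj_obj_def hom_space_def)
  show "(\<lambda>h. h i trivial_path) \<in> module_hom class_ring (fobj (hat_functor Q N) (proj_obj Q i))
    (rsp N i)"
    unfolding eq by (rule eval_hom[OF i trivial_path_mem[OF i]])
  show "bij_betw (\<lambda>h. h i trivial_path) (carrier (fobj (hat_functor Q N) (proj_obj Q i)))
    (carrier (rsp N i))"
    unfolding eq
  proof (rule bij_betw_byWitness[where f' = "yoneda N i"])
    show "\<forall>h\<in>carrier (hom_space Q (proj_rep Q i) N). yoneda N i (h i trivial_path) = h"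
      using yoneda_unique[OF N i] by simp
    show "\<forall>x\<in>carrier (rsp N i). yoneda N i x i trivial_path = x"
      using yoneda_trivial_path[OF N i] by simp
    show "(\<lambda>h. h i trivial_path) ` carrier (hom_space Q (proj_rep Q i) N) \<subseteq> carrier (rsp N i)"
      using rep_homD(2)[OF _ i trivial_path_mem[OF i]] by auto
    show "yoneda N i ` carrier (rsp N i) \<subseteq> carrier (hom_space Q (proj_rep Q i) N)"
      using yoneda_hom[OF N i] by auto
  qed
qed

lemma res_hat_sub:
  assumes M: "fd_rep Q M" and U: "U \<in> subreps Q M" and i: "i \<in> verts Q"
  shows "(\<lambda>h. h i trivial_path) ` hat_sub Q M U (proj_obj Q i) = U i"
proof -
  note S = sub_rep_fd[OF wf_digraph_axioms M U]
  have eq: "hat_sub Q M U (proj_obj Q i) = rep_hom Q (proj_rep Q i) (sub_rep M U)"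
    using hat_sub_eq[OF proj_obj_in[OF i], of M U] hat_vectors_proj_obj[OF i, of "sub_rep M U"]
    by simp
  show ?thesis
    unfolding eq
  proof
    show "(\<lambda>h. h i trivial_path) ` rep_hom Q (proj_rep Q i) (sub_rep M U) \<subseteq> U i"
      using rep_homD(2)[OF _ i trivial_path_mem[OF i], of _ "sub_rep M U"] by auto
    show "U i \<subseteq> (\<lambda>h. h i trivial_path) ` rep_hom Q (proj_rep Q i) (sub_rep M U)"
    proof
      fix u assume "u \<in> U i"
      then have u: "u \<in> carrier (rsp (sub_rep M U) i)" by simp
      show "u \<in> (\<lambda>h. h i trivial_path) ` rep_hom Q (proj_rep Q i) (sub_rep M U)"
        using yoneda_hom[OF S i u] yoneda_trivial_path[OF S i u] by (metis imageI)
    qed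
  qed
qed

text \<open>For an isomorphism class, \<open>vertex_obj\<close> chooses a minimal resolution of one of its members; there is one
  to choose by the definition of the vertices.\<close>

lemma vertex_obj_in:
  assumes "v \<in> h_vertices Q"
  shows "vertex_obj Q v \<in> (h_objs Q :: ('q, 'e, 'k::field) h_obj set)"
proof -
  from assms consider i where "i \<in> verts Q" "v = PVert i"
    | V :: "('q, 'e, 'k) qrep" and X where "v = IVert (iso_class Q V)" "indecomposable_rep Q V"
      "min_resolution Q X V"
    by (auto simp: h_vertices_def)
  then show ?thesis
  proof cases
    case 1
    then show ?thesis by (simp add: vertex_obj_def proj_obj_in)
  next
    case 2
    have V: "fd_rep Q V" using 2 by (simp add: indecomposable_rep_def)
    have "rep_iso Q V V"
      unfolding rep_iso_def using rep_id_hom[OF wf_digraph_axioms V]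
      by (intro bexI[of _ "rep_id Q V"]) (auto simp: rep_id_def bij_betw_def inj_on_def)
    then have "V \<in> iso_class Q V" using V by (simp add: iso_class_def)
    then have "\<exists>X. \<exists>U\<in>iso_class Q V. min_resolution Q X U" using 2(3) by blast
    then have "\<exists>U\<in>iso_class Q V. min_resolution Q (vertex_obj Q v) U"
      unfolding 2(1) vertex_obj_def by (simp only: h_vertex.case) (rule someI_ex)
    then show ?thesis by (auto simp: min_resolution_def)
  qed
qed

end


section \<open>The fibre and the quotient functor\<close>

context path_finite
begin

context
  fixes M :: "('q, 'e, 'k::field, 'm) quiver_rep" and U :: "'q \<Rightarrow> 'm set"
  assumes M: "fd_rep Q M" and U: "U \<in> subreps Q M"
begin

abbreviation "hatM \<equiv> hat_functor Q M"
abbreviation "hatU \<equiv> hat_sub Q M U"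
abbreviation "hatMU \<equiv> quot_functor hatM hatU"
abbreviation hcls where "hcls X \<equiv> (\<lambda>x. hatU X +>\<^bsub>fobj hatM X\<^esub> x)"

lemma quot_fobj: "fobj hatMU X = quot_space (fobj hatM X) (hatU X)"
  by (simp add: quot_functor_def)

text \<open>The map on classes does not depend on representatives, as \<open>hat U\<close> is itself a subfunctor.\<close>

lemma quot_fmap:
  assumes X: "X \<in> h_objs Q" and Y: "Y \<in> h_objs Q" and \<phi>: "\<phi> \<in> h_hom Q X Y"
    and y: "y \<in> carrier (fobj hatM Y)"
  shows "fmap hatMU X Y \<phi> (hcls Y y) = hcls X (fmap hatM X Y \<phi> y)"
proof -
  have "fmap hatM X Y \<phi> ` hatU Y \<subseteq> hatU X"
    using hat_fmap_closed[OF sub_rep_fd[OF wf_digraph_axioms M U] X Y \<phi>]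
    by (auto simp: hat_sub_eq[OF X] hat_sub_eq[OF Y] hat_fmap)
  then show ?thesis
    using coset_image_union[OF hat_quotient_space[OF M U Y] hat_quotient_space[OF M U X]
        hat_fmap_hom[OF M X Y \<phi>] _ y] by (simp add: quot_functor_def)
qed

definition quot_sub :: "(('q, 'e, 'k) h_obj \<Rightarrow> ('q \<Rightarrow> ('e, 'k) vec_elem \<Rightarrow> 'm) set) \<Rightarrow>
    ('q, 'e, 'k) h_obj \<Rightarrow> ('q \<Rightarrow> ('e, 'k) vec_elem \<Rightarrow> 'm) set set" where
  "quot_sub G = (\<lambda>X\<in>h_objs Q. hcls X ` G X)"

definition lift_sub :: "(('q, 'e, 'k) h_obj \<Rightarrow> ('q \<Rightarrow> ('e, 'k) vec_elem \<Rightarrow> 'm) set set) \<Rightarrow>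
    ('q, 'e, 'k) h_obj \<Rightarrow> ('q \<Rightarrow> ('e, 'k) vec_elem \<Rightarrow> 'm) set" where
  "lift_sub H = (\<lambda>X\<in>h_objs Q. {x \<in> carrier (fobj hatM X). hcls X x \<in> H X})"

lemma quot_sub_subfunctor:
  assumes G: "G \<in> subfunctors Q hatM"
  shows "quot_sub G \<in> subfunctors Q hatMU"
  unfolding subfunctors_def
proof (intro CollectI conjI ballI PiE_I)
  fix X :: "('q, 'e, 'k) h_obj" assume X: "X \<in> h_objs Q"
  show "quot_sub G X \<in> subspaces (fobj hatMU X)"
    using quotient_space.subspace_image[OF hat_quotient_space[OF M U X] subfunctorsD(1)[OF G X]] X
    by (simp add: subspaces_def quot_sub_def quot_fobj)
  fix Y \<phi> assume Y: "Y \<in> h_objs Q" and \<phi>: "\<phi> \<in> h_hom Q X Y"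
  show "fmap hatMU X Y \<phi> ` quot_sub G Y \<subseteq> quot_sub G X"
  proof (rule image_subsetI)
    fix A assume "A \<in> quot_sub G Y"
    then obtain y where y: "y \<in> G Y" "A = hcls Y y" using Y by (auto simp: quot_sub_def)
    have "y \<in> carrier (fobj hatM Y)" using subspace_subset[OF subfunctorsD(1)[OF G Y]] y by auto
    from quot_fmap[OF X Y \<phi> this] show "fmap hatMU X Y \<phi> A \<in> quot_sub G X"
      using subfunctorsD(2)[OF G X Y \<phi> y(1)] y(2) X by (simp add: quot_sub_def)
  qed
qed (simp add: quot_sub_def)

lemma lift_sub_subfunctor:
  assumes H: "H \<in> subfunctors Q hatMU"
  shows "lift_sub H \<in> subfunctors Q hatM"
  unfolding subfunctors_def
proof (intro CollectI conjI ballI PiE_I)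
  fix X :: "('q, 'e, 'k) h_obj" assume X: "X \<in> h_objs Q"
  show "lift_sub H X \<in> subspaces (fobj hatM X)"
    using quotient_space.subspace_preimage[OF hat_quotient_space[OF M U X]] subfunctorsD(1)[OF H X]
      X
    by (simp add: subspaces_def lift_sub_def quot_fobj)
  fix Y \<phi> assume Y: "Y \<in> h_objs Q" and \<phi>: "\<phi> \<in> h_hom Q X Y"
  show "fmap hatM X Y \<phi> ` lift_sub H Y \<subseteq> lift_sub H X"
  proof (rule image_subsetI)
    fix y assume "y \<in> lift_sub H Y"
    then have y: "y \<in> carrier (fobj hatM Y)" "hcls Y y \<in> H Y" using Y by (auto simp: lift_sub_def)
    have "hcls X (fmap hatM X Y \<phi> y) \<in> H X"
      using subfunctorsD(2)[OF H X Y \<phi> y(2)] quot_fmap[OF X Y \<phi> y(1)] by simp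
    moreover have "fmap hatM X Y \<phi> y \<in> carrier (fobj hatM X)"
      by (rule module_homD(1)[OF hat_fmap_hom[OF M X Y \<phi>] y(1)])
    ultimately show "fmap hatM X Y \<phi> y \<in> lift_sub H X" using X by (simp add: lift_sub_def)
  qed
qed (simp add: lift_sub_def)

lemma quot_sub_lift_sub:
  assumes H: "H \<in> subfunctors Q hatMU" and X: "X \<in> h_objs Q"
  shows "quot_sub (lift_sub H) X = H X"
  using quotient_space.image_preimage[OF hat_quotient_space[OF M U X]] subfunctorsD(1)[OF H X] X
  by (simp add: quot_sub_def lift_sub_def quot_fobj)

lemma hat_sub_in_lift_sub:
  assumes H: "H \<in> subfunctors Q hatMU" and X: "X \<in> h_objs Q"
  shows "hatU X \<subseteq> lift_sub H X"
  using quotient_space.preimage_contains[OF hat_quotient_space[OF M U X]] subfunctorsD(1)[OF H X] X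
  by (simp add: lift_sub_def quot_fobj)

lemma dim_quot_sub:
  assumes G: "G \<in> subfunctors Q hatM" and X: "X \<in> h_objs Q" and UG: "hatU X \<subseteq> G X"
  shows "int (vdim ((fobj hatMU X)\<lparr>carrier := quot_sub G X\<rparr>)) =
    int (vdim ((fobj hatM X)\<lparr>carrier := G X\<rparr>)) - int (vdim (fobj (hat_functor Q (sub_rep M U)) X))"
  using quotient_space.dim_quot[OF hat_quotient_space[OF M U X] hat_fd[OF M X]
    subfunctorsD(1)[OF G X] UG] X
  by (simp add: quot_sub_def quot_fobj hat_sub_rep_fobj)

text \<open>If \<open>H\<close> vanishes at \<open>(P\<^sub>i = P\<^sub>i)\<close>, then its inverse image there is \<open>hat U (P\<^sub>i = P\<^sub>i) = Hom (P\<^sub>i, U)\<close>, and the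
  values at the trivial path fill the space of \<open>U\<close> at \<open>i\<close>.\<close>

lemma res_lift_sub:
  assumes H: "H \<in> subfunctors Q hatMU"
    and dim: "\<And>i. i \<in> verts Q \<Longrightarrow> vdim ((fobj hatMU (proj_obj Q i))\<lparr>carrier := H (proj_obj Q i)\<rparr>) = 0"
  shows "res_sub Q (lift_sub H) = U"
proof (rule extensionalityI)
  show "res_sub Q (lift_sub H) \<in> extensional (verts Q)" by (simp add: res_sub_def)
  show "U \<in> extensional (verts Q)" using U by (auto simp: subreps_def PiE_iff)
  fix i assume i: "i \<in> verts Q"
  let ?X = "proj_obj Q i :: ('q, 'e, 'k) h_obj"
  note X = proj_obj_in[OF i, where 'k = 'k]
  interpret quotient_space "fobj hatM ?X" "hatU ?X" by (rule hat_quotient_space[OF M U X])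
  have "H ?X = {\<zero>\<^bsub>fobj hatMU ?X\<^esub>}"
    using dim_zero_subspace[OF fd_space_quot[OF hat_fd[OF M X]]] subfunctorsD(1)[OF H X] dim[OF i]
    by (simp add: quot_fobj)
  also have "\<dots> = {hatU ?X}" by (simp add: quot_fobj quot_space_def)
  finally have "lift_sub H ?X = {x \<in> carrier (fobj hatM ?X). cls x = hatU ?X}"
    using X by (simp add: lift_sub_def)
  also have "\<dots> = hatU ?X" using cls_eq_W_iff W_carrier by blast
  finally show "res_sub Q (lift_sub H) i = U i" using res_hat_sub[OF M U i] i
    by (simp add: res_sub_def)
qed

end

end

lemma stratum_dim:
  assumes M: "fd_rep Q M" and wf: "wf_digraph Q" and N: "fd_rep Q N" and "stratum Q e M N \<noteq> {}"
    and i: "i \<in> verts Q"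
  shows "vdim (rsp N i) = e i"
proof -
  obtain U0 f where U0: "U0 \<in> rep_gr Q e M" and f: "f \<in> rep_hom Q (sub_rep M U0) N"
    "bij_betw (f i) (carrier (rsp (sub_rep M U0) i)) (carrier (rsp N i))"
    using assms(4) i by (auto simp: stratum_def rep_iso_def)
  have "U0 \<in> subreps Q M" using U0 by (simp add: rep_gr_def)
  from fd_repD(1)[OF sub_rep_fd[OF wf M this] i]
  have "vdim (rsp (sub_rep M U0) i) = vdim (rsp N i)"
    by (rule module_hom_bij_dim[OF _ fd_repD(2)[OF N i] rep_homD(1)[OF f(1) i] f(2)])
  then show ?thesis using U0 i by (simp add: rep_gr_def)
qed

theorem proposition7p4:
  fixes Q :: "('q, 'e) pre_digraph"
    and M :: "('q, 'e, 'k::alg_closed_field, 'm) quiver_rep"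
    and N :: "('q, 'e, 'k, 'n) quiver_rep"
    and e :: "'q \<Rightarrow> nat"
    and U :: "'q \<Rightarrow> 'm set"
  assumes "dynkin_quiver Q"
    and "fd_rep Q M"
    and "N \<in> gsub Q e M"
    and "U \<in> rep_gr Q e M"
  shows "variety_iso
    (functor_gr_point Q (hat_functor Q M) ` pi_fibre Q M N U)
    (functor_gr_point Q (quot_functor (hat_functor Q M) (hat_sub Q M U)) `
       functor_gr Q
         (\<lambda>v. functor_dim Q (hat_functor Q N) v - functor_dim Q (hat_functor Q (sub_rep M U)) v)
         (quot_functor (hat_functor Q M) (hat_sub Q M U)))"
proof -
  interpret path_finite Q by (rule dynkin_path_finite[OF assms(1)])
  note M = assms(2)
  have U: "U \<in> subreps Q M" and dimU: "\<And>i. i \<in> verts Q \<Longrightarrow> vdim (rsp (sub_rep M U) i) = e i"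
    using assms(4) by (auto simp: rep_gr_def)
  have N: "fd_rep Q N" and "stratum Q e M N \<noteq> {}" using assms(3) by (auto simp: gsub_def)
  then have dimN: "\<And>i. i \<in> verts Q \<Longrightarrow> vdim (rsp N i) = e i"
    using stratum_dim[OF M wf_digraph_axioms N] by blast
  let ?hatM = "hat_functor Q M" and ?hatU = "hat_sub Q M U"
  let ?q = "quot_functor ?hatM ?hatU"
  let ?I = "h_vertices Q :: ('q, ('q, 'e, 'k) qrep) h_vertex set"
  let ?V = "\<lambda>v. fobj ?hatM (vertex_obj Q v)" and ?W = "\<lambda>v. ?hatU (vertex_obj Q v)"
  let ?d = "\<lambda>v. functor_dim Q (hat_functor Q N) v - functor_dim Q (hat_functor Q (sub_rep M U)) v"
  let ?F = "pi_fibre Q M N U"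
  let ?A = "(\<lambda>G v. G (vertex_obj Q v)) ` ?F"
  note vo = vertex_obj_in[where 'k = 'k]
  have F: "G \<in> subfunctors Q ?hatM" "res_sub Q G = U"
    "\<And>v. v \<in> ?I \<Longrightarrow> int (vdim ((?V v)\<lparr>carrier := G (vertex_obj Q v)\<rparr>))
      = functor_dim Q (hat_functor Q N) v"
    if "G \<in> ?F" for G
    using that by (auto simp: pi_fibre_def functor_gr_def)
  have UG: "?hatU X \<subseteq> G X" if "G \<in> ?F" "X \<in> h_objs Q" for G X
    using hat_sub_in_subfunctor[OF M U F(1,2)[OF that(1)] that(2)] .
  have iso: "variety_iso (gr_point ?I ?V ` ?A)
    ((\<lambda>A. gr_point ?I (\<lambda>v. quot_space (?V v) (?W v)) (\<lambda>v. (\<lambda>x. ?W v +>\<^bsub>?V v\<^esub> x) ` A v)) ` ?A)"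
  proof (rule grassmannian_quotient_iso)
    show "fd_space (?V v)" if "v \<in> ?I" for v using hat_fd[OF M vo[OF that]] .
    show "is_subspace (?W v) (?V v)" if "v \<in> ?I" for v
      using hat_sub_subspace[OF M U vo[OF that]] .
    show "is_subspace (A v) (?V v) \<and> ?W v \<subseteq> A v" if "A \<in> ?A" "v \<in> ?I" for A v
      using that F(1) UG vo[OF that(2)] subfunctorsD(1) by blast
  qed
  have X: "gr_point ?I ?V ` ?A = functor_gr_point Q ?hatM ` ?F"
    by (simp add: image_image functor_gr_point_def)
  have point: "gr_point ?I (\<lambda>v. quot_space (?V v) (?W v)) (\<lambda>v. (\<lambda>x. ?W v +>\<^bsub>?V v\<^esub> x) ` G
    (vertex_obj Q v))
      = functor_gr_point Q ?q H"
    if "\<And>X. X \<in> h_objs Q \<Longrightarrow> quot_sub M U G X = H X" for G H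
    unfolding functor_gr_point_def quot_fobj[OF M U]
    by (rule gr_point_cong) (use that[OF vo] vo in \<open>simp add: quot_sub_def[OF M U]\<close>)
  have Y: "(\<lambda>A. gr_point ?I (\<lambda>v. quot_space (?V v) (?W v)) (\<lambda>v. (\<lambda>x. ?W v +>\<^bsub>?V v\<^esub> x) ` A v)) ` ?A
      = functor_gr_point Q ?q ` functor_gr Q ?d ?q" (is "?L = ?R")
  proof
    show "?L \<subseteq> ?R"
    proof
      fix y assume "y \<in> ?L"
      then obtain G where G: "G \<in> ?F"
        "y = gr_point ?I (\<lambda>v. quot_space (?V v) (?W v)) (\<lambda>v. (\<lambda>x. ?W v +>\<^bsub>?V v\<^esub> x) ` G
          (vertex_obj Q v))"
        by auto
      have "quot_sub M U G \<in> functor_gr Q ?d ?q"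
        unfolding functor_gr_def
        using quot_sub_subfunctor[OF M U F(1)[OF G(1)]] dim_quot_sub[OF M U F(1)[OF G(1)] vo
          UG[OF G(1) vo]]
          F(3)[OF G(1)] by (auto simp: functor_dim_def)
      then show "y \<in> ?R" using point[of G "quot_sub M U G"] G(2) by blast
    qed
    show "?R \<subseteq> ?L"
    proof
      fix y assume "y \<in> ?R"
      then obtain H where H: "H \<in> functor_gr Q ?d ?q" "y = functor_gr_point Q ?q H" by auto
      then have Hs: "H \<in> subfunctors Q ?q" and Hd: "\<And>v. v \<in> ?I \<Longrightarrow>
          int (vdim ((fobj ?q (vertex_obj Q v))\<lparr>carrier := H (vertex_obj Q v)\<rparr>)) = ?d v"
        by (auto simp: functor_gr_def)
      let ?G = "lift_sub M U H"
      note Gs = lift_sub_subfunctor[OF M U Hs]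
      have "vdim ((fobj ?q (proj_obj Q i))\<lparr>carrier := H (proj_obj Q i)\<rparr>) = 0" if i: "i \<in> verts Q"
        for i
      proof -
        have "PVert i \<in> ?I" using i by (simp add: h_vertices_def)
        \<comment> \<open>both dimensions are \<open>e i\<close>\<close>
        from Hd[OF this] show ?thesis
          using hat_dim_proj_obj[OF N i] hat_dim_proj_obj[OF sub_rep_fd[OF wf_digraph_axioms M U] i]
            dimN[OF i] dimU[OF i]
          by (simp add: functor_dim_def vertex_obj_def)
      qed
      from res_lift_sub[OF M U Hs this] have res: "res_sub Q ?G = U" .
      have "int (vdim ((?V v)\<lparr>carrier := ?G (vertex_obj Q v)\<rparr>)) = functor_dim Q (hat_functor Q N) v"
        if v: "v \<in> ?I" for v
        using dim_quot_sub[OF M U Gs vo[OF v] hat_sub_in_lift_sub[OF M U Hs vo[OF v]]] Hd[OF v]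
          quot_sub_lift_sub[OF M U Hs vo[OF v]] by (simp add: functor_dim_def)
      then have G: "?G \<in> ?F" using Gs res by (simp add: pi_fibre_def functor_gr_def)
      have "y = gr_point ?I (\<lambda>v. quot_space (?V v) (?W v)) (\<lambda>v. (\<lambda>x. ?W v +>\<^bsub>?V v\<^esub> x) ` ?G
        (vertex_obj Q v))"
        unfolding H(2) by (rule point[symmetric]) (rule quot_sub_lift_sub[OF M U Hs])
      then show "y \<in> ?L" unfolding image_image by (rule image_eqI[OF _ G])
    qed
  qed
  show ?thesis using iso unfolding X Y .
qed

end
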